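(* Suppose $T_n=\omega(n)$, and let $\Gamma^{\mathrm c}=[n]\setminus\Gamma$ be a (random) set of size $\lfloor ne^{-T_n/n}\rfloor$ with $\min_{y\in\Gamma^{\mathrm c}}\hat N_{[n],y}\ge\max_{y\in\Gamma}\hat N_{[n],y}$. Then the singular values of $\hat N_\Gamma$ satisfy $$\sigma_i(\hat N_\Gamma)=\begin{cases}\Theta_{\mathbb P}(T_n/n)&\text{if } i\in[K],\\ O_{\mathbb P}(\sqrt{T_n/n})&\text{otherwise.}\end{cases}$$
   Context: Block Markov chain (BMC). Fix $K\ge1$, cluster ratios $\alpha=(\alpha_1,\dots,\alpha_K)$ with $\sum_k\alpha_k=1$ and $\min_k\alpha_k>0$, and a row-stochastic matrix $p=(p_{kl})_{k,l\in[K]}$ with $\min_{k,l}p_{kl}>0$ and $\mathrm{rank}(p)=K$; $\alpha,p,K$ do not depend on $n$. Write $[n]=\{1,\dots,n\}$. For each $n$ (large enough that all clusters are nonempty) the state space $[n]$ is partitioned into clusters $\mathcal V_1,\dots,\mathcal V_K$ with $|\mathcal V_k|=\lfloor n\alpha_k\rfloor$ for $k=2,\dots,K$ and $|\mathcal V_1|=n-\sum_{k=2}^K|\mathcal V_k|$; $\sigma:[n]\to[K]$ maps each state to the index of its cluster. The BMC $\{X_t\}_{t\ge0}$ is the homogeneous Markov chain on $[n]$ with transition matrix $P_{x,y}=p_{\sigma(x),\sigma(y)}/|\mathcal V_{\sigma(y)}|$; $\Pi$ denotes its unique stationary distribution, and $X_0$ has distribution $\Pi$. Given positive integers $T_n$,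 $\hat N$ is the random $n\times n$ matrix of transition counts $\hat N_{xy}=\sum_{t=0}^{T_n-1}\mathbf 1[X_t=x,X_{t+1}=y]$. Put $\hat N_{[n],y}=\sum_{x\in[n]}\hat N_{x,y}$. For a (possibly random) $\Gamma\subseteq[n]$, the trimmed matrix $\hat N_\Gamma$ has entries $(\hat N_\Gamma)_{x,y}=\hat N_{x,y}$ if $x,y\in\Gamma$ and $0$ otherwise. If $\Gamma^{\mathrm c}$ is empty the condition on it is void. $\sigma_1(A)\ge\dots\ge\sigma_n(A)$ are the singular values of an $n\times n$ matrix $A$ (not to be confused with the cluster map $\sigma$). $X_n=O_{\mathbb P}(Y_n)$ means: for every $\epsilon>0$ there are $C_\epsilon,n_\epsilon>0$ with $\mathbb P[|X_n/Y_n|>C_\epsilon]\le\epsilon$ for all $n>n_\epsilon$; $X_n=\Theta_{\mathbb P}(Y_n)$ means $X_n=O_{\mathbb P}(Y_n)$ and $Y_n=O_{\mathbb P}(X_n)$. $T_n=\omega(n)$ means $T_n/n\to\infty$. *)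

theory Defs
  imports "HOL-Probability.Probability" "Jordan_Normal_Form.Char_Poly" "Jordan_Normal_Form.DL_Rank"
begin

text \<open>States and clusters are numbered from 0, like the rows and columns of a matrix: the state
  space is \<open>{..<n}\<close>, the clusters are indexed by \<open>{..<K}\<close>, and cluster 0 is the one that
  absorbs the rounding. Singular values, in contrast, are numbered from 1.\<close>

definition bmc_parameters :: "nat \<Rightarrow> (nat \<Rightarrow> real) \<Rightarrow> real mat \<Rightarrow> bool" where
  "bmc_parameters K \<alpha> p \<longleftrightarrow>
     K \<ge> 1 \<and> (\<Sum>k<K. \<alpha> k) = 1 \<and> (\<forall>k<K. \<alpha> k > 0) \<and>
     p \<in> carrier_mat K K \<and> (\<forall>k<K. \<forall>l<K. p $$ (k, l) > 0) \<and> (\<forall>k<K. (\<Sum>l<K. p $$ (k, l)) = 1) \<and>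
     vec_space.rank K p = K"

definition cluster_size :: "nat \<Rightarrow> (nat \<Rightarrow> real) \<Rightarrow> nat \<Rightarrow> nat \<Rightarrow> nat" where
  "cluster_size K \<alpha> n k =
     (if k = 0 then n - (\<Sum>l\<in>{1..<K}. nat \<lfloor>real n * \<alpha> l\<rfloor>) else nat \<lfloor>real n * \<alpha> k\<rfloor>)"

definition cluster :: "nat \<Rightarrow> (nat \<Rightarrow> nat) \<Rightarrow> nat \<Rightarrow> nat set" where
  "cluster n \<sigma> k = {x. x < n \<and> \<sigma> x = k}"

definition cluster_map :: "nat \<Rightarrow> (nat \<Rightarrow> real) \<Rightarrow> nat \<Rightarrow> (nat \<Rightarrow> nat) \<Rightarrow> bool" where
  "cluster_map K \<alpha> n \<sigma> \<longleftrightarrow>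
     (\<forall>x<n. \<sigma> x < K) \<and> (\<forall>k<K. card (cluster n \<sigma> k) = cluster_size K \<alpha> n k)"

definition bmc_transition :: "real mat \<Rightarrow> nat \<Rightarrow> (nat \<Rightarrow> nat) \<Rightarrow> real mat" where
  "bmc_transition p n \<sigma> =
     mat n n (\<lambda>(x, y). p $$ (\<sigma> x, \<sigma> y) / real (card (cluster n \<sigma> (\<sigma> y))))"

definition stationary_distribution :: "nat \<Rightarrow> real mat \<Rightarrow> (nat \<Rightarrow> real) \<Rightarrow> bool" where
  "stationary_distribution n P \<pi> \<longleftrightarrow>
     (\<forall>x<n. \<pi> x \<ge> 0) \<and> (\<Sum>x<n. \<pi> x) = 1 \<and> (\<forall>y<n. (\<Sum>x<n. \<pi> x * P $$ (x, y)) = \<pi> y)"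

definition markov_chain ::
    "'a measure \<Rightarrow> nat \<Rightarrow> real mat \<Rightarrow> (nat \<Rightarrow> real) \<Rightarrow> (nat \<Rightarrow> 'a \<Rightarrow> nat) \<Rightarrow> bool" where
  "markov_chain M n P \<pi> X \<longleftrightarrow>
     prob_space M \<and> (\<forall>t. X t \<in> measurable M (count_space {..<n})) \<and>
     (\<forall>x<n. \<P>(\<omega> in M. X 0 \<omega> = x) = \<pi> x) \<and>
     (\<forall>t z. \<forall>y<n. \<P>(\<omega> in M. \<forall>s\<le>t. X s \<omega> = z s) > 0 \<longrightarrow>
        \<P>(\<omega> in M. X (Suc t) \<omega> = y \<bar> \<forall>s\<le>t. X s \<omega> = z s) = P $$ (z t, y))"

text \<open>The stationary distribution of the (irreducible) chain is unique, so it need not be singled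
  out further.\<close>

definition block_markov_chain ::
    "'a measure \<Rightarrow> real mat \<Rightarrow> nat \<Rightarrow> (nat \<Rightarrow> nat) \<Rightarrow> (nat \<Rightarrow> 'a \<Rightarrow> nat) \<Rightarrow> bool" where
  "block_markov_chain M p n \<sigma> X \<longleftrightarrow>
     (\<exists>\<pi>. stationary_distribution n (bmc_transition p n \<sigma>) \<pi> \<and>
          markov_chain M n (bmc_transition p n \<sigma>) \<pi> X)"

definition transition_count :: "nat \<Rightarrow> (nat \<Rightarrow> 'a \<Rightarrow> nat) \<Rightarrow> 'a \<Rightarrow> nat \<Rightarrow> nat \<Rightarrow> nat" where
  "transition_count T X \<omega> x y = card {t. t < T \<and> X t \<omega> = x \<and> X (Suc t) \<omega> = y}"

definition column_count :: "nat \<Rightarrow> nat \<Rightarrow> (nat \<Rightarrow> 'a \<Rightarrow> nat) \<Rightarrow> 'a \<Rightarrow> nat \<Rightarrow> nat" where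
  "column_count n T X \<omega> y = (\<Sum>x<n. transition_count T X \<omega> x y)"

definition trimmed_count_matrix ::
    "nat \<Rightarrow> nat \<Rightarrow> (nat \<Rightarrow> 'a \<Rightarrow> nat) \<Rightarrow> nat set \<Rightarrow> 'a \<Rightarrow> real mat" where
  "trimmed_count_matrix n T X G \<omega> =
     mat n n (\<lambda>(x, y). if x \<in> G \<and> y \<in> G then real (transition_count T X \<omega> x y) else 0)"

text \<open>The trimming condition on a realisation \<open>G\<close> of \<open>\<Gamma>\<close>. The requirement on the counts is
  void if nothing is removed; \<open>G\<close> itself is nonempty as soon as \<open>n > 0\<close> and \<open>T > 0\<close>.\<close>

definition trimming :: "nat \<Rightarrow> nat \<Rightarrow> (nat \<Rightarrow> 'a \<Rightarrow> nat) \<Rightarrow> nat set \<Rightarrow> 'a \<Rightarrow> bool" where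
  "trimming n T X G \<omega> \<longleftrightarrow>
     card ({..<n} - G) = nat \<lfloor>real n * exp (- (real T / real n))\<rfloor> \<and>
     ({..<n} - G \<noteq> {} \<longrightarrow>
        Min (column_count n T X \<omega> ` ({..<n} - G)) \<ge> Max (column_count n T X \<omega> ` G))"

text \<open>\<open>singular_value A i\<close> is the \<open>i\<close>-th largest singular value (\<open>1 \<le> i \<le> n\<close>, with multiplicity)
  of a real square matrix of size \<open>n\<close>: the square roots of the eigenvalues of \<open>A\<^sup>T A\<close>. As
  \<open>A\<^sup>T A\<close> is symmetric, its characteristic polynomial has \<open>n\<close> real roots.\<close>

definition singular_value :: "real mat \<Rightarrow> nat \<Rightarrow> real" where
  "singular_value A i =
     rev (sorted_list_of_multiset
       (image_mset sqrt (proots (char_poly (transpose_mat A * A))))) ! (i - 1)"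

text \<open>The events \<open>\<bar>X\<^sub>n / Y\<^sub>n\<bar> > C\<close> are written without division: as \<open>x / 0 = 0\<close> in HOL, a quotient
  would count the outcomes with \<open>Y\<^sub>n = 0 \<noteq> X\<^sub>n\<close> (an infinite ratio) as harmless.\<close>

definition bigo_prob ::
    "(nat \<Rightarrow> 'a measure) \<Rightarrow> (nat \<Rightarrow> 'a \<Rightarrow> real) \<Rightarrow> (nat \<Rightarrow> 'a \<Rightarrow> real) \<Rightarrow> bool" where
  "bigo_prob M X Y \<longleftrightarrow>
     (\<forall>\<epsilon>>0. \<exists>C>0. \<exists>n0>0. \<forall>n>n0. \<P>(\<omega> in M n. \<bar>X n \<omega>\<bar> > C * \<bar>Y n \<omega>\<bar>) \<le> \<epsilon>)"

definition bigtheta_prob ::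
    "(nat \<Rightarrow> 'a measure) \<Rightarrow> (nat \<Rightarrow> 'a \<Rightarrow> real) \<Rightarrow> (nat \<Rightarrow> 'a \<Rightarrow> real) \<Rightarrow> bool" where
  "bigtheta_prob M X Y \<longleftrightarrow> bigo_prob M X Y \<and> bigo_prob M Y X"

end

theory Submission
  imports Defs "Jordan_Normal_Form.Schur_Decomposition" "HOL-Library.Discrete_Functions"
    "HOL-Real_Asymp.Real_Asymp"
begin

text \<open>Write \<open>d = T / n\<close>, let \<open>N\<close> be the count matrix, \<open>R x\<close> its row sums and \<open>P\<close> the transition
  matrix. The differences \<open>N x y - R x * P x y\<close> are terminal values of martingales, and the matrix
  \<open>R x * P x y\<close> has rank at most \<open>K\<close> because \<open>P\<close> is constant on blocks. Centering by it rather
  than by the expectation of \<open>N\<close> makes mixing estimates unnecessary: the only probabilistic input is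
  a Chernoff bound for sums of \<open>h (X t) (X (t + 1))\<close> with \<open>(\<Sum>y. P x y * exp (h x y)) \<le> 1\<close>.

  The trimming leaves rows and columns with sums of order \<open>d\<close>. On these the centered matrix has
  norm of order \<open>sqrt d\<close>, by the method of Feige and Ofek: on a net of the unit ball, the pairs
  \<open>(x, y)\<close> with \<open>\<bar>u x * v y\<bar> < sqrt d / (16 * n)\<close> are handled by the martingale bound, the other ones
  by a discrepancy property of the counts, valid for all pairs of sets of states. This bounds
  the singular values beyond the \<open>K\<close>-th. Conversely \<open>R x * P x y\<close> is of order \<open>d\<close> on the span of the
  indicators of the clusters, since \<open>p\<close> is invertible and every set containing a fixed fraction of the
  states is visited a number of times of order \<open>T\<close>; the centered part is negligible there.\<close>

text \<open>The removed set is a function of the whole trajectory, so no estimate can treat it as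
  given in advance. All tail bounds are therefore made uniform over net vectors or over sets of
  states, and \<open>\<Gamma> \<omega>\<close> is inserted only afterwards, outside one bad set, by
  a deterministic argument. Centering by \<open>R x * P x y\<close> has a price: the compensators of
  the exponential supermartingales are weighted row sums, which are random. Upper bounds on those
  row sums are hence written into the events whose probability is estimated; they hold for the
  states that survive the trimming. The trimming itself only sees column sums; these control the row
  sums because along a path the departures from and the arrivals in any set of states differ by at
  most one. The passage from norms to singular values is by min-max, with two test spaces: the
  vectors whose sum over each trimmed cluster vanishes, where \<open>R x * P x y\<close> contributes
  nothing, and the span of the indicators of the trimmed clusters.\<close>

unbundle no inner_syntax

section \<open>Singular values of real matrices\<close>

lemma orthonormal_completion:
  fixes v :: "real vec"
  assumes v: "v \<in> carrier_vec n" and v0: "v \<noteq> 0\<^sub>v n"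
  obtains W c where "W \<in> carrier_mat n n" "transpose_mat W * W = 1\<^sub>m n" "col W 0 = c \<cdot>\<^sub>v v"
proof -
  interpret cof_vec_space n "TYPE(real)" .
  define b where "b = basis_completion v"
  define ws where "ws = gram_schmidt n b"
  from basis_completion[OF v v0, folded b_def]
  have dist_b: "distinct b" and indep: "\<not> lin_dep (set b)" and b: "set b \<subseteq> carrier_vec n"
    and hdb: "hd b = v" and len_b: "length b = n" by auto
  have n0: "n > 0"
    using v v0 by (cases n) auto
  with hdb len_b obtain vs where bv: "b = v # vs" by (cases b) auto
  from gram_schmidt_result[OF b dist_b indep refl, folded ws_def]
  have ws: "set ws \<subseteq> carrier_vec n" "corthogonal ws" "length ws = n" by (auto simp: len_b)
  from gram_schmidt_hd[OF v, of vs, folded bv] have "hd ws = v" unfolding ws_def .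
  then have w0: "ws ! 0 = v"
    using ws(3) n0 by (simp add: hd_conv_nth flip: length_greater_0_conv)
  have wc: "ws ! j \<in> carrier_vec n" if "j < n" for j
    using ws that by (meson nth_mem subsetD)
  define r where "r j = sqrt (ws ! j \<bullet> ws ! j)" for j
  define W where "W = mat n n (\<lambda>(i, j). ws ! j $ i / r j)"
  have orth: "(ws ! i \<bullet> ws ! j = 0) = (i \<noteq> j)" if "i < n" "j < n" for i j
    using corthogonalD[OF ws(2), of i j] that ws(3) by simp
  have pos: "ws ! j \<bullet> ws ! j > 0" if "j < n" for j
  proof -
    have "ws ! j \<bullet> ws ! j \<ge> 0" by (auto simp: scalar_prod_def intro!: sum_nonneg)
    then show ?thesis using orth[OF that that] by simp
  qed
  have colW: "col W j = (1 / r j) \<cdot>\<^sub>v ws ! j" if "j < n" for j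
    using that wc[OF that] unfolding W_def by (intro eq_vecI) auto
  have W: "W \<in> carrier_mat n n" by (simp add: W_def)
  have "transpose_mat W * W = 1\<^sub>m n"
  proof (rule eq_matI)
    fix i j assume "i < dim_row (1\<^sub>m n :: real mat)" "j < dim_col (1\<^sub>m n :: real mat)"
    then have ij: "i < n" "j < n" by auto
    have "(transpose_mat W * W) $$ (i, j) = col W i \<bullet> col W j"
      using ij W by simp
    also have "\<dots> = (ws ! i \<bullet> ws ! j) / (r i * r j)"
      unfolding colW[OF ij(1)] colW[OF ij(2)] using wc[OF ij(1)] wc[OF ij(2)] by simp
    also have "\<dots> = 1\<^sub>m n $$ (i, j)"
      using orth[OF ij] pos[OF ij(1)] ij by (auto simp: r_def)
    finally show "(transpose_mat W * W) $$ (i, j) = 1\<^sub>m n $$ (i, j)" .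
  qed (use W in auto)
  with W colW[OF n0] w0 that show thesis by auto
qed

text \<open>Over the complex numbers the characteristic polynomial splits. Its roots are real
  because symmetry turns \<open>a * (v \<bullet> conjugate v)\<close> into
  \<open>conjugate a * (v \<bullet> conjugate v)\<close> for an eigenvector \<open>v\<close>, so the
  factorization descends to the reals.\<close>

lemma symmetric_char_poly_splits:
  fixes S :: "real mat"
  assumes S: "S \<in> carrier_mat n n" and sym: "transpose_mat S = S"
  shows "\<exists>es. char_poly S = (\<Prod>e\<leftarrow>es. [:- e, 1:]) \<and> length es = n"
proof -
  let ?h = "map_mat complex_of_real"
  obtain as where as: "char_poly (?h S) = (\<Prod>a\<leftarrow>as. [:- a, 1:])" "length as = n"
    using char_poly_factorized[of "?h S" n] S by auto
  have real: "a \<in> \<real>" if "a \<in> set as" for a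
  proof -
    have "eigenvalue (?h S) a"
      using that S by (subst eigenvalue_root_char_poly[of _ n]) (auto simp: as(1) poly_prod_list prod_list_zero_iff)
    then obtain v where v: "v \<in> carrier_vec n" "v \<noteq> 0\<^sub>v n" "?h S *\<^sub>v v = a \<cdot>\<^sub>v v"
      using S unfolding eigenvalue_def eigenvector_def by auto
    have cv: "conjugate v \<in> carrier_vec n" using v by auto
    have hS: "?h S \<in> carrier_mat n n" using S by auto
    have symh: "transpose_mat (?h S) = ?h S" using sym by (metis map_mat_transpose)
    have sv: "?h S *\<^sub>v conjugate v = conjugate a \<cdot>\<^sub>v conjugate v"
    proof -
      have "(?h S *\<^sub>v conjugate v) $ i = cnj ((?h S *\<^sub>v v) $ i)" if "i < n" for i
        using v(1) S that by (simp add: scalar_prod_def)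
      then show ?thesis using v S by (intro eq_vecI) auto
    qed
    have "a * (v \<bullet> conjugate v) = (?h S *\<^sub>v v) \<bullet> conjugate v"
      using v cv by simp
    also have "\<dots> = v \<bullet> (?h S *\<^sub>v conjugate v)"
      using transpose_vec_mult_scalar[OF hS cv v(1)] v cv hS symh
      by (simp add: comm_scalar_prod[of _ n])
    also have "\<dots> = conjugate a * (v \<bullet> conjugate v)"
      using sv v cv by simp
    finally have "a = conjugate a"
      using v by (auto simp: conjugate_square_eq_0_vec[of _ n])
    then show ?thesis by (simp add: Reals_cnj_iff)
  qed
  define es where "es = map Re as"
  have aes: "as = map complex_of_real es"
    using real unfolding es_def by (auto simp: o_def intro!: map_idI[symmetric])
  interpret cr: map_poly_inj_idom_hom complex_of_real ..
  have "map_poly complex_of_real (char_poly S) = char_poly (?h S)"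
    by (rule of_real_hom.char_poly_hom[OF S, symmetric])
  also have "\<dots> = map_poly complex_of_real (\<Prod>e\<leftarrow>es. [:- e, 1:])"
    unfolding as(1) aes by (simp add: cr.hom_prod_list o_def)
  finally have "char_poly S = (\<Prod>e\<leftarrow>es. [:- e, 1:])" by simp
  then show ?thesis using as(2) es_def by (intro exI[of _ es]) auto
qed

text \<open>Deflation along the list \<open>es\<close>: an orthogonal matrix whose first column is
  proportional to an eigenvector for \<open>e\<close> makes \<open>S\<close> block diagonal, the
  first row vanishing by symmetry, and the characteristic polynomial of the remaining block belongs
  to the tail of the list. The eigenvalues appear in the order of \<open>es\<close>, which lets the
  caller prescribe a decreasing one.\<close>

lemma symmetric_diagonalization:
  fixes S :: "real mat"
  assumes "S \<in> carrier_mat n n" "transpose_mat S = S" "char_poly S = (\<Prod>e\<leftarrow>es. [:- e, 1:])"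
  shows "\<exists>P \<in> carrier_mat n n. transpose_mat P * P = 1\<^sub>m n \<and>
           S * P = P * mat n n (\<lambda>(i, j). if i = j then es ! i else 0)"
  using assms
proof (induction es arbitrary: n S)
  case Nil
  then have "n = 0" using degree_monic_char_poly[of S n] by auto
  then show ?case using Nil by (intro bexI[of _ "1\<^sub>m 0"]) auto
next
  case (Cons e es)
  note S = Cons.prems(1) and sym = Cons.prems(2)
  have "degree (char_poly S) = Suc (degree (\<Prod>e\<leftarrow>es. [:- e, 1:]))"
    unfolding Cons.prems(3) list.map prod_list.Cons
    by (subst degree_mult_eq) (auto simp: prod_list_zero_iff)
  then obtain m where n: "n = Suc m"
    using degree_monic_char_poly[OF S] by auto
  have "eigenvalue S e"
    unfolding eigenvalue_root_char_poly[OF S] Cons.prems(3) by simp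
  then obtain v where v: "v \<in> carrier_vec n" "v \<noteq> 0\<^sub>v n" "S *\<^sub>v v = e \<cdot>\<^sub>v v"
    using S unfolding eigenvalue_def eigenvector_def by auto
  obtain W c where W: "W \<in> carrier_mat n n" and WW: "transpose_mat W * W = 1\<^sub>m n"
    and col0: "col W 0 = c \<cdot>\<^sub>v v"
    by (rule orthonormal_completion[OF v(1,2)])
  have WW': "W * transpose_mat W = 1\<^sub>m n"
    by (rule mat_mult_left_right_inverse[OF _ W WW]) (use W in auto)
  define S' where "S' = transpose_mat W * (S * W)"
  have S': "S' \<in> carrier_mat n n" using W S by (auto simp: S'_def)
  have sym': "transpose_mat S' = S'"
    unfolding S'_def using W S sym
    by (simp add: transpose_mult[of _ n n _ n] assoc_mult_mat[of _ n n _ n _ n])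
  have SW: "S * W = W * S'"
    unfolding S'_def using W S WW'
    by (simp add: assoc_mult_mat[of W n n "transpose_mat W" n "S * W" n, symmetric])
  have colS': "col S' 0 = e \<cdot>\<^sub>v unit_vec n 0"
  proof -
    have tW0: "transpose_mat W \<in> carrier_mat n n" using W by simp
    have cW0: "col W 0 \<in> carrier_vec n" using W by (intro carrier_vecI) simp
    have "col S' 0 = transpose_mat W *\<^sub>v (S *\<^sub>v col W 0)"
      unfolding S'_def using W S n
      by (simp only: col_mult2[OF _ mult_carrier_mat[OF S W]] col_mult2[OF S W] transpose_carrier_mat zero_less_Suc)
    moreover have "S *\<^sub>v col W 0 = e \<cdot>\<^sub>v col W 0"
      unfolding col0 using v S by (simp add: mult_mat_vec[of _ n n] smult_smult_assoc mult.commute)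
    moreover have "transpose_mat W *\<^sub>v (e \<cdot>\<^sub>v col W 0) = e \<cdot>\<^sub>v (transpose_mat W *\<^sub>v col W 0)"
      by (rule mult_mat_vec[OF tW0 cW0])
    moreover have "transpose_mat W *\<^sub>v col W 0 = col (transpose_mat W * W) 0"
      by (rule col_mult2[OF tW0 W, symmetric]) (simp add: n)
    ultimately have "col S' 0 = e \<cdot>\<^sub>v col (1\<^sub>m n) 0"
      unfolding WW by (simp only:)
    then show ?thesis using n by simp
  qed
  have c0: "S' $$ (i, 0) = (if i = 0 then e else 0)" if "i < n" for i
    using arg_cong[OF colS', of "\<lambda>u. u $ i"] that S' n by auto
  have r0: "S' $$ (0, i) = (if i = 0 then e else 0)" if "i < n" for i
    using c0[OF that] arg_cong[OF sym', of "\<lambda>A. A $$ (i, 0)"] S' that n by auto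
  define S3 where "S3 = mat m m (\<lambda>(i, j). S' $$ (Suc i, Suc j))"
  define E where "E = mat 1 1 (\<lambda>_. e)"
  have S3: "S3 \<in> carrier_mat m m" and E: "E \<in> carrier_mat 1 1"
    by (auto simp: S3_def E_def)
  have blk: "S' = four_block_mat E (0\<^sub>m 1 m) (0\<^sub>m m 1) S3"
    using S' c0 r0 n by (intro eq_matI) (auto simp: S3_def E_def)
  have sym3: "transpose_mat S3 = S3"
  proof (rule eq_matI)
    fix i j assume "i < dim_row S3" "j < dim_col S3"
    then have ij: "i < m" "j < m" using S3 by auto
    then show "transpose_mat S3 $$ (i, j) = S3 $$ (i, j)"
      using arg_cong[OF sym', of "\<lambda>A. A $$ (Suc i, Suc j)"] S' n by (simp add: S3_def)
  qed (use S3 in auto)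
  have "similar_mat S' S"
    unfolding similar_mat_def
    by (rule exI[of _ "transpose_mat W"], rule exI[of _ W], rule similar_mat_witI[of _ _ n])
       (use W S S' WW WW' in \<open>auto simp: S'_def assoc_mult_mat[of _ n n _ n _ n]\<close>)
  then have cp1: "char_poly S' = [:- e, 1:] * (\<Prod>e\<leftarrow>es. [:- e, 1:])"
    using char_poly_similar Cons.prems(3) by force
  have cp2: "char_poly S' = char_poly E * char_poly S3"
    unfolding blk by (rule char_poly_four_block_zeros_col[OF E _ S3]) auto
  have cp3: "char_poly E = [:- e, 1:]"
    by (simp add: E_def char_poly_defs det_def sign_def)
  have ne0: "[:- e, 1:] \<noteq> 0" by simp
  have cp4: "[:- e, 1:] * char_poly S3 = [:- e, 1:] * (\<Prod>e\<leftarrow>es. [:- e, 1:])"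
    using cp2 unfolding cp1 cp3 by (rule HOL.sym)
  have "char_poly S3 = (\<Prod>e\<leftarrow>es. [:- e, 1:])"
    by (rule iffD1[OF mult_left_cancel[OF ne0] cp4])
  from Cons.IH[OF S3 sym3 this] obtain P3 where P3: "P3 \<in> carrier_mat m m"
    and PP3: "transpose_mat P3 * P3 = 1\<^sub>m m"
    and SP3: "S3 * P3 = P3 * mat m m (\<lambda>(i, j). if i = j then es ! i else 0)" by blast
  define D3 where "D3 = mat m m (\<lambda>(i, j). if i = j then es ! i else 0)"
  have D3: "D3 \<in> carrier_mat m m" by (simp add: D3_def)
  define Q where "Q = four_block_mat (1\<^sub>m 1) (0\<^sub>m 1 m) (0\<^sub>m m 1) P3"
  define D where "D = four_block_mat E (0\<^sub>m 1 m) (0\<^sub>m m 1) D3"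
  have Q: "Q \<in> carrier_mat n n" and D: "D \<in> carrier_mat n n"
    using P3 E D3 n by (auto simp: Q_def D_def)
  have Deq: "D = mat n n (\<lambda>(i, j). if i = j then (e # es) ! i else 0)"
    using n by (intro eq_matI) (auto simp: D_def D3_def E_def nth_Cons')
  have tQ: "transpose_mat Q = four_block_mat (1\<^sub>m 1) (0\<^sub>m 1 m) (0\<^sub>m m 1) (transpose_mat P3)"
    unfolding Q_def using P3 by (subst transpose_four_block_mat) auto
  have QQ: "transpose_mat Q * Q = 1\<^sub>m n"
    unfolding tQ unfolding Q_def n using P3 PP3
    by (subst mult_four_block_mat[of _ 1 1 _ m _ m _ _ 1 _ m]) auto
  have SQ: "S' * Q = Q * D"
    unfolding blk Q_def D_def using P3 E S3 D3 SP3[folded D3_def]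
    by (simp add: mult_four_block_mat[of _ 1 1 _ m _ m _ _ 1 _ m])
  have WQ: "W * Q \<in> carrier_mat n n" and tW: "transpose_mat W \<in> carrier_mat n n"
    and tQ': "transpose_mat Q \<in> carrier_mat n n"
    using W Q by auto
  have "transpose_mat (W * Q) * (W * Q) = transpose_mat Q * (transpose_mat W * (W * Q))"
    unfolding transpose_mult[OF W Q] by (rule assoc_mult_mat[OF tQ' tW WQ])
  also have "transpose_mat W * (W * Q) = Q"
    unfolding assoc_mult_mat[OF tW W Q, symmetric] WW by (rule left_mult_one_mat[OF Q])
  finally have 1: "transpose_mat (W * Q) * (W * Q) = 1\<^sub>m n" unfolding QQ .
  have "S * (W * Q) = (W * S') * Q"
    unfolding assoc_mult_mat[OF S W Q, symmetric] SW ..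
  then have 2: "S * (W * Q) = W * Q * D"
    unfolding assoc_mult_mat[OF W S' Q] SQ assoc_mult_mat[OF W Q D] .
  show ?case
    by (intro bexI[of _ "W * Q"] conjI 1 2[unfolded Deq] WQ)
qed

section \<open>Min-max bounds for singular values\<close>

lemma vec_nonzero_index:
  fixes v :: "real vec"
  assumes "v \<in> carrier_vec n" "v \<noteq> 0\<^sub>v n"
  obtains i where "i < n" "v $ i \<noteq> 0"
proof -
  have "\<exists>i<n. v $ i \<noteq> 0"
  proof (rule ccontr)
    assume "\<not> (\<exists>i<n. v $ i \<noteq> 0)"
    then have "v = 0\<^sub>v n" using assms(1) by (intro eq_vecI) auto
    with assms(2) show False by simp
  qed
  with that show thesis by blast
qed

text \<open>Padded with zero rows to a square matrix, \<open>F\<close> becomes singular: the last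
  row is zero because \<open>r < n\<close>.\<close>

lemma underdetermined_system:
  fixes F :: "real mat"
  assumes F: "F \<in> carrier_mat r n" and r: "r < n"
  obtains v where "v \<in> carrier_vec n" "v \<noteq> 0\<^sub>v n" "F *\<^sub>v v = 0\<^sub>v r"
proof -
  define G where "G = mat n n (\<lambda>(i, j). if i < r then F $$ (i, j) else 0)"
  have G: "G \<in> carrier_mat n n" by (simp add: G_def)
  have "transpose_mat G *\<^sub>v unit_vec n (n - 1) = 0\<^sub>v n"
    using r by (intro eq_vecI) (auto simp: G_def scalar_prod_right_unit[of _ n])
  moreover have "unit_vec n (n - 1) \<noteq> (0\<^sub>v n :: real vec)"
    using r by (intro unit_vec_nonzero) simp
  ultimately have "det (transpose_mat G) = 0"
    using G by (subst det_0_iff_vec_prod_zero_field[of _ n]) (auto intro!: exI[of _ "unit_vec n (n - 1)"])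
  then have "det G = 0" using det_transpose[OF G] by simp
  then obtain v where v: "v \<in> carrier_vec n" "v \<noteq> 0\<^sub>v n" "G *\<^sub>v v = 0\<^sub>v n"
    using det_0_iff_vec_prod_zero_field[OF G] by blast
  have "F *\<^sub>v v = 0\<^sub>v r"
  proof (rule eq_vecI)
    fix i assume "i < dim_vec (0\<^sub>v r :: real vec)"
    then have i: "i < r" by simp
    have "row F i = row G i"
      using i F G r by (intro eq_vecI) (auto simp: G_def)
    then show "(F *\<^sub>v v) $ i = 0\<^sub>v r $ i"
      using arg_cong[OF v(3), of "\<lambda>u. u $ i"] i r F G by simp
  qed (use F in auto)
  with v that show thesis by blast
qed

text \<open>The eigenvalues of \<open>A\<^sup>T A\<close> are sorted decreasingly before
  diagonalizing, so that \<open>es ! (i - 1)\<close> matches the indexing of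
  \<open>singular_value\<close> and the columns of \<open>P\<close> are right singular vectors in
  the same order.\<close>

lemma singular_values_diagonalize:
  assumes A: "A \<in> carrier_mat n n"
  obtains P es where "P \<in> carrier_mat n n" "transpose_mat P * P = 1\<^sub>m n" "length es = n"
    "sorted_wrt (\<ge>) es" "\<And>i. 1 \<le> i \<Longrightarrow> i \<le> n \<Longrightarrow> singular_value A i = sqrt (es ! (i - 1))"
    "\<And>z. z \<in> carrier_vec n \<Longrightarrow>
       (A *\<^sub>v (P *\<^sub>v z)) \<bullet> (A *\<^sub>v (P *\<^sub>v z)) = (\<Sum>j<n. es ! j * (z $ j)\<^sup>2)"
proof -
  define S where "S = transpose_mat A * A"
  have S: "S \<in> carrier_mat n n" using A by (simp add: S_def)
  have sym: "transpose_mat S = S" using A by (simp add: S_def transpose_mult[of _ n n _ n])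
  obtain es0 where es0: "char_poly S = (\<Prod>e\<leftarrow>es0. [:- e, 1:])" "length es0 = n"
    using symmetric_char_poly_splits[OF S sym] by blast
  define es where "es = rev (sort es0)"
  have "mset es = mset es0" by (simp add: es_def)
  then have "(\<Prod>e\<leftarrow>es. [:- e, 1:]) = (\<Prod>e\<leftarrow>es0. [:- e, 1:])"
    unfolding prod_mset_prod_list[symmetric] mset_map by simp
  with es0 have cp: "char_poly S = (\<Prod>e\<leftarrow>es. [:- e, 1:])" by simp
  have len: "length es = n" using es0 by (simp add: es_def)
  have sorted: "sorted_wrt (\<ge>) es"
    unfolding es_def sorted_wrt_rev by simp
  obtain P where P: "P \<in> carrier_mat n n" "transpose_mat P * P = 1\<^sub>m n"
    and SP: "S * P = P * mat n n (\<lambda>(i, j). if i = j then es ! i else 0)"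
    using symmetric_diagonalization[OF S sym cp] by blast
  have proots: "proots (\<Prod>e\<leftarrow>xs. [:- e, 1:]) = mset xs" for xs :: "real list"
  proof (induction xs)
    case (Cons x xs)
    have "(\<Prod>e\<leftarrow>xs. [:- e, 1:]) \<noteq> 0" by (auto simp: prod_list_zero_iff)
    then show ?case
      using Cons by (simp add: proots_mult del: mult_pCons_left)
  qed simp
  have "sorted (rev (map sqrt es))"
    using sorted unfolding sorted_wrt_rev sorted_wrt_map
    by (rule sorted_wrt_mono_rel[rotated]) simp
  then have "sort (map sqrt es) = rev (map sqrt es)"
    by (intro properties_for_sort) simp_all
  then have "rev (sorted_list_of_multiset (image_mset sqrt (proots (char_poly S)))) = map sqrt es"
    unfolding cp proots mset_map[symmetric] sorted_list_of_multiset_mset by simp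
  then have sv: "singular_value A i = sqrt (es ! (i - 1))" if "1 \<le> i" "i \<le> n" for i
    unfolding singular_value_def S_def[symmetric] using that len by simp
  have quad: "(A *\<^sub>v (P *\<^sub>v z)) \<bullet> (A *\<^sub>v (P *\<^sub>v z)) = (\<Sum>j<n. es ! j * (z $ j)\<^sup>2)"
    if z: "z \<in> carrier_vec n" for z
  proof -
    define D where "D = mat n n (\<lambda>(i, j). if i = j then es ! i else 0)"
    have D: "D \<in> carrier_mat n n" by (simp add: D_def)
    define v where "v = P *\<^sub>v z"
    have v: "v \<in> carrier_vec n" using P z by (simp add: v_def)
    have Dz: "D *\<^sub>v z \<in> carrier_vec n" using D z by simp
    have "S *\<^sub>v v = (S * P) *\<^sub>v z" using S P z by (simp add: v_def)
    also have "\<dots> = P *\<^sub>v (D *\<^sub>v z)" unfolding SP D_def[symmetric] using P D z by simp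
    finally have Sv: "S *\<^sub>v v = P *\<^sub>v (D *\<^sub>v z)" .
    have Av: "A *\<^sub>v v \<in> carrier_vec n" using A v by simp
    have "(A *\<^sub>v v) \<bullet> (A *\<^sub>v v) = (transpose_mat A *\<^sub>v (A *\<^sub>v v)) \<bullet> v"
      using transpose_vec_mult_scalar[OF A v Av] by simp
    also have "transpose_mat A *\<^sub>v (A *\<^sub>v v) = P *\<^sub>v (D *\<^sub>v z)"
      using Sv A v by (simp add: S_def)
    also have "(P *\<^sub>v (D *\<^sub>v z)) \<bullet> v = (transpose_mat P *\<^sub>v (P *\<^sub>v (D *\<^sub>v z))) \<bullet> z"
      unfolding v_def using transpose_vec_mult_scalar[OF P(1) z, of "P *\<^sub>v (D *\<^sub>v z)"] P Dz by simp
    also have "transpose_mat P *\<^sub>v (P *\<^sub>v (D *\<^sub>v z)) = D *\<^sub>v z"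
      using P Dz by (simp add: assoc_mult_mat_vec[symmetric, of _ n n _ n])
    also have "(D *\<^sub>v z) \<bullet> z = (\<Sum>j<n. es ! j * (z $ j)\<^sup>2)"
    proof -
      have "(D *\<^sub>v z) $ j = es ! j * z $ j" if "j < n" for j
        using that z by (simp add: D_def scalar_prod_def if_distrib[of "\<lambda>x. x * _"] cong: if_cong)
      then show ?thesis using z
        by (simp add: scalar_prod_def power2_eq_square atLeast0LessThan ac_simps)
    qed
    finally show ?thesis by (simp add: v_def)
  qed
  show thesis using that[OF P len sorted sv quad] by blast
qed

lemma scalar_prod_orthogonal:
  fixes P :: "real mat"
  assumes P: "P \<in> carrier_mat n n" "transpose_mat P * P = 1\<^sub>m n" and z: "z \<in> carrier_vec n"
  shows "(P *\<^sub>v z) \<bullet> (P *\<^sub>v z) = (\<Sum>j<n. (z $ j)\<^sup>2)"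
proof -
  have "(P *\<^sub>v z) \<bullet> (P *\<^sub>v z) = (transpose_mat P *\<^sub>v (P *\<^sub>v z)) \<bullet> z"
    using transpose_vec_mult_scalar[OF P(1) z, of "P *\<^sub>v z"] P z by simp
  also have "transpose_mat P *\<^sub>v (P *\<^sub>v z) = z"
    using P z by (simp add: assoc_mult_mat_vec[symmetric, of _ n n _ n])
  finally show ?thesis
    using z by (simp add: scalar_prod_def power2_eq_square atLeast0LessThan)
qed

text \<open>Max-min half of Courant-Fischer: being orthogonal to the first \<open>i - 1\<close>
  singular vectors is \<open>i - 1\<close> conditions on \<open>i\<close> unknowns, so some nonzero
  \<open>w\<close> satisfies them, and on \<open>U *\<^sub>v w\<close> the quadratic form is at most
  \<open>es ! (i - 1)\<close> times the squared norm.\<close>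

lemma singular_value_ge:
  assumes A: "A \<in> carrier_mat n n" and i: "1 \<le> i" "i \<le> n" and c: "c \<ge> 0"
    and U: "U \<in> carrier_mat n i"
    and inj: "\<And>w. w \<in> carrier_vec i \<Longrightarrow> w \<noteq> 0\<^sub>v i \<Longrightarrow> U *\<^sub>v w \<noteq> 0\<^sub>v n"
    and lower: "\<And>w. w \<in> carrier_vec i \<Longrightarrow>
      (A *\<^sub>v (U *\<^sub>v w)) \<bullet> (A *\<^sub>v (U *\<^sub>v w)) \<ge> c\<^sup>2 * ((U *\<^sub>v w) \<bullet> (U *\<^sub>v w))"
  shows "singular_value A i \<ge> c"
proof -
  obtain P es where P: "P \<in> carrier_mat n n" "transpose_mat P * P = 1\<^sub>m n" and es: "length es = n"
    "sorted_wrt (\<ge>) es"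
    and svs: "\<And>i. 1 \<le> i \<Longrightarrow> i \<le> n \<Longrightarrow> singular_value A i = sqrt (es ! (i - 1))"
    and quad: "\<And>z. z \<in> carrier_vec n \<Longrightarrow>
       (A *\<^sub>v (P *\<^sub>v z)) \<bullet> (A *\<^sub>v (P *\<^sub>v z)) = (\<Sum>j<n. es ! j * (z $ j)\<^sup>2)"
    by (rule singular_values_diagonalize[OF A]) auto
  have sv: "singular_value A i = sqrt (es ! (i - 1))"
    using i by (intro svs) auto
  have PP': "P * transpose_mat P = 1\<^sub>m n"
    by (rule mat_mult_left_right_inverse[OF _ P]) (use P in auto)
  define F where "F = mat (i - 1) i (($$) (transpose_mat P * U))"
  have F: "F \<in> carrier_mat (i - 1) i" by (simp add: F_def)
  obtain w where w: "w \<in> carrier_vec i" "w \<noteq> 0\<^sub>v i" "F *\<^sub>v w = 0\<^sub>v (i - 1)"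
    by (rule underdetermined_system[OF F]) (use i in auto)
  define v where "v = U *\<^sub>v w"
  have v: "v \<in> carrier_vec n" using U w by (simp add: v_def)
  define z where "z = transpose_mat P *\<^sub>v v"
  have z: "z \<in> carrier_vec n" using P v by (simp add: z_def)
  have vz: "v = P *\<^sub>v z"
    unfolding z_def using P v PP' by (simp add: assoc_mult_mat_vec[symmetric, of _ n n _ n])
  have z0: "z $ j = 0" if "j < i - 1" for j
  proof -
    have "row F j = row (transpose_mat P * U) j"
      using that P U i by (intro eq_vecI) (auto simp: F_def)
    moreover have "z = (transpose_mat P * U) *\<^sub>v w"
      unfolding z_def v_def using P U w by (intro assoc_mult_mat_vec[symmetric, of _ n n _ i]) auto
    moreover have "j < dim_row (transpose_mat P * U)" "j < dim_row F"
      using that i P F by auto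
    ultimately have "z $ j = (F *\<^sub>v w) $ j"
      by (simp only: index_mult_mat_vec)
    then show ?thesis using w that by simp
  qed
  have "v \<bullet> v \<noteq> 0"
    using inj[OF w(1,2), folded v_def] conjugate_square_eq_0_vec[OF v] by simp
  moreover have vv: "v \<bullet> v = (\<Sum>j<n. (z $ j)\<^sup>2)"
    unfolding vz by (rule scalar_prod_orthogonal[OF P z])
  ultimately have pos: "v \<bullet> v > 0"
    using sum_nonneg[of "{..<n}" "\<lambda>j. (z $ j)\<^sup>2"] by simp
  have "c\<^sup>2 * (v \<bullet> v) \<le> (\<Sum>j<n. es ! j * (z $ j)\<^sup>2)"
    using lower[OF w(1), folded v_def] quad[OF z, folded vz] by linarith
  also have "\<dots> \<le> (\<Sum>j<n. es ! (i - 1) * (z $ j)\<^sup>2)"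
  proof (rule sum_mono)
    fix j assume "j \<in> {..<n}"
    then show "es ! j * (z $ j)\<^sup>2 \<le> es ! (i - 1) * (z $ j)\<^sup>2"
      using z0[of j] sorted_wrt_nth_less[OF es(2), of "i - 1" j] es(1)
      by (cases "j < i - 1"; cases "j = i - 1") (auto intro: mult_right_mono)
  qed
  also have "\<dots> = es ! (i - 1) * (v \<bullet> v)" by (simp add: vv sum_distrib_left)
  finally have "c\<^sup>2 \<le> es ! (i - 1)" using pos by simp
  then show ?thesis unfolding sv using c by (simp add: real_le_rsqrt)
qed

text \<open>Min-max half of Courant-Fischer: the kernel of \<open>F\<close> has codimension at most
  \<open>r\<close>, hence meets the span of the first \<open>i\<close> singular vectors, on which
  the quadratic form is at least \<open>es ! (i - 1)\<close> times the squared norm.\<close>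

lemma singular_value_le:
  assumes A: "A \<in> carrier_mat n n" and i: "r < i" "i \<le> n" and c: "c \<ge> 0"
    and F: "F \<in> carrier_mat r n"
    and upper: "\<And>v. v \<in> carrier_vec n \<Longrightarrow> F *\<^sub>v v = 0\<^sub>v r \<Longrightarrow>
      (A *\<^sub>v v) \<bullet> (A *\<^sub>v v) \<le> c\<^sup>2 * (v \<bullet> v)"
  shows "singular_value A i \<le> c"
proof -
  obtain P es where P: "P \<in> carrier_mat n n" "transpose_mat P * P = 1\<^sub>m n" and es: "length es = n"
    "sorted_wrt (\<ge>) es"
    and svs: "\<And>i. 1 \<le> i \<Longrightarrow> i \<le> n \<Longrightarrow> singular_value A i = sqrt (es ! (i - 1))"
    and quad: "\<And>z. z \<in> carrier_vec n \<Longrightarrow>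
       (A *\<^sub>v (P *\<^sub>v z)) \<bullet> (A *\<^sub>v (P *\<^sub>v z)) = (\<Sum>j<n. es ! j * (z $ j)\<^sup>2)"
    by (rule singular_values_diagonalize[OF A]) auto
  have sv: "singular_value A i = sqrt (es ! (i - 1))"
    using i by (intro svs) auto
  define H where "H = F * P"
  have H: "H \<in> carrier_mat r n" using F P by (simp add: H_def)
  define G where "G = mat r i (($$) H)"
  have G: "G \<in> carrier_mat r i" by (simp add: G_def)
  obtain y where y: "y \<in> carrier_vec i" "y \<noteq> 0\<^sub>v i" "G *\<^sub>v y = 0\<^sub>v r"
    by (rule underdetermined_system[OF G i(1)])
  define z where "z = vec n (\<lambda>j. if j < i then y $ j else 0)"
  have z: "z \<in> carrier_vec n" by (simp add: z_def)
  define v where "v = P *\<^sub>v z"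
  have v: "v \<in> carrier_vec n" using P z by (simp add: v_def)
  have "F *\<^sub>v v = 0\<^sub>v r"
  proof (rule eq_vecI)
    fix k assume "k < dim_vec (0\<^sub>v r :: real vec)"
    then have k: "k < r" by simp
    have "F *\<^sub>v v = H *\<^sub>v z" unfolding v_def H_def using F P z by simp
    then have "(F *\<^sub>v v) $ k = (\<Sum>j\<in>{0..<n}. H $$ (k, j) * (if j < i then y $ j else 0))"
      using k H by (simp add: scalar_prod_def z_def)
    also have "\<dots> = (\<Sum>j\<in>{0..<i}. H $$ (k, j) * y $ j)"
      by (rule sum.mono_neutral_cong_right) (use i in auto)
    also have "\<dots> = (G *\<^sub>v y) $ k"
      using k y(1) by (simp add: G_def scalar_prod_def)
    finally show "(F *\<^sub>v v) $ k = 0\<^sub>v r $ k" using y(3) k by simp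
  qed (use F in auto)
  from upper[OF v this] have "(\<Sum>j<n. es ! j * (z $ j)\<^sup>2) \<le> c\<^sup>2 * (\<Sum>j<n. (z $ j)\<^sup>2)"
    unfolding v_def quad[OF z] scalar_prod_orthogonal[OF P z] .
  moreover have "(\<Sum>j<n. es ! (i - 1) * (z $ j)\<^sup>2) \<le> (\<Sum>j<n. es ! j * (z $ j)\<^sup>2)"
  proof (rule sum_mono)
    fix j assume "j \<in> {..<n}"
    then show "es ! (i - 1) * (z $ j)\<^sup>2 \<le> es ! j * (z $ j)\<^sup>2"
      using sorted_wrt_nth_less[OF es(2), of j "i - 1"] es(1) i
      by (cases "j < i - 1"; cases "j = i - 1") (auto intro: mult_right_mono simp: z_def)
  qed
  ultimately have le: "es ! (i - 1) * (\<Sum>j<n. (z $ j)\<^sup>2) \<le> c\<^sup>2 * (\<Sum>j<n. (z $ j)\<^sup>2)"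
    unfolding sum_distrib_left[symmetric] by linarith
  obtain k where k: "k < i" "y $ k \<noteq> 0" by (rule vec_nonzero_index[OF y(1,2)])
  then have "(z $ k)\<^sup>2 > 0" using i by (simp add: z_def)
  then have "(\<Sum>j<n. (z $ j)\<^sup>2) > 0"
    using k i by (intro sum_pos2[of _ k]) auto
  with le have "es ! (i - 1) \<le> c\<^sup>2" by simp
  then show ?thesis unfolding sv using c by (simp add: real_le_lsqrt)
qed

section \<open>Chernoff bounds for Markov chains\<close>

text \<open>Product form of the Markov property. \<open>markov_chain\<close> constrains only
  histories of positive probability; for the others both sides are zero.\<close>

lemma markov_chain_step:
  assumes mc: "markov_chain M n P \<pi> X" and y: "y < n"
  shows "\<P>(\<omega> in M. (\<forall>s\<le>t. X s \<omega> = z s) \<and> X (Suc t) \<omega> = y) =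
    \<P>(\<omega> in M. \<forall>s\<le>t. X s \<omega> = z s) * P $$ (z t, y)"
proof (cases "\<P>(\<omega> in M. \<forall>s\<le>t. X s \<omega> = z s) > 0")
  case True
  then have "\<P>(\<omega> in M. X (Suc t) \<omega> = y \<bar> \<forall>s\<le>t. X s \<omega> = z s) = P $$ (z t, y)"
    using mc y unfolding markov_chain_def by blast
  with True show ?thesis
    by (simp add: cond_prob_def field_simps conj_commute)
next
  case False
  interpret prob_space M using mc by (simp add: markov_chain_def)
  have [measurable]: "X s \<in> measurable M (count_space {..<n})" for s
    using mc by (simp add: markov_chain_def)
  have "\<P>(\<omega> in M. (\<forall>s\<le>t. X s \<omega> = z s) \<and> X (Suc t) \<omega> = y) \<le> \<P>(\<omega> in M. \<forall>s\<le>t. X s \<omega> = z s)"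
    by (intro finite_measure_mono) auto
  moreover have zero: "\<P>(\<omega> in M. \<forall>s\<le>t. X s \<omega> = z s) = 0"
    using False by (intro antisym measure_nonneg) simp
  ultimately have "\<P>(\<omega> in M. (\<forall>s\<le>t. X s \<omega> = z s) \<and> X (Suc t) \<omega> = y) = 0"
    by (intro antisym measure_nonneg) simp
  with zero show ?thesis by simp
qed

text \<open>The hypothesis on \<open>h\<close> makes the exponential of the path sum a
  supermartingale. Since the state space is finite, its expectation is a finite sum over
  trajectories, and summing out the last state is the induction step.\<close>

lemma markov_chain_exp_sum:
  assumes mc: "markov_chain M n P \<pi> X"
    and h: "\<And>x. x < n \<Longrightarrow> (\<Sum>y<n. P $$ (x, y) * exp (h x y)) \<le> 1"
  shows "(\<Sum>z\<in>PiE {..t} (\<lambda>_. {..<n}). exp (\<Sum>s<t. h (z s) (z (Suc s))) *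
    \<P>(\<omega> in M. \<forall>s\<le>t. X s \<omega> = z s)) \<le> 1"
proof (induction t)
  case 0
  interpret prob_space M using mc by (simp add: markov_chain_def)
  have [measurable]: "X s \<in> measurable M (count_space {..<n})" for s
    using mc by (simp add: markov_chain_def)
  let ?Z = "PiE {..0::nat} (\<lambda>_. {..<n})"
  let ?E = "\<lambda>z. {\<omega> \<in> space M. X 0 \<omega> = z (0::nat)}"
  have disj: "disjoint_family_on ?E ?Z"
    unfolding disjoint_family_on_def
  proof (intro ballI impI)
    fix z z' assume z: "z \<in> ?Z" "z' \<in> ?Z" "z \<noteq> z'"
    have "z 0 \<noteq> z' 0"
    proof
      assume "z 0 = z' 0"
      then have "z i = z' i" if "i \<in> {..0}" for i using that by simp
      with z show False by (metis PiE_ext)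
    qed
    then show "?E z \<inter> ?E z' = {}" by auto
  qed
  have meas: "?E z \<in> sets M" for z by measurable
  have "(\<Sum>z\<in>?Z. exp (\<Sum>s<0. h (z s) (z (Suc s))) * \<P>(\<omega> in M. \<forall>s\<le>0. X s \<omega> = z s)) =
      (\<Sum>z\<in>?Z. measure M (?E z))"
    by (intro sum.cong refl) simp
  also have "\<dots> = measure M (\<Union>z\<in>?Z. ?E z)"
  proof (rule finite_measure_finite_Union[symmetric])
    show "finite ?Z" by (rule finite_PiE) auto
    show "?E ` ?Z \<subseteq> sets M" using meas by blast
  qed (rule disj)
  also have "\<dots> \<le> 1" by (rule prob_le_1)
  finally show ?case .
next
  case (Suc t)
  let ?p = "\<lambda>t z. \<P>(\<omega> in M. \<forall>s\<le>t. X s \<omega> = z s)"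
  let ?e = "\<lambda>t z. exp (\<Sum>s<t. h (z s) (z (Suc s)))"
  let ?Z = "\<lambda>t. PiE {..t} (\<lambda>_. {..<n})"
  have ins: "{..Suc t} = insert (Suc t) {..t}" by auto
  have inj: "inj_on (\<lambda>(y, g). g(Suc t := y)) ({..<n} \<times> ?Z t)"
    by (rule inj_combinator) simp
  have step: "?e (Suc t) (g(Suc t := y)) * ?p (Suc t) (g(Suc t := y)) =
      ?e t g * ?p t g * (P $$ (g t, y) * exp (h (g t) y))" if "y < n" for y g
  proof -
    have "?p (Suc t) (g(Suc t := y)) = \<P>(\<omega> in M. (\<forall>s\<le>t. X s \<omega> = g s) \<and> X (Suc t) \<omega> = y)"
    proof -
      have split: "(\<forall>s\<le>Suc t. Q s) \<longleftrightarrow> (\<forall>s\<le>t. Q s) \<and> Q (Suc t)" for Q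
        by (auto simp: le_Suc_eq)
      have "(\<forall>s\<le>t. X s \<omega> = (g(Suc t := y)) s) \<longleftrightarrow> (\<forall>s\<le>t. X s \<omega> = g s)" for \<omega>
        by (intro all_cong) simp
      then show ?thesis unfolding split by simp
    qed
    also have "\<dots> = ?p t g * P $$ (g t, y)" by (rule markov_chain_step[OF mc that])
    finally have 1: "?p (Suc t) (g(Suc t := y)) = ?p t g * P $$ (g t, y)" .
    have "(\<Sum>s<t. h ((g(Suc t := y)) s) ((g(Suc t := y)) (Suc s))) = (\<Sum>s<t. h (g s) (g (Suc s)))"
      by (rule sum.cong) auto
    then have 2: "?e (Suc t) (g(Suc t := y)) = ?e t g * exp (h (g t) y)"
      by (simp add: exp_add)
    show ?thesis unfolding 1 2 by (simp add: ac_simps)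
  qed
  have "(\<Sum>z\<in>?Z (Suc t). ?e (Suc t) z * ?p (Suc t) z) =
      (\<Sum>(y, g)\<in>{..<n} \<times> ?Z t. ?e (Suc t) (g(Suc t := y)) * ?p (Suc t) (g(Suc t := y)))"
    unfolding ins PiE_insert_eq sum.reindex[OF inj] by (simp add: case_prod_unfold)
  also have "\<dots> = (\<Sum>(y, g)\<in>{..<n} \<times> ?Z t. ?e t g * ?p t g * (P $$ (g t, y) * exp (h (g t) y)))"
  proof (rule sum.cong[OF refl])
    fix w assume "w \<in> {..<n} \<times> ?Z t"
    then obtain y g where w: "w = (y, g)" "y < n" by auto
    show "(case w of (y, g) \<Rightarrow> ?e (Suc t) (g(Suc t := y)) * ?p (Suc t) (g(Suc t := y))) =
        (case w of (y, g) \<Rightarrow> ?e t g * ?p t g * (P $$ (g t, y) * exp (h (g t) y)))"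
      unfolding w(1) prod.case by (rule step[OF w(2)])
  qed
  also have "\<dots> = (\<Sum>y<n. \<Sum>g\<in>?Z t. ?e t g * ?p t g * (P $$ (g t, y) * exp (h (g t) y)))"
    by (rule sum.cartesian_product[symmetric])
  also have "\<dots> = (\<Sum>g\<in>?Z t. ?e t g * ?p t g * (\<Sum>y<n. P $$ (g t, y) * exp (h (g t) y)))"
    by (subst sum.swap) (simp add: sum_distrib_left)
  also have "\<dots> \<le> (\<Sum>g\<in>?Z t. ?e t g * ?p t g * 1)"
    by (intro sum_mono mult_left_mono h) (auto simp: PiE_iff)
  also have "\<dots> \<le> 1" using Suc.IH by simp
  finally show ?case .
qed

text \<open>Markov's inequality, carried out trajectory by trajectory: for those in the event,
  \<open>exp (- a)\<close> times the exponential of the path sum is at least one.\<close>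

lemma markov_chain_tail:
  assumes mc: "markov_chain M n P \<pi> X"
    and h: "\<And>x. x < n \<Longrightarrow> (\<Sum>y<n. P $$ (x, y) * exp (h x y)) \<le> 1"
  shows "\<P>(\<omega> in M. a \<le> (\<Sum>s<t. h (X s \<omega>) (X (Suc s) \<omega>))) \<le> exp (- a)"
proof -
  interpret prob_space M using mc by (simp add: markov_chain_def)
  have [measurable]: "X s \<in> measurable M (count_space {..<n})" for s
    using mc by (simp add: markov_chain_def)
  let ?Z = "PiE {..t} (\<lambda>_. {..<n})"
  let ?H = "\<lambda>z. \<Sum>s<t. h (z s) (z (Suc s))"
  let ?E = "\<lambda>z. {\<omega> \<in> space M. \<forall>s\<le>t. X s \<omega> = z s}"
  have fin: "finite ?Z" by (rule finite_PiE) auto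
  have meas: "?E z \<in> sets M" for z by measurable
  have "{\<omega> \<in> space M. a \<le> ?H (\<lambda>s. X s \<omega>)} \<subseteq> (\<Union>z\<in>{z \<in> ?Z. a \<le> ?H z}. ?E z)"
  proof
    fix \<omega> assume w: "\<omega> \<in> {\<omega> \<in> space M. a \<le> ?H (\<lambda>s. X s \<omega>)}"
    define z where "z = restrict (\<lambda>s. X s \<omega>) {..t}"
    have lt: "X s \<omega> < n" for s
      using measurable_space[of "X s" M "count_space {..<n}" \<omega>] w by auto
    have "?H z = ?H (\<lambda>s. X s \<omega>)" unfolding z_def by (intro sum.cong) auto
    with w lt have "z \<in> {z \<in> ?Z. a \<le> ?H z}" "\<omega> \<in> ?E z" by (auto simp: z_def)
    then show "\<omega> \<in> (\<Union>z\<in>{z \<in> ?Z. a \<le> ?H z}. ?E z)" by blast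
  qed
  then have "\<P>(\<omega> in M. a \<le> ?H (\<lambda>s. X s \<omega>)) \<le> measure M (\<Union>z\<in>{z \<in> ?Z. a \<le> ?H z}. ?E z)"
    using fin meas by (intro finite_measure_mono) auto
  also have "\<dots> \<le> (\<Sum>z\<in>{z \<in> ?Z. a \<le> ?H z}. measure M (?E z))"
    using fin meas by (intro finite_measure_subadditive_finite) auto
  also have "\<dots> \<le> (\<Sum>z\<in>{z \<in> ?Z. a \<le> ?H z}. exp (- a) * (exp (?H z) * measure M (?E z)))"
  proof (rule sum_mono)
    fix z assume "z \<in> {z \<in> ?Z. a \<le> ?H z}"
    then have "1 \<le> exp (- a) * exp (?H z)" by (simp flip: exp_add)
    then have "1 * measure M (?E z) \<le> exp (- a) * exp (?H z) * measure M (?E z)"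
      by (intro mult_right_mono) auto
    then show "measure M (?E z) \<le> exp (- a) * (exp (?H z) * measure M (?E z))"
      by (simp only: mult.assoc mult_1)
  qed
  also have "\<dots> \<le> (\<Sum>z\<in>?Z. exp (- a) * (exp (?H z) * measure M (?E z)))"
    using fin by (intro sum_mono2) auto
  also have "\<dots> = exp (- a) * (\<Sum>z\<in>?Z. exp (?H z) * measure M (?E z))"
    by (simp add: sum_distrib_left)
  also have "\<dots> \<le> exp (- a) * 1"
    by (intro mult_left_mono markov_chain_exp_sum[OF mc h]) auto
  finally show ?thesis by simp
qed

section \<open>Path sums and transition counts\<close>

lemma sum_transitions:
  fixes f :: "nat \<Rightarrow> nat \<Rightarrow> real"
  assumes X: "\<And>t. X t \<omega> < n"
  shows "(\<Sum>t<T. f (X t \<omega>) (X (Suc t) \<omega>)) =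
    (\<Sum>x<n. \<Sum>y<n. f x y * real (transition_count T X \<omega> x y))"
proof -
  have eq: "real (transition_count T X \<omega> x y) = (\<Sum>t<T. if x = X t \<omega> \<and> y = X (Suc t) \<omega> then 1 else 0)" for x y
    unfolding transition_count_def
    by (subst sum.If_cases) (auto intro!: arg_cong[where f = card])
  have "f x y * real (transition_count T X \<omega> x y) =
      (\<Sum>t<T. if x = X t \<omega> then if y = X (Suc t) \<omega> then f x y else 0 else 0)" for x y
    unfolding eq sum_distrib_left by (intro sum.cong refl) auto
  then have "(\<Sum>x<n. \<Sum>y<n. f x y * real (transition_count T X \<omega> x y)) =
      (\<Sum>x<n. \<Sum>y<n. \<Sum>t<T. if x = X t \<omega> then if y = X (Suc t) \<omega> then f x y else 0 else 0)"
    by (simp only:)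
  also have "\<dots> = (\<Sum>x<n. \<Sum>t<T. \<Sum>y<n. if x = X t \<omega> then if y = X (Suc t) \<omega> then f x y else 0 else 0)"
    by (rule sum.cong[OF refl], rule sum.swap)
  also have "\<dots> = (\<Sum>t<T. \<Sum>x<n. \<Sum>y<n. if x = X t \<omega> then if y = X (Suc t) \<omega> then f x y else 0 else 0)"
    by (rule sum.swap)
  also have "\<dots> = (\<Sum>t<T. \<Sum>x<n. if x = X t \<omega> then f x (X (Suc t) \<omega>) else 0)"
    using X by (intro sum.cong refl) (auto simp: sum.delta)
  also have "\<dots> = (\<Sum>t<T. f (X t \<omega>) (X (Suc t) \<omega>))"
    using X by (intro sum.cong refl) (auto simp: sum.delta)
  finally show ?thesis by simp
qed

text \<open>Row sums count departures at times \<open>0\<close> to \<open>T - 1\<close>, column sums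
  count arrivals at times \<open>1\<close> to \<open>T\<close>, so the difference telescopes to the
  two ends of the path. With an indicator for \<open>f\<close> this compares the row and column sums
  of a set of states up to one.\<close>

lemma weighted_row_count_diff:
  fixes f :: "nat \<Rightarrow> real"
  assumes X: "\<And>t. X t \<omega> < n"
  shows "(\<Sum>x<n. f x * (\<Sum>y<n. real (transition_count T X \<omega> x y))) -
    (\<Sum>y<n. f y * real (column_count n T X \<omega> y)) = f (X 0 \<omega>) - f (X T \<omega>)"
proof -
  have "(\<Sum>x<n. f x * (\<Sum>y<n. real (transition_count T X \<omega> x y))) = (\<Sum>t<T. f (X t \<omega>))"
    unfolding sum_distrib_left
    by (rule sum_transitions[where X = X and \<omega> = \<omega> and f = "\<lambda>x y. f x", OF X, symmetric])
  moreover have "(\<Sum>y<n. f y * real (column_count n T X \<omega> y)) = (\<Sum>t<T. f (X (Suc t) \<omega>))"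
    unfolding column_count_def of_nat_sum sum_distrib_left
    by (subst sum.swap)
       (rule sum_transitions[where X = X and \<omega> = \<omega> and f = "\<lambda>x y. f y", OF X, symmetric])
  moreover have "(\<Sum>t<T. f (X t \<omega>)) - (\<Sum>t<T. f (X (Suc t) \<omega>)) = f (X 0 \<omega>) - f (X T \<omega>)"
    unfolding sum_subtractf[symmetric] by (rule sum_lessThan_telescope')
  ultimately show ?thesis by (simp only:)
qed

text \<open>Comparability with the uniform kernel is what the concentration estimates rest on:
  \<open>c0\<close> makes large sets visited often, \<open>c1\<close> bounds variances and
  exponential moments. The block structure returns in the deterministic bounds on singular
  values.\<close>

locale comparable_chain =
  fixes M :: "'a measure" and n :: nat and P :: "real mat" and \<pi> :: "nat \<Rightarrow> real"
    and X :: "nat \<Rightarrow> 'a \<Rightarrow> nat" and T :: nat and c0 c1 :: real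
  assumes mc: "markov_chain M n P \<pi> X"
    and n: "n > 0" and T: "T > 0" and c0: "c0 > 0"
    and P_ge: "\<And>x y. x < n \<Longrightarrow> y < n \<Longrightarrow> c0 / n \<le> P $$ (x, y)"
    and P_le: "\<And>x y. x < n \<Longrightarrow> y < n \<Longrightarrow> P $$ (x, y) \<le> c1 / n"
    and P_sum: "\<And>x. x < n \<Longrightarrow> (\<Sum>y<n. P $$ (x, y)) = 1"
begin

sublocale prob_space M using mc by (simp add: markov_chain_def)

abbreviation "d \<equiv> real T / real n"
abbreviation "N \<omega> x y \<equiv> real (transition_count T X \<omega> x y)"
abbreviation "R \<omega> x \<equiv> \<Sum>y<n. N \<omega> x y"
abbreviation "C \<omega> y \<equiv> real (column_count n T X \<omega> y)"

lemma X_measurable [measurable]: "X t \<in> measurable M (count_space {..<n})"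
  using mc by (simp add: markov_chain_def)

lemma X_less: "\<omega> \<in> space M \<Longrightarrow> X t \<omega> < n"
  using measurable_space[OF X_measurable] by auto

lemma P_nonneg: "x < n \<Longrightarrow> y < n \<Longrightarrow> 0 \<le> P $$ (x, y)"
  using P_ge[of x y] c0 by (intro order_trans[OF _ P_ge[of x y]]) auto

lemma c1_pos: "c1 > 0"
proof -
  have "0 < c0 / n" using c0 n by simp
  also have "\<dots> \<le> c1 / n" using P_ge[OF n n] P_le[OF n n] by linarith
  finally show ?thesis using n by (simp add: zero_less_divide_iff)
qed

lemma N_measurable [measurable]: "(\<lambda>\<omega>. N \<omega> x y) \<in> borel_measurable M"
proof -
  have "N \<omega> x y = (\<Sum>t<T. if X t \<omega> = x \<and> X (Suc t) \<omega> = y then 1 else 0)" for \<omega>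
    unfolding transition_count_def
    by (subst sum.If_cases) (auto intro!: arg_cong[where f = card])
  then show ?thesis by simp
qed

lemma C_measurable [measurable]: "(\<lambda>\<omega>. C \<omega> y) \<in> borel_measurable M"
  unfolding column_count_def of_nat_sum by measurable

lemma R_diff: "\<omega> \<in> space M \<Longrightarrow>
  (\<Sum>x<n. f x * R \<omega> x) - (\<Sum>y<n. f y * C \<omega> y) = f (X 0 \<omega>) - f (X T \<omega>)" for f :: "nat \<Rightarrow> real"
  using X_less by (intro weighted_row_count_diff) auto

lemma sum_R: "\<omega> \<in> space M \<Longrightarrow> (\<Sum>x<n. R \<omega> x) = real T"
  using sum_transitions[where X = X and \<omega> = \<omega> and f = "\<lambda>x y. 1" and n = n and T = T] X_less by simp

text \<open>\<open>k x\<close> bounds the logarithm of the exponential moment of one step from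
  \<open>x\<close>, so \<open>markov_chain_tail\<close> applies to \<open>g x y - k x\<close>. The
  accumulated compensator \<open>\<Sum>x<n. k x * R \<omega> x\<close> depends on the path and is
  controlled later through row sums.\<close>

lemma tail:
  assumes "\<And>x. x < n \<Longrightarrow> (\<Sum>y<n. P $$ (x, y) * exp (g x y)) \<le> exp (k x)"
  shows "prob {\<omega> \<in> space M. a \<le> (\<Sum>x<n. \<Sum>y<n. g x y * N \<omega> x y) - (\<Sum>x<n. k x * R \<omega> x)} \<le> exp (- a)"
proof -
  have "(\<Sum>x<n. \<Sum>y<n. g x y * N \<omega> x y) - (\<Sum>x<n. k x * R \<omega> x) =
      (\<Sum>t<T. (\<lambda>x y. g x y - k x) (X t \<omega>) (X (Suc t) \<omega>))" if "\<omega> \<in> space M" for \<omega>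
    using X_less[OF that]
    by (subst sum_transitions[where n = n])
       (auto simp: sum_subtractf[symmetric] sum_distrib_left left_diff_distrib)
  then have "{\<omega> \<in> space M. a \<le> (\<Sum>x<n. \<Sum>y<n. g x y * N \<omega> x y) - (\<Sum>x<n. k x * R \<omega> x)} =
      {\<omega> \<in> space M. a \<le> (\<Sum>t<T. (\<lambda>x y. g x y - k x) (X t \<omega>) (X (Suc t) \<omega>))}" by auto
  moreover have "prob {\<omega> \<in> space M. a \<le> (\<Sum>t<T. (\<lambda>x y. g x y - k x) (X t \<omega>) (X (Suc t) \<omega>))} \<le> exp (- a)"
  proof (rule markov_chain_tail[OF mc])
    fix x assume x: "x < n"
    have "(\<Sum>y<n. P $$ (x, y) * exp (g x y - k x)) = (\<Sum>y<n. P $$ (x, y) * exp (g x y)) / exp (k x)"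
      by (simp add: exp_diff sum_divide_distrib)
    also have "\<dots> \<le> 1" using assms[OF x] by (simp add: divide_le_eq)
    finally show "(\<Sum>y<n. P $$ (x, y) * exp (g x y - k x)) \<le> 1" .
  qed
  ultimately show ?thesis by simp
qed

lemma union_bound:
  assumes "finite I" "\<And>i. i \<in> I \<Longrightarrow> {\<omega> \<in> space M. Q i \<omega>} \<in> events"
    and "\<And>i. i \<in> I \<Longrightarrow> prob {\<omega> \<in> space M. Q i \<omega>} \<le> f i"
  shows "prob {\<omega> \<in> space M. \<exists>i\<in>I. Q i \<omega>} \<le> (\<Sum>i\<in>I. f i)"
proof -
  have "{\<omega> \<in> space M. \<exists>i\<in>I. Q i \<omega>} = (\<Union>i\<in>I. {\<omega> \<in> space M. Q i \<omega>})" by auto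
  also have "prob \<dots> \<le> (\<Sum>i\<in>I. prob {\<omega> \<in> space M. Q i \<omega>})"
    using assms(1,2) by (intro finite_measure_subadditive_finite) auto
  also have "\<dots> \<le> (\<Sum>i\<in>I. f i)" by (intro sum_mono assms(3))
  finally show ?thesis .
qed

text \<open>Lower tail, with the weight \<open>exp (- 1)\<close> on steps into \<open>A\<close>. A
  step enters \<open>A\<close> with probability at least \<open>c0 * \<eta>\<close>, and
  \<open>1 - exp (- 1) \<ge> 1 / 2\<close>, so the compensator amounts to
  \<open>c0 * \<eta> / 2 * T\<close>; one half of it becomes the threshold, the other half the
  exponent.\<close>

lemma few_visits:
  fixes \<eta> :: real
  assumes A: "A \<subseteq> {..<n}" and card: "\<eta> * n \<le> card A" and \<eta>: "\<eta> \<ge> 0"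
  shows "prob {\<omega> \<in> space M. (\<Sum>y\<in>A. C \<omega> y) \<le> c0 * \<eta> / 4 * T} \<le> exp (- (c0 * \<eta> / 4 * T))"
proof -
  let ?g = "\<lambda>x y. if y \<in> A then - 1 else 0 :: real" and ?k = "\<lambda>x. - (c0 * \<eta> / 2)"
  have "prob {\<omega> \<in> space M. c0 * \<eta> / 4 * T \<le> (\<Sum>x<n. \<Sum>y<n. ?g x y * N \<omega> x y) - (\<Sum>x<n. ?k x * R \<omega> x)}
      \<le> exp (- (c0 * \<eta> / 4 * T))"
  proof (rule tail)
    fix x assume x: "x < n"
    have "(\<Sum>y<n. P $$ (x, y) * exp (?g x y)) = (\<Sum>y<n. P $$ (x, y) - (if y \<in> A then P $$ (x, y) * (1 - exp (- 1)) else 0))"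
      by (intro sum.cong) (auto simp: algebra_simps)
    also have "\<dots> = 1 - (\<Sum>y\<in>A. P $$ (x, y) * (1 - exp (- 1)))"
      unfolding sum_subtractf P_sum[OF x] using A
      by (subst sum.inter_restrict[symmetric]) (auto simp: Int_absorb1)
    also have "\<dots> \<le> 1 - (\<Sum>y\<in>A. c0 / n * (1 / 2))"
    proof -
      have "exp (- 1 :: real) \<le> 1 / 2"
        using exp_ge_add_one_self[of 1] by (simp add: exp_minus inverse_eq_divide divide_simps)
      then show ?thesis
        using A P_ge[OF x] c0 P_nonneg[OF x]
        by (intro diff_left_mono sum_mono mult_mono) auto
    qed
    also have "(\<Sum>y\<in>A. c0 / n * (1 / 2)) = c0 / (2 * n) * card A" by (simp add: field_simps)
    also have "1 - c0 / (2 * n) * card A \<le> 1 - c0 / (2 * n) * (\<eta> * n)"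
      using card c0 by (intro diff_left_mono mult_left_mono) auto
    also have "c0 / (2 * n) * (\<eta> * n) = c0 * \<eta> / 2" using n by simp
    also have "1 - c0 * \<eta> / 2 \<le> exp (- (c0 * \<eta> / 2))"
      using exp_ge_add_one_self[of "- (c0 * \<eta> / 2)"] by simp
    finally show "(\<Sum>y<n. P $$ (x, y) * exp (?g x y)) \<le> exp (?k x)" .
  qed
  moreover have "(\<Sum>x<n. \<Sum>y<n. ?g x y * N \<omega> x y) - (\<Sum>x<n. ?k x * R \<omega> x) =
      c0 * \<eta> / 2 * T - (\<Sum>y\<in>A. C \<omega> y)" if "\<omega> \<in> space M" for \<omega>
  proof -
    have "(\<Sum>x<n. \<Sum>y<n. ?g x y * N \<omega> x y) = (\<Sum>y<n. \<Sum>x<n. if y \<in> A then - N \<omega> x y else 0)"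
      by (subst sum.swap) (intro sum.cong, auto)
    also have "\<dots> = (\<Sum>y<n. if y \<in> A then - C \<omega> y else 0)"
      by (intro sum.cong) (auto simp: column_count_def sum_negf)
    also have "\<dots> = - (\<Sum>y\<in>A. C \<omega> y)"
      using A by (subst sum.inter_restrict[symmetric]) (auto simp: Int_absorb1 sum_negf)
    finally have 1: "(\<Sum>x<n. \<Sum>y<n. ?g x y * N \<omega> x y) = - (\<Sum>y\<in>A. C \<omega> y)" .
    have 2: "(\<Sum>x<n. ?k x * R \<omega> x) = - (c0 * \<eta> / 2 * T)"
      unfolding sum_distrib_left[symmetric] sum_R[OF that] by simp
    show ?thesis unfolding 1 2 by simp
  qed
  then have "{\<omega> \<in> space M. c0 * \<eta> / 4 * T \<le> (\<Sum>x<n. \<Sum>y<n. ?g x y * N \<omega> x y) - (\<Sum>x<n. ?k x * R \<omega> x)} =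
      {\<omega> \<in> space M. c0 * \<eta> / 4 * T \<le> c0 * \<eta> / 2 * T - (\<Sum>y\<in>A. C \<omega> y)}"
    by (intro Collect_cong conj_cong refl) simp
  moreover have "c0 * \<eta> / 4 * T \<le> c0 * \<eta> / 2 * T - S \<longleftrightarrow> S \<le> c0 * \<eta> / 4 * T" for S
    by argo
  ultimately show ?thesis by simp
qed

end

section \<open>Light pairs and discrepancy\<close>

lemma exp_le_quadratic:
  fixes u :: real
  assumes "\<bar>u\<bar> \<le> 1"
  shows "exp u \<le> 1 + u + u\<^sup>2"
proof (cases "u \<ge> 0")
  case True
  then show ?thesis using assms by (intro exp_bound) auto
next
  case False
  define v where "v = - u"
  have v: "0 \<le> v" using False by (simp add: v_def)
  define q where "q = 1 - v + v\<^sup>2"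
  have "q = (v - 1 / 2)\<^sup>2 + 3 / 4"
    by (simp add: q_def power2_eq_square algebra_simps)
  then have q: "q > 0" by (simp add: add_nonneg_pos)
  \<comment> \<open>The second factor is twice the quadratic Taylor polynomial of
    \<open>exp v\<close>. The product is at least 2, so \<open>q * exp v \<ge> 1\<close>, which is
    the claim for \<open>- v\<close>.\<close>
  have "q * (2 + 2 * v + v\<^sup>2) = 2 + v\<^sup>2 + v ^ 3 + v ^ 4"
    by (simp add: q_def algebra_simps power2_eq_square power3_eq_cube power4_eq_xxxx)
  then have "2 \<le> q * (2 + 2 * v + v\<^sup>2)" using v by simp
  also have "\<dots> \<le> q * (2 * exp v)"
    using exp_lower_Taylor_quadratic[OF v] q by (intro mult_left_mono) auto
  finally have "1 \<le> q * exp v" by simp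
  then have "exp (- v) * 1 \<le> exp (- v) * (q * exp v)" by (intro mult_left_mono) auto
  also have "\<dots> = q" by (simp add: exp_minus)
  finally have "exp (- v) \<le> 1 - v + v\<^sup>2" by (simp add: q_def)
  then show ?thesis by (simp add: v_def)
qed

text \<open>Divided by \<open>4 * sqrt n\<close>, these vectors form the net of the unit ball.\<close>

definition lattice_ball :: "nat \<Rightarrow> (nat \<Rightarrow> int) set" where
  "lattice_ball n = {k. (\<forall>x. x \<ge> n \<longrightarrow> k x = 0) \<and> (\<Sum>x<n. (k x)\<^sup>2) \<le> 16 * int n}"

lemma lattice_ball_sum_le:
  assumes "k \<in> lattice_ball n"
  shows "(\<Sum>x<n. (real_of_int (k x))\<^sup>2) \<le> 16 * real n"
proof -
  have "real_of_int (\<Sum>x<n. (k x)\<^sup>2) \<le> real_of_int (16 * int n)"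
    using assms unfolding lattice_ball_def of_int_le_iff by blast
  then show ?thesis by simp
qed

lemma sum_half_powers: "(\<Sum>j\<in>{- int m..int m}. (1 / 2 :: real) ^ nat \<bar>j\<bar>) = 3 - 2 * (1 / 2) ^ m"
proof (induction m)
  case (Suc m)
  have "{- int (Suc m)..int (Suc m)} = insert (int (Suc m)) (insert (- int (Suc m)) {- int m..int m})"
    by auto
  then have "(\<Sum>j\<in>{- int (Suc m)..int (Suc m)}. (1 / 2 :: real) ^ nat \<bar>j\<bar>) =
      (1 / 2) ^ Suc m + ((1 / 2) ^ Suc m + (\<Sum>j\<in>{- int m..int m}. (1 / 2 :: real) ^ nat \<bar>j\<bar>))"
    by (simp only:) (subst sum.insert, force, force, subst sum.insert, auto simp: nat_add_distrib)
  then show ?case using Suc by simp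
qed simp

text \<open>Counting by weights: \<open>w\<close> is at least \<open>(1 / 2) ^ (16 * n)\<close> at
  every point of the ball, because an integer is bounded by its square, while the total weight of
  the surrounding box factorizes and is at most \<open>3 ^ n\<close>. The exponent comes from
  \<open>3 * 2 ^ 16 \<le> 2 ^ 18 \<le> exp 1 ^ 18\<close>.\<close>

lemma lattice_ball_card: "finite (lattice_ball n)" "real (card (lattice_ball n)) \<le> exp (18 * real n)"
proof -
  define m where "m = 16 * n"
  define F where "F = PiE {..<n} (\<lambda>_. {- int m..int m})"
  define w :: "(nat \<Rightarrow> int) \<Rightarrow> real" where "w k = (\<Prod>x<n. (1 / 2) ^ nat \<bar>k x\<bar>)" for k
  define r :: "(nat \<Rightarrow> int) \<Rightarrow> nat \<Rightarrow> int" where "r k = restrict k {..<n}" for k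
  have inj: "inj_on r (lattice_ball n)"
  proof (rule inj_onI)
    fix k l assume kl: "k \<in> lattice_ball n" "l \<in> lattice_ball n" "r k = r l"
    show "k = l"
    proof
      fix x show "k x = l x"
      proof (cases "x < n")
        case True
        then show ?thesis using fun_cong[OF kl(3), of x] by (simp add: r_def)
      next
        case False
        then show ?thesis using kl(1,2) by (simp add: lattice_ball_def)
      qed
    qed
  qed
  have sq: "\<bar>j\<bar> \<le> j\<^sup>2" for j :: int
  proof (cases "j = 0")
    case False
    then have "\<bar>j\<bar> * 1 \<le> \<bar>j\<bar> * \<bar>j\<bar>" by (intro mult_left_mono) auto
    then show ?thesis by (simp add: power2_eq_square)
  qed simp
  have abs_sum: "(\<Sum>x<n. \<bar>k x\<bar>) \<le> int m" if "k \<in> lattice_ball n" for k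
  proof -
    have "(\<Sum>x<n. \<bar>k x\<bar>) \<le> (\<Sum>x<n. (k x)\<^sup>2)" by (intro sum_mono sq)
    then show ?thesis using that by (simp add: lattice_ball_def m_def)
  qed
  have F: "r k \<in> F" if "k \<in> lattice_ball n" for k
  proof -
    have "\<bar>k x\<bar> \<le> int m" if "x < n" for x
      using member_le_sum[of x "{..<n}" "\<lambda>x. \<bar>k x\<bar>"] that abs_sum[OF \<open>k \<in> _\<close>] by auto
    then show ?thesis by (fastforce simp: F_def r_def abs_le_iff)
  qed
  have finF: "finite F" by (simp add: F_def finite_PiE)
  show fin: "finite (lattice_ball n)"
    by (rule inj_on_finite[OF inj _ finF]) (use F in auto)
  have w: "(1 / 2) ^ m \<le> w (r k)" if "k \<in> lattice_ball n" for k
  proof -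
    have "w (r k) = (1 / 2) ^ (\<Sum>x<n. nat \<bar>k x\<bar>)"
      by (simp add: w_def r_def power_sum)
    moreover have "(\<Sum>x<n. nat \<bar>k x\<bar>) \<le> m"
    proof -
      have "int (\<Sum>x<n. nat \<bar>k x\<bar>) = (\<Sum>x<n. \<bar>k x\<bar>)" by simp
      then show ?thesis using abs_sum[OF that] by linarith
    qed
    ultimately show ?thesis by (simp add: power_decreasing)
  qed
  have "real (card (lattice_ball n)) * (1 / 2) ^ m = (\<Sum>k\<in>lattice_ball n. (1 / 2) ^ m)" by simp
  also have "\<dots> \<le> (\<Sum>k\<in>lattice_ball n. w (r k))" by (intro sum_mono w)
  also have "\<dots> = (\<Sum>k\<in>r ` lattice_ball n. w k)" by (simp add: sum.reindex[OF inj])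
  also have "\<dots> \<le> (\<Sum>k\<in>F. w k)"
    using finF F by (intro sum_mono2) (auto simp: w_def intro!: prod_nonneg)
  also have "\<dots> = (\<Prod>x<n. \<Sum>j\<in>{- int m..int m}. (1 / 2) ^ nat \<bar>j\<bar>)"
    unfolding F_def w_def by (subst prod_sum_PiE) auto
  also have "\<dots> \<le> 3 ^ n" unfolding sum_half_powers prod_constant card_lessThan
    using power_le_one[of "1 / 2 :: real" m] by (intro power_mono) auto
  finally have "real (card (lattice_ball n)) \<le> 3 ^ n * 2 ^ m"
    by (simp add: power_divide field_simps)
  also have "\<dots> = (3 * 2 ^ 16) ^ n" by (simp only: m_def power_mult power_mult_distrib)
  also have "\<dots> \<le> (exp 1 ^ 18) ^ n"
  proof (intro power_mono)
    have "(3 * 2 ^ 16 :: real) \<le> 2 ^ 18" by simp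
    also have "\<dots> \<le> exp 1 ^ 18" using exp_ge_add_one_self[of 1] by (intro power_mono) auto
    finally show "(3 * 2 ^ 16 :: real) \<le> exp 1 ^ 18" .
  qed simp
  also have "\<dots> = exp (18 * real n)" by (simp flip: exp_of_nat_mult power_mult)
  finally show "real (card (lattice_ball n)) \<le> exp (18 * real n)" .
qed

text \<open>\<open>n * ent (m / n) = m * ln (exp 1 * n / m)\<close> bounds \<open>ln (n choose m)\<close>.\<close>

definition ent :: "real \<Rightarrow> real" where "ent z = z * (1 - ln z)"

text \<open>Two-point form of the fact that the derivative \<open>- ln z\<close> is nonnegative up
  to 1.\<close>

lemma ent_mono:
  assumes "0 < a" "a \<le> b" "b \<le> 1"
  shows "ent a \<le> ent b"
proof -
  have "ln (b / a) \<le> b / a - 1" using assms by (intro ln_le_minus_one) simp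
  then have "a * (ln b - ln a) \<le> b - a"
    using assms by (simp add: ln_div field_simps)
  moreover have "(b - a) * ln b \<le> 0"
    using assms by (intro mult_nonneg_nonpos) auto
  ultimately show ?thesis by (simp add: ent_def algebra_simps)
qed

text \<open>A single term of the binomial expansion of \<open>(x + 1) ^ n\<close> is at most
  \<open>exp x ^ n\<close>; the choice \<open>x = i / n\<close> turns the right-hand side into
  \<open>exp i\<close>.\<close>

lemma binomial_le_ent:
  fixes i n :: nat
  assumes "1 \<le> i" "i \<le> n"
  shows "real (n choose i) \<le> exp (n * ent (i / n))"
proof -
  define x where "x = real i / real n"
  have x: "x > 0" using assms by (simp add: x_def)
  have nx: "n * x = i" using assms by (simp add: x_def)
  have "real (n choose i) * x ^ i \<le> (\<Sum>k\<le>n. real (n choose k) * x ^ k * 1 ^ (n - k))"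
    using assms x by (intro order_trans[OF _ member_le_sum[of i]]) auto
  also have "\<dots> = (x + 1) ^ n" by (rule binomial_ring[symmetric])
  also have "\<dots> \<le> exp x ^ n" using x exp_ge_add_one_self[of x] by (intro power_mono) (auto simp: add.commute)
  also have "\<dots> = exp i" using nx by (simp flip: exp_of_nat_mult)
  finally have "real (n choose i) \<le> exp i / x ^ i" using x by (simp add: field_simps)
  also have "x ^ i = exp (i * ln x)" using x by (simp add: exp_of_nat_mult)
  also have "exp i / exp (i * ln x) = exp (n * ent x)"
  proof -
    have "real i - real i * ln x = n * (x * (1 - ln x))"
      unfolding nx[symmetric] by (simp add: algebra_simps)
    then show ?thesis unfolding exp_diff[symmetric] ent_def by simp
  qed
  finally show ?thesis by (simp add: x_def)
qed

text \<open>Of the three copies of the entropy, one pays for the number of sets of a given size. By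
  monotonicity the other two are least for singletons, where they give \<open>2 + 2 * ln n\<close>;
  each of the \<open>n\<close> sizes thus contributes at most \<open>1 / n ^ 2\<close>. The empty
  set is left out because its entropy is 0.\<close>

lemma sum_subsets_ent:
  fixes n :: nat
  assumes n: "n > 0"
  shows "(\<Sum>A\<in>Pow {..<n} - {{}}. exp (- (3 * n * ent (card A / n)))) \<le> 1 / n"
proof -
  have "(\<Sum>A\<in>Pow {..<n} - {{}}. exp (- (3 * n * ent (card A / n)))) =
      (\<Sum>i\<in>{1..n}. \<Sum>A\<in>{A \<in> Pow {..<n} - {{}}. card A = i}. exp (- (3 * n * ent (card A / n))))"
  proof (rule sum.group[symmetric])
    show "card ` (Pow {..<n} - {{}}) \<subseteq> {1..n}"
    proof
      fix i assume "i \<in> card ` (Pow {..<n} - {{}})"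
      then obtain A where A: "A \<subseteq> {..<n}" "A \<noteq> {}" "i = card A" by auto
      then have "finite A" using finite_subset by blast
      then have "card A > 0" using A by (simp add: card_gt_0_iff)
      moreover have "card A \<le> n" using card_mono[OF _ A(1)] by simp
      ultimately show "i \<in> {1..n}" using A(3) by simp
    qed
  qed auto
  also have "\<dots> \<le> (\<Sum>i\<in>{1..n}. 1 / n ^ 2)"
  proof (rule sum_mono)
    fix i assume "i \<in> {1..n}"
    then have i: "1 \<le> i" "i \<le> n" by auto
    have "(\<Sum>A\<in>{A \<in> Pow {..<n} - {{}}. card A = i}. exp (- (3 * n * ent (card A / n)))) =
        (\<Sum>A\<in>{A. A \<subseteq> {..<n} \<and> card A = i}. exp (- (3 * n * ent (i / n))))"
      using i by (intro sum.cong) auto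
    also have "\<dots> = real (n choose i) * exp (- (3 * n * ent (i / n)))"
      by (simp add: n_subsets)
    also have "\<dots> \<le> exp (n * ent (i / n)) * exp (- (3 * n * ent (i / n)))"
      by (intro mult_right_mono binomial_le_ent i) auto
    also have "\<dots> = exp (- (2 * n * ent (i / n)))" by (simp flip: exp_add)
    also have "\<dots> \<le> exp (- (2 * n * ent (1 / n)))"
    proof -
      have "ent (1 / n) \<le> ent (i / n)"
        using i n by (intro ent_mono divide_right_mono) auto
      then show ?thesis by (simp add: mult_left_mono)
    qed
    also have "2 * n * ent (1 / n) = 2 + 2 * ln n" using n by (simp add: ent_def ln_div algebra_simps)
    also have "exp (- (2 + 2 * ln n)) \<le> exp (- (2 * ln n))" by simp
    also have "\<dots> = 1 / n ^ 2" using n by (simp add: exp_minus exp_double inverse_eq_divide)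
    finally show "(\<Sum>A\<in>{A \<in> Pow {..<n} - {{}}. card A = i}. exp (- (3 * n * ent (card A / n)))) \<le> 1 / n ^ 2" .
  qed
  also have "\<dots> = 1 / n" using n by (simp add: power2_eq_square)
  finally show ?thesis .
qed

text \<open>The lattice vectors are not normalised here: dividing both by \<open>4 * sqrt n\<close>
  turns the cutoff \<open>s\<close> on \<open>k x * l y\<close> into the cutoff
  \<open>s / (16 * n)\<close> on the product of coordinates.\<close>

definition light :: "real \<Rightarrow> (nat \<Rightarrow> int) \<Rightarrow> (nat \<Rightarrow> int) \<Rightarrow> nat \<Rightarrow> nat \<Rightarrow> real" where
  "light s k l x y = (if \<bar>real_of_int (k x * l y)\<bar> < s then real_of_int (k x * l y) else 0)"

section \<open>Tail bounds for light pairs, rectangles and columns\<close>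

context comparable_chain
begin

abbreviation "e \<omega> A B \<equiv> \<Sum>x\<in>A. \<Sum>y\<in>B. N \<omega> x y"

text \<open>Bernstein-type bound: divided by \<open>sqrt d\<close> the weights are at most 1 in
  size, and \<open>exp_le_quadratic\<close> gives the compensator \<open>p + q\<close>. The part
  \<open>p\<close> is exactly the centering by \<open>R x * P x y\<close>. The variance part
  \<open>q x\<close> is at most \<open>16 * c1 / d\<close> times the square of \<open>k x\<close>,
  so the row-sum condition in the event keeps its total below \<open>256 * c1 * B * n\<close>. The
  exponent \<open>37 = 18 + 18 + 1\<close> outweighs two copies of the net.\<close>

lemma light_tail:
  fixes B :: real
  assumes k: "k \<in> lattice_ball n" and l: "l \<in> lattice_ball n" and B: "B \<ge> 0"
  defines "f \<equiv> light (sqrt d) k l"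
  shows "prob {\<omega> \<in> space M. (\<Sum>x<n. (real_of_int (k x))\<^sup>2 * R \<omega> x) \<le> 16 * B * T \<and>
      (256 * c1 * B + 37) * n * sqrt d \<le> (\<Sum>x<n. \<Sum>y<n. f x y * (N \<omega> x y - R \<omega> x * P $$ (x, y)))}
    \<le> exp (- (37 * real n))"
proof -
  define s where "s = sqrt d"
  have d: "d > 0" using n T by simp
  have s: "s > 0" "s\<^sup>2 = d" using d by (auto simp: s_def)
  define g where "g x y = f x y / s" for x y
  have g1: "\<bar>g x y\<bar> \<le> 1" for x y
    using s by (auto simp: g_def f_def light_def s_def[symmetric] divide_le_eq abs_divide)
  define q where "q x = (\<Sum>y<n. P $$ (x, y) * (g x y)\<^sup>2)" for x
  define p where "p x = (\<Sum>y<n. P $$ (x, y) * g x y)" for x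
  have "prob {\<omega> \<in> space M. 37 * real n \<le> (\<Sum>x<n. \<Sum>y<n. g x y * N \<omega> x y) - (\<Sum>x<n. (p x + q x) * R \<omega> x)}
      \<le> exp (- (37 * real n))"
  proof (rule tail)
    fix x assume x: "x < n"
    have "(\<Sum>y<n. P $$ (x, y) * exp (g x y)) \<le> (\<Sum>y<n. P $$ (x, y) * (1 + g x y + (g x y)\<^sup>2))"
      using P_nonneg[OF x] by (intro sum_mono mult_left_mono exp_le_quadratic g1) auto
    also have "\<dots> = 1 + (p x + q x)"
      using P_sum[OF x] by (simp add: p_def q_def distrib_left sum.distrib)
    also have "\<dots> \<le> exp (p x + q x)" by simp
    finally show "(\<Sum>y<n. P $$ (x, y) * exp (g x y)) \<le> exp (p x + q x)" .
  qed
  moreover have "{\<omega> \<in> space M. (\<Sum>x<n. (real_of_int (k x))\<^sup>2 * R \<omega> x) \<le> 16 * B * T \<and>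
      (256 * c1 * B + 37) * n * sqrt d \<le> (\<Sum>x<n. \<Sum>y<n. f x y * (N \<omega> x y - R \<omega> x * P $$ (x, y)))} \<subseteq>
    {\<omega> \<in> space M. 37 * real n \<le> (\<Sum>x<n. \<Sum>y<n. g x y * N \<omega> x y) - (\<Sum>x<n. (p x + q x) * R \<omega> x)}"
  proof safe
    fix \<omega>
    assume h1: "(\<Sum>x<n. (real_of_int (k x))\<^sup>2 * R \<omega> x) \<le> 16 * B * T"
      and h2: "(256 * c1 * B + 37) * n * sqrt d \<le> (\<Sum>x<n. \<Sum>y<n. f x y * (N \<omega> x y - R \<omega> x * P $$ (x, y)))"
    note ls = lattice_ball_sum_le[OF l]
    have q: "q x \<le> 16 * c1 / d * (real_of_int (k x))\<^sup>2" if x: "x < n" for x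
    proof -
      have "q x \<le> (\<Sum>y<n. c1 / n * ((real_of_int (k x))\<^sup>2 * (real_of_int (l y))\<^sup>2 / d))"
        unfolding q_def
      proof (intro sum_mono mult_mono)
        fix y assume "y \<in> {..<n}"
        then have y: "y < n" by simp
        show "P $$ (x, y) \<le> c1 / n" by (rule P_le[OF x y])
        show "(g x y)\<^sup>2 \<le> (real_of_int (k x))\<^sup>2 * (real_of_int (l y))\<^sup>2 / d"
          using d s by (auto simp: g_def f_def light_def power_divide power_mult_distrib)
      qed (use c1_pos in auto)
      also have "\<dots> = c1 / n * ((real_of_int (k x))\<^sup>2 / d) * (\<Sum>y<n. (real_of_int (l y))\<^sup>2)"
        unfolding sum_distrib_left by (intro sum.cong refl) (simp add: divide_inverse mult_ac)
      also have "\<dots> \<le> c1 / n * ((real_of_int (k x))\<^sup>2 / d) * (16 * real n)"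
        using ls c1_pos d by (intro mult_left_mono) auto
      also have "\<dots> = 16 * c1 / d * (real_of_int (k x))\<^sup>2" using n by (simp add: field_simps)
      finally show ?thesis .
    qed
    have "(\<Sum>x<n. q x * R \<omega> x) \<le> (\<Sum>x<n. 16 * c1 / d * (real_of_int (k x))\<^sup>2 * R \<omega> x)"
      using q by (intro sum_mono mult_right_mono sum_nonneg) auto
    also have "\<dots> = 16 * c1 / d * (\<Sum>x<n. (real_of_int (k x))\<^sup>2 * R \<omega> x)"
      by (simp add: sum_distrib_left mult.assoc)
    also have "\<dots> \<le> 16 * c1 / d * (16 * B * T)"
      using h1 c1_pos d by (intro mult_left_mono) auto
    also have "\<dots> = 256 * c1 * B * n" using n T by (simp add: field_simps)
    finally have Q: "(\<Sum>x<n. q x * R \<omega> x) \<le> 256 * c1 * B * n" .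
    have "(\<Sum>x<n. \<Sum>y<n. f x y * (N \<omega> x y - R \<omega> x * P $$ (x, y))) =
        s * ((\<Sum>x<n. \<Sum>y<n. g x y * N \<omega> x y) - (\<Sum>x<n. p x * R \<omega> x))"
    proof -
      have "(\<Sum>y<n. f x y * (N \<omega> x y - r * P $$ (x, y))) =
          s * (\<Sum>y<n. g x y * N \<omega> x y) - s * (p x * r)" for x r
        unfolding p_def sum_distrib_left sum_distrib_right sum_subtractf[symmetric]
        using s by (intro sum.cong) (auto simp: g_def right_diff_distrib mult_ac)
      then show ?thesis
        by (simp add: sum_subtractf right_diff_distrib sum_distrib_left)
    qed
    with h2 have "s * ((256 * c1 * B + 37) * n) \<le> s * ((\<Sum>x<n. \<Sum>y<n. g x y * N \<omega> x y) - (\<Sum>x<n. p x * R \<omega> x))"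
      by (simp add: s_def mult_ac)
    then have "(256 * c1 * B + 37) * n \<le> (\<Sum>x<n. \<Sum>y<n. g x y * N \<omega> x y) - (\<Sum>x<n. p x * R \<omega> x)"
      using s by simp
    with Q show "37 * real n \<le> (\<Sum>x<n. \<Sum>y<n. g x y * N \<omega> x y) - (\<Sum>x<n. (p x + q x) * R \<omega> x)"
      by (simp add: distrib_right sum.distrib)
  qed
  ultimately show ?thesis
    by (rule order_trans[OF finite_measure_mono, rotated 2]) measurable
qed

lemma light_uniform:
  fixes B :: real
  assumes B: "B \<ge> 0"
  shows "prob {\<omega> \<in> space M. \<exists>k\<in>lattice_ball n. \<exists>l\<in>lattice_ball n.
      (\<Sum>x<n. (real_of_int (k x))\<^sup>2 * R \<omega> x) \<le> 16 * B * T \<and>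
      (256 * c1 * B + 37) * n * sqrt d \<le>
        (\<Sum>x<n. \<Sum>y<n. light (sqrt d) k l x y * (N \<omega> x y - R \<omega> x * P $$ (x, y)))}
    \<le> exp (- real n)" (is "prob ?bad \<le> _")
proof -
  let ?L = "lattice_ball n"
  define Q where "Q k l \<omega> \<longleftrightarrow> (\<Sum>x<n. (real_of_int (k x))\<^sup>2 * R \<omega> x) \<le> 16 * B * T \<and>
      (256 * c1 * B + 37) * n * sqrt d \<le>
        (\<Sum>x<n. \<Sum>y<n. light (sqrt d) k l x y * (N \<omega> x y - R \<omega> x * P $$ (x, y)))" for k l \<omega>
  note fin = lattice_ball_card(1)[of n]
  have meas: "{\<omega> \<in> space M. Q k l \<omega>} \<in> events" for k l unfolding Q_def by measurable
  have "prob {\<omega> \<in> space M. \<exists>k\<in>?L. \<exists>l\<in>?L. Q k l \<omega>} \<le> (\<Sum>k\<in>?L. \<Sum>l\<in>?L. exp (- (37 * real n)))"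
  proof (rule union_bound[OF fin sets.sets_Collect_finite_Ex[OF meas fin]])
    fix k assume k: "k \<in> ?L"
    show "prob {\<omega> \<in> space M. \<exists>l\<in>?L. Q k l \<omega>} \<le> (\<Sum>l\<in>?L. exp (- (37 * real n)))"
      by (rule union_bound[OF fin meas]) (unfold Q_def, rule light_tail[OF k _ B])
  qed
  then have "prob ?bad \<le> (\<Sum>k\<in>?L. \<Sum>l\<in>?L. exp (- (37 * real n)))" by (simp only: Q_def)
  also have "\<dots> = real (card ?L) * real (card ?L) * exp (- (37 * real n))" by simp
  also have "\<dots> \<le> exp (18 * real n) * exp (18 * real n) * exp (- (37 * real n))"
    using lattice_ball_card(2)[of n] by (intro mult_right_mono mult_mono) auto
  also have "\<dots> = exp (- real n)" by (simp flip: exp_add)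
  finally show ?thesis .
qed

text \<open>Chernoff bound with weight \<open>u\<close> on the steps from \<open>A\<close> to
  \<open>B\<close>: each departure from \<open>A\<close> is compensated by
  \<open>c1 * card B / n * exp u\<close>, so the total compensator is a multiple of the row sum of
  \<open>A\<close>. That sum is random, which is why its bound is part of the event.\<close>

lemma discrepancy_tail:
  fixes D a u :: real
  assumes A: "A \<subseteq> {..<n}" and B: "B \<subseteq> {..<n}" and u: "u \<ge> 0" and D: "D \<ge> 0"
  shows "prob {\<omega> \<in> space M. (\<Sum>x\<in>A. R \<omega> x) \<le> D * card A \<and>
      a + c1 * D * card A * card B / n * exp u \<le> u * e \<omega> A B} \<le> exp (- a)"
proof -
  let ?g = "\<lambda>x y. if x \<in> A \<and> y \<in> B then u else 0"
  let ?k = "\<lambda>x. if x \<in> A then c1 * card B / n * exp u else 0"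
  have "prob {\<omega> \<in> space M. a \<le> (\<Sum>x<n. \<Sum>y<n. ?g x y * N \<omega> x y) - (\<Sum>x<n. ?k x * R \<omega> x)} \<le> exp (- a)"
  proof (rule tail)
    fix x assume x: "x < n"
    show "(\<Sum>y<n. P $$ (x, y) * exp (?g x y)) \<le> exp (?k x)"
    proof (cases "x \<in> A")
      case True
      have "(\<Sum>y<n. P $$ (x, y) * exp (?g x y)) = (\<Sum>y<n. P $$ (x, y) + (if y \<in> B then P $$ (x, y) * (exp u - 1) else 0))"
        using True by (intro sum.cong) (auto simp: algebra_simps)
      also have "\<dots> = 1 + (\<Sum>y\<in>B. P $$ (x, y) * (exp u - 1))"
        unfolding sum.distrib P_sum[OF x] using B
        by (subst sum.inter_restrict[symmetric]) (auto simp: Int_absorb1)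
      also have "\<dots> \<le> 1 + (\<Sum>y\<in>B. c1 / n * exp u)"
        using B P_le[OF x] P_nonneg[OF x] c1_pos u
        by (intro add_left_mono sum_mono mult_mono) auto
      also have "\<dots> = 1 + c1 * card B / n * exp u" by (simp add: field_simps)
      also have "\<dots> \<le> exp (c1 * card B / n * exp u)" by simp
      finally show ?thesis using True by simp
    next
      case False
      then show ?thesis using P_sum[OF x] by simp
    qed
  qed
  moreover have "{\<omega> \<in> space M. (\<Sum>x\<in>A. R \<omega> x) \<le> D * card A \<and>
      a + c1 * D * card A * card B / n * exp u \<le> u * e \<omega> A B} \<subseteq>
    {\<omega> \<in> space M. a \<le> (\<Sum>x<n. \<Sum>y<n. ?g x y * N \<omega> x y) - (\<Sum>x<n. ?k x * R \<omega> x)}"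
  proof safe
    fix \<omega>
    assume h1: "(\<Sum>x\<in>A. R \<omega> x) \<le> D * card A"
      and h2: "a + c1 * D * card A * card B / n * exp u \<le> u * e \<omega> A B"
    have "(\<Sum>x<n. \<Sum>y<n. ?g x y * N \<omega> x y) = (\<Sum>x<n. if x \<in> A then \<Sum>y<n. if y \<in> B then u * N \<omega> x y else 0 else 0)"
      by (intro sum.cong) (auto intro!: sum.cong)
    also have "\<dots> = (\<Sum>x\<in>A. \<Sum>y\<in>B. u * N \<omega> x y)"
      using A B by (simp add: sum.inter_restrict[symmetric] Int_absorb1)
    finally have 1: "(\<Sum>x<n. \<Sum>y<n. ?g x y * N \<omega> x y) = u * e \<omega> A B"
      by (simp add: sum_distrib_left)
    have "(\<Sum>x<n. ?k x * R \<omega> x) = (\<Sum>x<n. if x \<in> A then c1 * card B / n * exp u * R \<omega> x else 0)"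
      by (intro sum.cong) auto
    also have "\<dots> = (\<Sum>x\<in>A. c1 * card B / n * exp u * R \<omega> x)"
      using A by (simp add: sum.inter_restrict[symmetric] Int_absorb1)
    also have "\<dots> = c1 * card B / n * exp u * (\<Sum>x\<in>A. R \<omega> x)"
      by (simp only: sum_distrib_left)
    also have "\<dots> \<le> c1 * card B / n * exp u * (D * card A)"
      using h1 c1_pos by (intro mult_left_mono) auto
    also have "\<dots> = c1 * D * card A * card B / n * exp u" by simp
    finally show "a \<le> (\<Sum>x<n. \<Sum>y<n. ?g x y * N \<omega> x y) - (\<Sum>x<n. ?k x * R \<omega> x)"
      using h2 unfolding 1 by linarith
  qed
  ultimately show ?thesis
    by (rule order_trans[OF finite_measure_mono, rotated 2]) measurable
qed

text \<open>With all states for \<open>A\<close> and \<open>D = d\<close>, the row-sum condition of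
  \<open>discrepancy_tail\<close> holds with equality; the parameter is 1, and
  \<open>exp 1 \<le> 3\<close> gives the term \<open>3 * c1 * d\<close>.\<close>

lemma column_tail:
  assumes y: "y < n"
  shows "prob {\<omega> \<in> space M. a \<le> C \<omega> y} \<le> exp (3 * c1 * d - a)"
proof -
  have "prob {\<omega> \<in> space M. (\<Sum>x\<in>{..<n}. R \<omega> x) \<le> d * card {..<n} \<and>
      (a - 3 * c1 * d) + c1 * d * card {..<n} * card {y} / n * exp 1 \<le> 1 * e \<omega> {..<n} {y}} \<le> exp (- (a - 3 * c1 * d))"
    using y by (intro discrepancy_tail) auto
  moreover have "{\<omega> \<in> space M. a \<le> C \<omega> y} \<subseteq> {\<omega> \<in> space M. (\<Sum>x\<in>{..<n}. R \<omega> x) \<le> d * card {..<n} \<and>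
      (a - 3 * c1 * d) + c1 * d * card {..<n} * card {y} / n * exp 1 \<le> 1 * e \<omega> {..<n} {y}}"
  proof safe
    fix \<omega> assume "\<omega> \<in> space M" "a \<le> C \<omega> y"
    moreover have "c1 * d * exp 1 \<le> c1 * d * 3" using exp_le c1_pos by (intro mult_left_mono) auto
    ultimately show "(\<Sum>x\<in>{..<n}. R \<omega> x) \<le> d * card {..<n}"
      "(a - 3 * c1 * d) + c1 * d * card {..<n} * card {y} / n * exp 1 \<le> 1 * e \<omega> {..<n} {y}"
      using n by (simp_all add: sum_R column_count_def)
  qed
  ultimately have "prob {\<omega> \<in> space M. a \<le> C \<omega> y} \<le> exp (- (a - 3 * c1 * d))"
    by (rule order_trans[OF finite_measure_mono, rotated 2]) measurable
  then show ?thesis by simp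
qed

text \<open>The threshold \<open>n * exp (- d)\<close> is the number of states that the trimming removes: it removes all
  states with a large column count.\<close>

lemma many_large_columns:
  "prob {\<omega> \<in> space M. real n * exp (- d) \<le> (\<Sum>y<n. if (3 * c1 + 2) * d \<le> C \<omega> y then 1 else 0)} \<le> exp (- d)"
proof -
  let ?a = "(3 * c1 + 2) * d"
  let ?u = "\<lambda>\<omega>. \<Sum>y<n. indicator {\<omega> \<in> space M. ?a \<le> C \<omega> y} \<omega> :: real"
  have meas: "{\<omega> \<in> space M. ?a \<le> C \<omega> y} \<in> events" for y by measurable
  have int: "integrable M (\<lambda>\<omega>. indicator {\<omega> \<in> space M. ?a \<le> C \<omega> y} \<omega> :: real)" for y
    by (intro integrable_real_indicator meas) (simp add: emeasure_eq_measure)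
  have "prob {\<omega> \<in> space M. real n * exp (- d) \<le> ?u \<omega>} \<le> (\<integral>\<omega>. ?u \<omega> \<partial>M) / (real n * exp (- d))"
    using int n by (intro integral_Markov_inequality_measure[where A = "{}"]) (auto intro!: sum_nonneg)
  also have "(\<integral>\<omega>. ?u \<omega> \<partial>M) = (\<Sum>y<n. prob {\<omega> \<in> space M. ?a \<le> C \<omega> y})"
    using meas int by (subst Bochner_Integration.integral_sum) auto
  \<comment> \<open>The \<open>+ 2\<close> in the threshold yields two factors
    \<open>exp (- d)\<close> for each column; Markov's inequality, which divides by
    \<open>n * exp (- d)\<close>, uses up one of them.\<close>
  also have "\<dots> \<le> (\<Sum>y<n. exp (- d) * exp (- d))"
  proof (rule sum_mono)
    fix y assume "y \<in> {..<n}"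
    then have "prob {\<omega> \<in> space M. ?a \<le> C \<omega> y} \<le> exp (3 * c1 * d - ?a)" by (intro column_tail) simp
    also have "3 * c1 * d - ?a = - d + - d" by (simp add: algebra_simps)
    finally show "prob {\<omega> \<in> space M. ?a \<le> C \<omega> y} \<le> exp (- d) * exp (- d)"
      unfolding exp_add[symmetric] .
  qed
  also have "(\<Sum>y<n. exp (- d) * exp (- d)) / (real n * exp (- d)) = exp (- d)"
    using n by simp
  finally have "prob {\<omega> \<in> space M. real n * exp (- d) \<le> ?u \<omega>} \<le> exp (- d)"
    using n by (simp add: divide_right_mono)
  moreover have "{\<omega> \<in> space M. real n * exp (- d) \<le> ?u \<omega>} =
      {\<omega> \<in> space M. real n * exp (- d) \<le> (\<Sum>y<n. if ?a \<le> C \<omega> y then 1 else 0)}"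
    by (intro Collect_cong conj_cong refl arg_cong2[where f = "(\<le>)"] sum.cong) (auto simp: indicator_def)
  ultimately show ?thesis by simp
qed

end

context comparable_chain
begin

text \<open>The Chernoff parameter \<open>u\<close> is tied to the sizes of \<open>A\<close> and \<open>B\<close>, so that no union bound over the
  value of \<open>e \<omega> A B\<close> (at most \<open>T\<close>, which may be huge compared to \<open>n\<close>) is needed.\<close>

lemma discrepancy_uniform:
  fixes D :: real
  assumes D: "D \<ge> 0"
  shows "prob {\<omega> \<in> space M. \<exists>A\<in>Pow {..<n} - {{}}. \<exists>B\<in>Pow {..<n} - {{}}.
      \<exists>u\<in>{1, (1 - ln (max (card A) (card B) / n)) / 4}. (\<Sum>x\<in>A. R \<omega> x) \<le> D * card A \<and>
        6 * real n * ent (max (card A) (card B) / n) + c1 * D * card A * card B / n * exp u \<le> u * e \<omega> A B}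
    \<le> 2 / real n ^ 2" (is "prob ?bad \<le> _")
proof -
  let ?S = "Pow {..<n} - {{}}"
  define m where "m A B = real (max (card A) (card B)) / n" for A B :: "nat set"
  define w where "w A = exp (- (3 * n * ent (card A / n)))" for A :: "nat set"
  have frac: "0 < card A / real n" "card A / real n \<le> 1" if "A \<in> ?S" for A
  proof -
    have A: "A \<subseteq> {..<n}" "A \<noteq> {}" using that by auto
    then have "finite A" using finite_subset by blast
    then have "card A > 0" using A by (simp add: card_gt_0_iff)
    moreover have "card A \<le> n" using card_mono[OF _ A(1)] by simp
    ultimately show "0 < card A / real n" "card A / real n \<le> 1" using n by auto
  qed
  define Q where "Q A B u \<omega> \<longleftrightarrow> (\<Sum>x\<in>A. R \<omega> x) \<le> D * card A \<and>
      6 * real n * ent (m A B) + c1 * D * card A * card B / n * exp u \<le> u * e \<omega> A B" for A B u \<omega>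
  have meas: "{\<omega> \<in> space M. Q A B u \<omega>} \<in> events" for A B u unfolding Q_def by measurable
  have tail: "prob {\<omega> \<in> space M. Q A B u \<omega>} \<le> w A * w B"
    if AB: "A \<in> ?S" "B \<in> ?S" and u: "u \<in> {1, (1 - ln (m A B)) / 4}" for A B u
  proof -
    have m: "0 < m A B" "m A B \<le> 1" "card A / real n \<le> m A B" "card B / real n \<le> m A B"
      using frac[OF AB(1)] frac[OF AB(2)] by (auto simp: m_def max_def divide_right_mono)
    have "ln (m A B) \<le> 0" using m by simp
    then have u0: "u \<ge> 0" using u by auto
    have "ent (card A / n) \<le> ent (m A B)" "ent (card B / n) \<le> ent (m A B)"
      using m frac[OF AB(1)] frac[OF AB(2)] by (auto intro!: ent_mono)
    then have ent: "real n * ent (card A / n) \<le> real n * ent (m A B)"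
      "real n * ent (card B / n) \<le> real n * ent (m A B)"
      by (auto intro: mult_left_mono)
    have "prob {\<omega> \<in> space M. Q A B u \<omega>} \<le> exp (- (6 * real n * ent (m A B)))"
      unfolding Q_def using AB u0 D by (intro discrepancy_tail) auto
    \<comment> \<open>Here \<open>6 = 3 + 3\<close>: by monotonicity \<open>ent (m A B)\<close>
      dominates the entropies of both sizes, so the exponent pays for the choice of \<open>A\<close>
      and for that of \<open>B\<close>, each as in \<open>sum_subsets_ent\<close>.\<close>
    also have "\<dots> \<le> exp (- (3 * n * ent (card A / n)) + - (3 * n * ent (card B / n)))"
      using ent by simp
    finally show ?thesis unfolding exp_add w_def .
  qed
  have finS: "finite ?S" and finU: "finite {1, x}" for x :: real by auto
  have "prob {\<omega> \<in> space M. \<exists>A\<in>?S. \<exists>B\<in>?S. \<exists>u\<in>{1, (1 - ln (m A B)) / 4}. Q A B u \<omega>} \<le>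
      (\<Sum>A\<in>?S. \<Sum>B\<in>?S. \<Sum>u\<in>{1, (1 - ln (m A B)) / 4}. w A * w B)"
  proof (rule union_bound[OF finS sets.sets_Collect_finite_Ex[OF sets.sets_Collect_finite_Ex[OF meas finU] finS]])
    fix A assume A: "A \<in> ?S"
    show "prob {\<omega> \<in> space M. \<exists>B\<in>?S. \<exists>u\<in>{1, (1 - ln (m A B)) / 4}. Q A B u \<omega>} \<le>
        (\<Sum>B\<in>?S. \<Sum>u\<in>{1, (1 - ln (m A B)) / 4}. w A * w B)"
    proof (rule union_bound[OF finS sets.sets_Collect_finite_Ex[OF meas finU]])
      fix B assume B: "B \<in> ?S"
      show "prob {\<omega> \<in> space M. \<exists>u\<in>{1, (1 - ln (m A B)) / 4}. Q A B u \<omega>} \<le>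
          (\<Sum>u\<in>{1, (1 - ln (m A B)) / 4}. w A * w B)"
        by (rule union_bound[OF finU meas tail[OF A B]])
    qed
  qed
  then have "prob ?bad \<le> (\<Sum>A\<in>?S. \<Sum>B\<in>?S. \<Sum>u\<in>{1, (1 - ln (m A B)) / 4}. w A * w B)"
    by (simp only: Q_def m_def)
  also have "\<dots> \<le> (\<Sum>A\<in>?S. \<Sum>B\<in>?S. 2 * (w A * w B))"
    by (intro sum_mono) (auto simp: card_insert_if w_def)
  also have "\<dots> = 2 * ((\<Sum>A\<in>?S. w A) * (\<Sum>B\<in>?S. w B))"
    unfolding sum_product by (simp only: sum_distrib_left)
  also have "\<dots> \<le> 2 * (1 / n * (1 / n))"
    using sum_subsets_ent[OF n] unfolding w_def
    by (intro mult_left_mono mult_mono) (auto intro!: sum_nonneg)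
  also have "\<dots> = 2 / real n ^ 2" by (simp add: power2_eq_square)
  finally show ?thesis .
qed

end

section \<open>Heavy pairs\<close>

lemma sum_powers_le:
  fixes c :: real
  assumes "c > 0"
  shows "(\<Sum>t<S. if 2 ^ t \<le> c then 2 ^ t / c else 0) \<le> 2"
proof -
  \<comment> \<open>The bound by \<open>2 ^ S\<close> carries the induction: when a term
    \<open>2 ^ S \<le> c\<close> is added, the new sum is at most
    \<open>2 * 2 ^ S \<le> 2 * c\<close>.\<close>
  have "(\<Sum>t<S. if 2 ^ t \<le> c then 2 ^ t else 0) \<le> 2 * c \<and> (\<Sum>t<S. if 2 ^ t \<le> c then 2 ^ t else 0) \<le> (2 :: real) ^ S"
    using assms by (induction S) auto
  then have "(\<Sum>t<S. if 2 ^ t \<le> c then 2 ^ t else 0) / c \<le> 2"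
    using assms by (simp add: divide_le_eq)
  moreover have "(\<Sum>t<S. if 2 ^ t \<le> c then 2 ^ t / c else 0) = (\<Sum>t<S. if 2 ^ t \<le> c then 2 ^ t else 0) / c"
    unfolding sum_divide_distrib by (intro sum.cong) auto
  ultimately show ?thesis by simp
qed

lemma sum_inverse_powers_le:
  fixes c :: real
  assumes c: "c > 0"
  shows "(\<Sum>t<S. if c \<le> 2 ^ t then c / 2 ^ t else 0) \<le> 2"
proof -
  define G where "G S = (\<Sum>t<S. if c \<le> 2 ^ t then c / 2 ^ t else 0)" for S
  \<comment> \<open>\<open>2 * c / 2 ^ S\<close> is the geometric tail starting at index
    \<open>S\<close>. With it subtracted from 2, the bound reproduces itself when
    \<open>c / 2 ^ S\<close> is added.\<close>
  have "(2 ^ S \<le> c \<longrightarrow> G S = 0) \<and> (c < 2 ^ S \<longrightarrow> G S \<le> 2 - 2 * c / 2 ^ S)" for S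
  proof (induction S)
    case 0
    then show ?case using c by (simp add: G_def)
  next
    case (Suc S)
    have G: "G (Suc S) = G S + (if c \<le> 2 ^ S then c / 2 ^ S else 0)" by (simp add: G_def)
    consider "c < 2 ^ S" | "c = 2 ^ S" | "2 ^ S < c" "c < 2 ^ Suc S" | "2 ^ Suc S \<le> c" by linarith
    then show ?case
    proof cases
      case 1
      then have "\<not> 2 ^ Suc S \<le> c" using zero_less_power[of "2 :: real" S] unfolding power_Suc by linarith
      with 1 show ?thesis using Suc G by (auto simp: field_simps)
    next
      case 2
      then show ?thesis using Suc G c by (auto simp: field_simps)
    next
      case 3
      then show ?thesis using Suc G c by (auto simp: field_simps)
    next
      case 4
      then have "(2::real) ^ S < 2 ^ Suc S" by simp
      with 4 have "2 ^ S < c" by linarith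
      with 4 show ?thesis using Suc G by auto
    qed
  qed
  from this[of S] have "G S \<le> 2"
    using c by (cases "2 ^ S \<le> c") (auto intro: order_trans)
  then show ?thesis by (simp add: G_def)
qed

text \<open>Here \<open>a\<close> and \<open>b\<close> are the fractions of the coordinates of the two vectors with values of size about
  \<open>X\<close> and \<open>Y\<close> (up to normalisation), \<open>E\<close> is the number of transitions between them divided by \<open>n\<close>, and
  \<open>D\<close> is of order \<open>sqrt d\<close>. The five summands are chosen such that their sums over dyadic \<open>X\<close> and \<open>Y\<close>
  are bounded, as geometric series or through the norms of the vectors. The degree bound is used if
  \<open>X\<close> is much larger than \<open>Y\<close>; otherwise the discrepancy bound with the parameter \<open>1\<close> is used if \<open>b\<close> is
  not too small (so that \<open>ln b\<close> is bounded in terms of \<open>Y\<close>) and \<open>X < D\<close>, and with \<open>(1 - ln b) / 4\<close>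
  in the remaining cases.\<close>

lemma level_bound:
  fixes a b X Y D E K :: real
  assumes ab: "0 < a" "a \<le> b" "b \<le> 1" and XY: "1 \<le> X" "1 \<le> Y" "D \<le> X * Y" and D: "D > 0" and K: "K \<ge> 0"
    and deg: "E \<le> K * D\<^sup>2 * a"
    and disc1: "E \<le> K * (D\<^sup>2 * a * b * exp 1 + b * (1 - ln b))"
    and disc2: "(1 - ln b) / 4 * E \<le> K * (D\<^sup>2 * a * b * exp ((1 - ln b) / 4) + b * (1 - ln b))"
  shows "X * Y * E \<le> 8 * K * D * (a * X\<^sup>2 * (b * Y\<^sup>2)
    + a * X\<^sup>2 * (if Y \<le> X / D then Y / (X / D) else 0)
    + b * Y\<^sup>2 * (if X \<le> D * Y then X / (D * Y) else 0)
    + a * X\<^sup>2 * (if D / X \<le> Y then D / X / Y else 0)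
    + b * Y\<^sup>2 * (if X \<le> D then X / D else 0))" (is "_ \<le> 8 * K * D * (?t1 + ?t2 + ?t3 + ?t4 + ?t5)")
proof -
  have b: "b > 0" using ab by simp
  have t: "?t1 \<ge> 0" "?t2 \<ge> 0" "?t3 \<ge> 0" "?t4 \<ge> 0" "?t5 \<ge> 0"
    using ab b XY D by auto
  define W where "W = ?t1 + ?t2 + ?t3 + ?t4 + ?t5"
  have reduce: "X * Y * E \<le> 8 * K * D * W" if "X * Y * E \<le> K * (D * (8 * Z))" "Z \<le> W" for Z
  proof -
    have "K * (D * (8 * Z)) \<le> K * (D * (8 * W))"
      using that K D by (intro mult_left_mono) auto
    with that have "X * Y * E \<le> K * (D * (8 * W))" by linarith
    then show ?thesis by (simp add: mult_ac)
  qed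
  have lnb: "ln b \<le> 0" using ab b by simp
  have XY0: "X * Y > 0" using XY by simp
  have bY: "1 < b * Y ^ 4" if "b < (b * Y\<^sup>2)\<^sup>2"
  proof -
    have "b * 1 < b * (b * Y ^ 4)" using that by (simp add: power2_eq_square power4_eq_xxxx mult_ac)
    then show ?thesis using b by (simp only: mult_less_cancel_left_pos)
  qed
  consider (1) "D * Y \<le> X" | (3) "X < D * Y" "(b * Y\<^sup>2)\<^sup>2 \<le> b \<or> D \<le> X" | (4) "b < (b * Y\<^sup>2)\<^sup>2" "X < D"
    by linarith
  then have "X * Y * E \<le> 8 * K * D * W"
  proof cases
    case 1
    have "X * Y * E \<le> X * Y * (K * D\<^sup>2 * a)" using deg XY0 by (intro mult_left_mono) auto
    also have "\<dots> = K * (D * (a * X\<^sup>2 * (Y / (X / D))))"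
      using XY D by (simp add: field_simps power2_eq_square)
    also have "a * X\<^sup>2 * (Y / (X / D)) = ?t2"
      using 1 D by (simp add: pos_le_divide_eq mult.commute)
    also have "K * (D * ?t2) \<le> K * (D * (8 * ?t2))"
      using t(2) D K by (intro mult_left_mono) linarith+
    finally show ?thesis by (rule reduce) (use t in \<open>simp add: W_def\<close>)
  next
    case 3
    \<comment> \<open>\<open>w\<close> is \<open>b\<close> to the power \<open>- 1 / 4\<close>,
      which is \<open>exp ((1 - ln b) / 4)\<close> up to the factor
      \<open>exp (1 / 4) \<le> 2\<close>. The quarter in the parameter is chosen so that
      \<open>w\<close> can be compared with \<open>Y\<close> through \<open>b * Y ^ 4\<close>,
      according to whether that is below or above 1.\<close>
    define w where "w = exp (- ln b / 4)"
    have "w ^ 4 = exp (- ln b)"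
      unfolding w_def using exp_of_nat_mult[of 4 "- ln b / 4"] by simp
    then have w4: "b * w ^ 4 = 1" using b by (simp add: exp_minus)
    have w: "w > 0" by (simp add: w_def)
    have "exp ((1 - ln b) / 4) = exp (1 / 4) * w"
      unfolding w_def exp_add[symmetric] by (simp add: field_simps)
    also have "exp (1 / 4 :: real) \<le> 2"
    proof -
      have "exp (1 / 4 :: real) \<le> 1 + 1 / 4 + (1 / 4)\<^sup>2" by (rule exp_bound) auto
      then show ?thesis by (simp add: power2_eq_square)
    qed
    finally have ew: "exp ((1 - ln b) / 4) \<le> 2 * w" using w by (simp add: mult_right_mono)
    define u where "u = (1 - ln b) / 4"
    have u: "1 / 4 \<le> u" "1 - ln b = 4 * u" using lnb by (auto simp: u_def)
    have c: "D\<^sup>2 * a * b \<ge> 0" using ab b by simp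
    have "u * E \<le> K * (D\<^sup>2 * a * b * (2 * w) + b * (4 * u))"
    proof -
      have "D\<^sup>2 * a * b * exp u \<le> D\<^sup>2 * a * b * (2 * w)"
        using ew c unfolding u_def by (intro mult_left_mono)
      then have "K * (D\<^sup>2 * a * b * exp u + b * (4 * u)) \<le> K * (D\<^sup>2 * a * b * (2 * w) + b * (4 * u))"
        using K by (intro mult_left_mono) auto
      moreover have "u * E \<le> K * (D\<^sup>2 * a * b * exp u + b * (4 * u))"
        using disc2 unfolding u(2) by simp
      ultimately show ?thesis by linarith
    qed
    \<comment> \<open>The factor \<open>4 * u \<ge> 1\<close> is inserted so that \<open>u\<close>
      can be cancelled on both sides.\<close>
    also have "\<dots> \<le> K * (D\<^sup>2 * a * b * (2 * w) * (4 * u) + b * (4 * u))"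
    proof -
      have "D\<^sup>2 * a * b * (2 * w) * 1 \<le> D\<^sup>2 * a * b * (2 * w) * (4 * u)"
        using c w u by (intro mult_left_mono) auto
      then show ?thesis using K by (intro mult_left_mono) auto
    qed
    also have "\<dots> = u * (K * (8 * (D\<^sup>2 * a * b * w) + 4 * b))" by (simp add: algebra_simps)
    finally have E: "E \<le> K * (8 * (D\<^sup>2 * a * b * w) + 4 * b)" using u by simp
    have "X * Y * E \<le> X * Y * (K * (8 * (D\<^sup>2 * a * b * w) + 4 * b))"
      using E XY0 by (intro mult_left_mono) auto
    also have "\<dots> = K * (8 * (X * Y * (D\<^sup>2 * a * b * w)) + 4 * (D * (b * Y\<^sup>2 * (X / (D * Y)))))"
      using XY D by (simp add: field_simps power2_eq_square)
    also have "b * Y\<^sup>2 * (X / (D * Y)) = ?t3" using 3 by simp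
    finally have main: "X * Y * E \<le> K * (8 * (X * Y * (D\<^sup>2 * a * b * w)) + 4 * (D * ?t3))" .
    show ?thesis
    proof (cases "(b * Y\<^sup>2)\<^sup>2 \<le> b")
      case True
      \<comment> \<open>Fourth powers remove the root in \<open>w\<close>: the case assumption
        bounds this one by \<open>b\<^sup>2 * w ^ 4 = b \<le> 1\<close>.\<close>
      have "(b * Y\<^sup>2 * w) ^ 4 = ((b * Y\<^sup>2)\<^sup>2)\<^sup>2 * w ^ 4"
        by (simp add: power_mult_distrib flip: power_mult)
      also have "\<dots> \<le> b\<^sup>2 * w ^ 4"
        using True b w by (intro mult_right_mono power_mono) auto
      also have "\<dots> = b" using w4 by (simp add: power2_eq_square)
      also have "\<dots> \<le> 1 ^ 4" using ab by simp
      finally have "b * Y\<^sup>2 * w \<le> 1" by (rule power_le_imp_le_base[of _ 3, simplified]) simp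
      then have "D\<^sup>2 * a * X / Y * (b * Y\<^sup>2 * w) \<le> D\<^sup>2 * a * X / Y * 1"
        using ab XY by (intro mult_left_mono) auto
      moreover have "D\<^sup>2 * a * X / Y * (b * Y\<^sup>2 * w) = X * Y * (D\<^sup>2 * a * b * w)"
        using XY by (simp add: power2_eq_square)
      moreover have "D\<^sup>2 * a * X / Y * 1 = D * ?t4"
        using XY D by (simp add: field_simps power2_eq_square)
      ultimately have "X * Y * (D\<^sup>2 * a * b * w) \<le> D * ?t4" by simp
      then have "8 * (X * Y * (D\<^sup>2 * a * b * w)) + 4 * (D * ?t3) \<le> D * (8 * (?t4 + ?t3))"
        using mult_nonneg_nonneg[OF less_imp_le[OF D] t(3)] by (simp only: distrib_left)
      then have "X * Y * E \<le> K * (D * (8 * (?t4 + ?t3)))"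
        using main K by (meson mult_left_mono order_trans)
      then show ?thesis by (rule reduce) (use t in \<open>simp add: W_def\<close>)
    next
      case False
      then have DX: "D \<le> X" and big: "b < (b * Y\<^sup>2)\<^sup>2" using 3 by auto
      have "b * w ^ 4 \<le> b * Y ^ 4" using w4 bY[OF big] by simp
      then have "w ^ 4 \<le> Y ^ 4" using b by (simp only: mult_le_cancel_left_pos)
      then have wY: "w \<le> Y" by (rule power_le_imp_le_base[of _ 3, simplified]) (use XY in simp)
      have "X * Y * (D\<^sup>2 * a * b * w) \<le> X * Y * (D\<^sup>2 * a * b * Y)"
        using wY c XY0 by (intro mult_left_mono) auto
      also have "\<dots> = D * (a * X * (b * Y\<^sup>2)) * D" by (simp add: power2_eq_square)
      also have "\<dots> \<le> D * (a * X * (b * Y\<^sup>2)) * X"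
        using DX D ab b XY by (intro mult_left_mono) auto
      also have "\<dots> = D * ?t1" by (simp add: power2_eq_square)
      finally have "8 * (X * Y * (D\<^sup>2 * a * b * w)) + 4 * (D * ?t3) \<le> D * (8 * (?t1 + ?t3))"
        using mult_nonneg_nonneg[OF less_imp_le[OF D] t(3)] by (simp only: distrib_left)
      then have "X * Y * E \<le> K * (D * (8 * (?t1 + ?t3)))"
        using main K by (meson mult_left_mono order_trans)
      then show ?thesis by (rule reduce) (use t in \<open>simp add: W_def\<close>)
    qed
  next
    case 4
    \<comment> \<open>Here \<open>b\<close> is so large that \<open>- ln b < 4 * ln Y\<close>, and
      the entropy term costs only a factor of order \<open>Y\<close>. In the other term,
      \<open>D \<le> X * Y\<close> trades one factor \<open>D\<close> for \<open>X * Y\<close>,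
      which produces the product summand.\<close>
    have "0 < ln (b * Y ^ 4)" using bY[OF 4(1)] by simp
    also have "\<dots> = ln b + 4 * ln Y" using b XY by (simp add: ln_mult ln_realpow)
    finally have "- ln b < 4 * ln Y" by simp
    moreover have "ln Y \<le> Y - 1" using XY by (intro ln_le_minus_one) simp
    ultimately have lb: "1 - ln b \<le> 4 * Y" by simp
    have "E \<le> K * (D\<^sup>2 * a * b * 3 + b * (4 * Y))"
    proof -
      have "D\<^sup>2 * a * b * exp 1 \<le> D\<^sup>2 * a * b * 3" "b * (1 - ln b) \<le> b * (4 * Y)"
        using exp_le ab b lb by (auto intro!: mult_left_mono)
      then have "K * (D\<^sup>2 * a * b * exp 1 + b * (1 - ln b)) \<le> K * (D\<^sup>2 * a * b * 3 + b * (4 * Y))"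
        using K by (intro mult_left_mono) auto
      with disc1 show ?thesis by linarith
    qed
    then have "X * Y * E \<le> X * Y * (K * (D\<^sup>2 * a * b * 3 + b * (4 * Y)))"
      using XY0 by (intro mult_left_mono) auto
    also have "\<dots> = K * (3 * (D * (a * b * X * Y) * D) + 4 * (b * Y\<^sup>2 * X))"
      by (simp add: algebra_simps power2_eq_square)
    also have "b * Y\<^sup>2 * X = D * ?t5" using 4 D by simp
    also have "D * (a * b * X * Y) * D \<le> D * (a * b * X * Y) * (X * Y)"
      using XY ab b D by (intro mult_left_mono) auto
    also have "\<dots> = D * ?t1" by (simp add: power2_eq_square)
    finally have "X * Y * E \<le> K * (3 * (D * ?t1) + 4 * (D * ?t5))"
      using K by (simp add: mult_left_mono)
    also have "\<dots> \<le> K * (D * (8 * (?t1 + ?t5)))"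
    proof -
      have "3 * (D * ?t1) + 4 * (D * ?t5) \<le> D * (8 * (?t1 + ?t5))"
        using mult_nonneg_nonneg[OF less_imp_le[OF D] t(1)] mult_nonneg_nonneg[OF less_imp_le[OF D] t(5)]
        by (simp only: distrib_left)
      then show ?thesis using K by (intro mult_left_mono)
    qed
    finally show ?thesis by (rule reduce) (use t in \<open>simp add: W_def\<close>)
  qed
  then show ?thesis by (simp only: W_def)
qed

text \<open>The product summand of \<open>level_bound\<close> adds up to at most
  \<open>16 * 16\<close>. Each of the other four is a geometric series in one index weighted by a
  norm in the other and adds up to at most \<open>2 * 16\<close>. Hence
  \<open>256 + 4 * 32 = 384\<close> and \<open>8 * 384 = 3072\<close>. For empty levels, where the
  discrepancy bound is not assumed, \<open>deg\<close> forces \<open>E s t \<le> 0\<close>.\<close>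

lemma level_sum_bound:
  fixes a b :: "nat \<Rightarrow> real" and E :: "nat \<Rightarrow> nat \<Rightarrow> real"
  assumes a: "\<And>s. 0 \<le> a s" and b: "\<And>t. 0 \<le> b t" "\<And>t. b t \<le> 1"
    and sa: "(\<Sum>s<S. a s * (2 ^ s)\<^sup>2) \<le> 16" and sb: "(\<Sum>t<S. b t * (2 ^ t)\<^sup>2) \<le> 16"
    and D: "D > 0" and K: "K \<ge> 0"
    and deg: "\<And>s t. E s t \<le> K * D\<^sup>2 * a s"
    and disc: "\<And>s t u. 0 < a s \<Longrightarrow> a s \<le> b t \<Longrightarrow> u \<in> {1, (1 - ln (b t)) / 4} \<Longrightarrow>
      u * E s t \<le> K * (D\<^sup>2 * a s * b t * exp u + b t * (1 - ln (b t)))"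
  shows "(\<Sum>s<S. \<Sum>t<S. if a s \<le> b t \<and> D \<le> 2 ^ s * 2 ^ t then 2 ^ s * 2 ^ t * E s t else 0) \<le> 3072 * K * D"
proof -
  define A where "A s = a s * (2 ^ s)\<^sup>2" for s
  define B where "B t = b t * (2 ^ t)\<^sup>2" for t
  have A0: "A s \<ge> 0" and B0: "B s \<ge> 0" for s using a b by (auto simp: A_def B_def)
  define g2 where "g2 s t = (if 2 ^ t \<le> 2 ^ s / D then 2 ^ t / (2 ^ s / D) else 0)" for s t :: nat
  define g3 where "g3 s t = (if 2 ^ s \<le> D * 2 ^ t then 2 ^ s / (D * 2 ^ t) else 0)" for s t :: nat
  define g4 where "g4 s t = (if D / 2 ^ s \<le> 2 ^ t then D / 2 ^ s / 2 ^ t else 0)" for s t :: nat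
  define g5 where "g5 s = (if 2 ^ s \<le> D then 2 ^ s / D else 0)" for s :: nat
  have nonneg: "g2 s t \<ge> 0" "g3 s t \<ge> 0" "g4 s t \<ge> 0" "g5 s \<ge> 0" for s t
    using D by (auto simp: g2_def g3_def g4_def g5_def)
  define W where "W s t = A s * B t + A s * g2 s t + B t * g3 s t + A s * g4 s t + B t * g5 s" for s t
  have W0: "W s t \<ge> 0" for s t
    unfolding W_def using A0 B0 nonneg by (intro add_nonneg_nonneg mult_nonneg_nonneg) auto
  have summand: "(if a s \<le> b t \<and> D \<le> 2 ^ s * 2 ^ t then 2 ^ s * 2 ^ t * E s t else 0) \<le> 8 * K * D * W s t" for s t
  proof (cases "a s \<le> b t \<and> D \<le> 2 ^ s * 2 ^ t")
    case True
    show ?thesis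
    proof (cases "a s > 0")
      case pos: True
      have "2 ^ s * 2 ^ t * E s t \<le> 8 * K * D * W s t"
        unfolding W_def A_def B_def g2_def g3_def g4_def g5_def
      proof (rule level_bound)
        show "E s t \<le> K * (D\<^sup>2 * a s * b t * exp 1 + b t * (1 - ln (b t)))"
          using disc[of s t 1] True pos by simp
        show "(1 - ln (b t)) / 4 * E s t \<le>
            K * (D\<^sup>2 * a s * b t * exp ((1 - ln (b t)) / 4) + b t * (1 - ln (b t)))"
          by (rule disc) (use True pos in auto)
      qed (use pos True D K deg b in auto)
      then show ?thesis using True by simp
    next
      case False
      then have "a s = 0" using a[of s] by linarith
      then have "E s t \<le> 0" using deg[of s t] by simp
      then have "2 ^ s * 2 ^ t * E s t \<le> 0" by (intro mult_nonneg_nonpos) auto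
      also have "0 \<le> 8 * K * D * W s t" using W0[of s t] K D by simp
      finally show ?thesis using True by simp
    qed
  next
    case False
    have "0 \<le> 8 * K * D * W s t"
      using W0[of s t] K D by (intro mult_nonneg_nonneg) auto
    with False show ?thesis by (subst if_not_P) auto
  qed
  have sumA: "(\<Sum>s<S. A s) \<le> 16" and sumB: "(\<Sum>t<S. B t) \<le> 16"
    using sa sb by (simp_all add: A_def B_def)
  have A2: "(\<Sum>s<S. A s * h s) \<le> 32" if "\<And>s. h s \<le> 2" for h
  proof -
    have "(\<Sum>s<S. A s * h s) \<le> (\<Sum>s<S. A s * 2)" using A0 that by (intro sum_mono mult_left_mono) auto
    then show ?thesis using sumA by (simp add: sum_distrib_right[symmetric])
  qed
  have B2: "(\<Sum>s<S. B s * h s) \<le> 32" if "\<And>s. h s \<le> 2" for h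
  proof -
    have "(\<Sum>s<S. B s * h s) \<le> (\<Sum>s<S. B s * 2)" using B0 that by (intro sum_mono mult_left_mono) auto
    then show ?thesis using sumB by (simp add: sum_distrib_right[symmetric])
  qed
  have w1: "(\<Sum>s<S. \<Sum>t<S. A s * B t) \<le> 256"
  proof -
    have "(\<Sum>s<S. \<Sum>t<S. A s * B t) = (\<Sum>s<S. A s) * (\<Sum>t<S. B t)" by (simp add: sum_product)
    also have "\<dots> \<le> 16 * 16" using sumA sumB A0 B0 by (intro mult_mono sum_nonneg) auto
    finally show ?thesis by simp
  qed
  have w2: "(\<Sum>s<S. \<Sum>t<S. A s * g2 s t) \<le> 32"
  proof -
    have "(\<Sum>t<S. g2 s t) \<le> 2" for s unfolding g2_def using D by (intro sum_powers_le) simp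
    from A2[OF this] show ?thesis by (simp add: sum_distrib_left)
  qed
  have w4: "(\<Sum>s<S. \<Sum>t<S. A s * g4 s t) \<le> 32"
  proof -
    have "(\<Sum>t<S. g4 s t) \<le> 2" for s unfolding g4_def using D by (intro sum_inverse_powers_le) simp
    from A2[OF this] show ?thesis by (simp add: sum_distrib_left)
  qed
  have w3: "(\<Sum>s<S. \<Sum>t<S. B t * g3 s t) \<le> 32"
  proof -
    have "(\<Sum>s<S. g3 s t) \<le> 2" for t unfolding g3_def using D by (intro sum_powers_le) simp
    from B2[OF this] show ?thesis by (subst sum.swap) (simp add: sum_distrib_left)
  qed
  have w5: "(\<Sum>s<S. \<Sum>t<S. B t * g5 s) \<le> 32"
  proof -
    have "(\<Sum>s<S. g5 s) \<le> 2" unfolding g5_def using D by (intro sum_powers_le) simp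
    from B2[OF this] show ?thesis by (subst sum.swap) (simp add: sum_distrib_left)
  qed
  have "(\<Sum>s<S. \<Sum>t<S. if a s \<le> b t \<and> D \<le> 2 ^ s * 2 ^ t then 2 ^ s * 2 ^ t * E s t else 0) \<le>
      (\<Sum>s<S. \<Sum>t<S. 8 * K * D * W s t)"
    by (intro sum_mono summand)
  also have "\<dots> = 8 * K * D * (\<Sum>s<S. \<Sum>t<S. W s t)" by (simp add: sum_distrib_left)
  also have "(\<Sum>s<S. \<Sum>t<S. W s t) \<le> 384"
    unfolding W_def sum.distrib using w1 w2 w3 w4 w5 by linarith
  then have "8 * K * D * (\<Sum>s<S. \<Sum>t<S. W s t) \<le> 8 * K * D * 384"
    using K D by (intro mult_left_mono) auto
  finally show ?thesis by simp
qed

section \<open>Dyadic level sets of lattice vectors\<close>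

definition level :: "nat \<Rightarrow> (nat \<Rightarrow> int) \<Rightarrow> nat \<Rightarrow> nat set" where
  "level n k s = {x. x < n \<and> k x \<noteq> 0 \<and> floor_log (nat \<bar>k x\<bar>) = s}"

lemma level_abs:
  assumes "x \<in> level n k s"
  shows "2 ^ s \<le> \<bar>real_of_int (k x)\<bar>" "\<bar>real_of_int (k x)\<bar> < 2 * 2 ^ s"
proof -
  define j where "j = nat \<bar>k x\<bar>"
  have j: "j > 0" "floor_log j = s" using assms by (auto simp: level_def j_def)
  have jk: "real j = \<bar>real_of_int (k x)\<bar>" by (simp add: j_def)
  have "2 ^ s \<le> j" using floor_log_exp2_le[of j] j by simp
  then have "real (2 ^ s) \<le> real j" by (rule of_nat_mono)
  then show "2 ^ s \<le> \<bar>real_of_int (k x)\<bar>" unfolding jk[symmetric] by simp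
  have "j < 2 * 2 ^ s" using floor_log_exp2_gt[of j] j by simp
  then have "real j < real (2 * 2 ^ s)" by (rule of_nat_less_iff[THEN iffD2])
  then show "\<bar>real_of_int (k x)\<bar> < 2 * 2 ^ s" unfolding jk[symmetric] by simp
qed

lemma sum_levels:
  fixes f :: "nat \<Rightarrow> real"
  assumes k: "k \<in> lattice_ball n" and f: "\<And>x. x < n \<Longrightarrow> k x = 0 \<Longrightarrow> f x = 0"
  shows "(\<Sum>x<n. f x) = (\<Sum>s<16 * n. \<Sum>x\<in>level n k s. f x)"
proof -
  let ?S = "{x. x < n \<and> k x \<noteq> 0}"
  have "(\<Sum>x<n. f x) = (\<Sum>x\<in>?S. f x)"
    using f by (intro sum.mono_neutral_right) auto
  also have "\<dots> = (\<Sum>s<16 * n. \<Sum>x\<in>{x \<in> ?S. floor_log (nat \<bar>k x\<bar>) = s}. f x)"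
  proof (rule sum.group[symmetric])
    show "(\<lambda>x. floor_log (nat \<bar>k x\<bar>)) ` ?S \<subseteq> {..<16 * n}"
    proof
      fix s assume "s \<in> (\<lambda>x. floor_log (nat \<bar>k x\<bar>)) ` ?S"
      then obtain x where x: "x < n" "k x \<noteq> 0" "s = floor_log (nat \<bar>k x\<bar>)" by auto
      have "\<bar>k x\<bar> * 1 \<le> \<bar>k x\<bar> * \<bar>k x\<bar>" using x by (intro mult_left_mono) auto
      also have "\<dots> = (k x)\<^sup>2" by (simp add: power2_eq_square)
      also have "\<dots> \<le> (\<Sum>x<n. (k x)\<^sup>2)" using x by (intro member_le_sum) auto
      also have "\<dots> \<le> 16 * int n" using k by (simp add: lattice_ball_def)
      finally have "nat \<bar>k x\<bar> \<le> 16 * n" by simp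
      moreover have "2 ^ s \<le> nat \<bar>k x\<bar>" using floor_log_exp2_le[of "nat \<bar>k x\<bar>"] x by simp
      \<comment> \<open>A crude count of the levels is enough: the bound of
        \<open>level_sum_bound\<close> does not depend on their number.\<close>
      moreover have "s < 2 ^ s" by (rule less_exp)
      ultimately have "s < 16 * n" by linarith
      then show "s \<in> {..<16 * n}" by simp
    qed
  qed auto
  also have "\<dots> = (\<Sum>s<16 * n. \<Sum>x\<in>level n k s. f x)"
    by (intro sum.cong) (auto simp: level_def)
  finally show ?thesis .
qed

lemma level_weight:
  assumes k: "k \<in> lattice_ball n" and n: "n > 0"
  shows "(\<Sum>s<16 * n. card (level n k s) / n * (2 ^ s)\<^sup>2) \<le> 16"
proof -
  have "(\<Sum>s<16 * n. card (level n k s) / n * (2 ^ s)\<^sup>2) = (\<Sum>s<16 * n. \<Sum>x\<in>level n k s. (2 ^ s)\<^sup>2) / n"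
    by (simp add: sum_divide_distrib)
  also have "\<dots> \<le> (\<Sum>s<16 * n. \<Sum>x\<in>level n k s. (real_of_int (k x))\<^sup>2) / n"
  proof (intro divide_right_mono sum_mono)
    fix s x assume "x \<in> level n k s"
    from level_abs(1)[OF this] show "(2 ^ s)\<^sup>2 \<le> (real_of_int (k x))\<^sup>2"
      using power_mono[of "2 ^ s" "\<bar>real_of_int (k x)\<bar>" 2] by simp
  qed simp
  also have "(\<Sum>s<16 * n. \<Sum>x\<in>level n k s. (real_of_int (k x))\<^sup>2) = (\<Sum>x<n. (real_of_int (k x))\<^sup>2)"
    by (rule sum_levels[OF k, symmetric]) simp
  also have "(\<Sum>x<n. (real_of_int (k x))\<^sup>2) / n \<le> 16"
    using n lattice_ball_sum_le[OF k] by (simp add: divide_le_eq)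
  finally show ?thesis .
qed

text \<open>For a pair of levels \<open>s\<close>, \<open>t\<close> the products
  \<open>k x * l y\<close> have size between \<open>2 ^ s * 2 ^ t\<close> and four times that, so
  the cutoff \<open>4 * D\<close> leaves only pairs with \<open>D \<le> 2 ^ s * 2 ^ t\<close>. These
  are split according to which level set is larger; \<open>level_sum_bound\<close> treats one half
  directly and the other half transposed, with the column bound in place of the row bound. Hence the
  constant \<open>4 * (3072 + 3072)\<close>.\<close>

lemma heavy_bound:
  fixes N :: "nat \<Rightarrow> nat \<Rightarrow> real" and D K :: real
  assumes n: "n > 0" and k: "k \<in> lattice_ball n" and l: "l \<in> lattice_ball n"
    and N: "\<And>x y. 0 \<le> N x y" and D: "D > 0" and K: "K \<ge> 0"
    and row: "\<And>x. x < n \<Longrightarrow> k x \<noteq> 0 \<Longrightarrow> (\<Sum>y<n. N x y) \<le> K * D\<^sup>2"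
    and col: "\<And>y. y < n \<Longrightarrow> l y \<noteq> 0 \<Longrightarrow> (\<Sum>x<n. N x y) \<le> K * D\<^sup>2"
    and disc: "\<And>A B u. A \<subseteq> {x. x < n \<and> k x \<noteq> 0} \<Longrightarrow> B \<subseteq> {y. y < n \<and> l y \<noteq> 0} \<Longrightarrow> A \<noteq> {} \<Longrightarrow> B \<noteq> {} \<Longrightarrow>
      u \<in> {1, (1 - ln (max (card A) (card B) / n)) / 4} \<Longrightarrow>
      u * (\<Sum>x\<in>A. \<Sum>y\<in>B. N x y) \<le>
        K * (D\<^sup>2 * card A * card B / n * exp u + n * ent (max (card A) (card B) / n))"
  shows "(\<Sum>x<n. \<Sum>y<n. if 4 * D \<le> \<bar>real_of_int (k x * l y)\<bar> then \<bar>real_of_int (k x * l y)\<bar> * N x y else 0)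
    \<le> 24576 * K * D * n"
proof -
  define S where "S = 16 * n"
  define a where "a s = card (level n k s) / real n" for s
  define b where "b t = card (level n l t) / real n" for t
  define E where "E s t = (\<Sum>x\<in>level n k s. \<Sum>y\<in>level n l t. N x y) / n" for s t
  have E0: "E s t \<ge> 0" for s t using N by (auto simp: E_def intro!: sum_nonneg divide_nonneg_nonneg)
  have card: "card (level n k s) \<le> n" for k s
    using card_mono[of "{..<n}" "level n k s"] by (auto simp: level_def)
  have ab: "0 \<le> a s" "a s \<le> 1" "0 \<le> b s" "b s \<le> 1" for s
    using n card by (auto simp: a_def b_def divide_le_eq)
  have deg1: "E s t \<le> K * D\<^sup>2 * a s" for s t
  proof -
    have "(\<Sum>x\<in>level n k s. \<Sum>y\<in>level n l t. N x y) \<le> (\<Sum>x\<in>level n k s. K * D\<^sup>2)"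
    proof (rule sum_mono)
      fix x assume x: "x \<in> level n k s"
      have "(\<Sum>y\<in>level n l t. N x y) \<le> (\<Sum>y<n. N x y)"
        using N by (intro sum_mono2) (auto simp: level_def)
      also have "\<dots> \<le> K * D\<^sup>2" using x by (intro row) (auto simp: level_def)
      finally show "(\<Sum>y\<in>level n l t. N x y) \<le> K * D\<^sup>2" .
    qed
    then show ?thesis using n by (simp add: E_def a_def divide_right_mono mult.commute)
  qed
  have deg2: "E s t \<le> K * D\<^sup>2 * b t" for s t
  proof -
    have "(\<Sum>x\<in>level n k s. \<Sum>y\<in>level n l t. N x y) = (\<Sum>y\<in>level n l t. \<Sum>x\<in>level n k s. N x y)"
      by (rule sum.swap)
    also have "\<dots> \<le> (\<Sum>y\<in>level n l t. K * D\<^sup>2)"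
    proof (rule sum_mono)
      fix y assume y: "y \<in> level n l t"
      have "(\<Sum>x\<in>level n k s. N x y) \<le> (\<Sum>x<n. N x y)"
        using N by (intro sum_mono2) (auto simp: level_def)
      also have "\<dots> \<le> K * D\<^sup>2" using y by (intro col) (auto simp: level_def)
      finally show "(\<Sum>x\<in>level n k s. N x y) \<le> K * D\<^sup>2" .
    qed
    finally show ?thesis using n by (simp add: E_def b_def divide_right_mono mult.commute)
  qed
  have disc': "u * E s t \<le> K * (D\<^sup>2 * a s * b t * exp u + m * (1 - ln m))"
    if "0 < a s" "0 < b t" "m = max (a s) (b t)" "u \<in> {1, (1 - ln m) / 4}" for s t u m
  proof -
    have m: "m = max (card (level n k s)) (card (level n l t)) / real n"
      using that(3) n by (auto simp: a_def b_def max_def divide_le_cancel)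
    have ne: "level n k s \<noteq> {}" "level n l t \<noteq> {}" using that(1,2) by (auto simp: a_def b_def)
    have "u * (\<Sum>x\<in>level n k s. \<Sum>y\<in>level n l t. N x y) \<le>
        K * (D\<^sup>2 * card (level n k s) * card (level n l t) / n * exp u + n * ent m)"
      unfolding m using ne that(4) by (intro disc) (auto simp: level_def m)
    then have "u * (\<Sum>x\<in>level n k s. \<Sum>y\<in>level n l t. N x y) / n \<le>
        K * (D\<^sup>2 * card (level n k s) * card (level n l t) / n * exp u + n * ent m) / n"
      by (rule divide_right_mono) simp
    then show ?thesis using n
      by (simp add: E_def a_def b_def ent_def distrib_left add_divide_distrib mult_ac)
  qed
  have sa: "(\<Sum>s<S. a s * (2 ^ s)\<^sup>2) \<le> 16" and sb: "(\<Sum>t<S. b t * (2 ^ t)\<^sup>2) \<le> 16"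
    using level_weight[OF k n] level_weight[OF l n] by (simp_all add: S_def a_def b_def)
  have half1: "(\<Sum>s<S. \<Sum>t<S. if a s \<le> b t \<and> D \<le> 2 ^ s * 2 ^ t then 2 ^ s * 2 ^ t * E s t else 0) \<le> 3072 * K * D"
  proof (rule level_sum_bound[OF ab(1,3,4) sa sb D K deg1])
    fix s t u assume "0 < a s" "a s \<le> b t" "u \<in> {1, (1 - ln (b t)) / 4}"
    then show "u * E s t \<le> K * (D\<^sup>2 * a s * b t * exp u + b t * (1 - ln (b t)))"
      by (intro disc') (auto simp: max_def)
  qed
  have half2: "(\<Sum>t<S. \<Sum>s<S. if b t \<le> a s \<and> D \<le> 2 ^ t * 2 ^ s then 2 ^ t * 2 ^ s * E s t else 0) \<le> 3072 * K * D"
  proof (rule level_sum_bound[where E = "\<lambda>t s. E s t", OF ab(3,1,2) sb sa D K deg2])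
    fix t s u assume *: "0 < b t" "b t \<le> a s" "u \<in> {1, (1 - ln (a s)) / 4}"
    have "u * E s t \<le> K * (D\<^sup>2 * a s * b t * exp u + a s * (1 - ln (a s)))"
      using * by (intro disc') (auto simp: max_def)
    then show "u * E s t \<le> K * (D\<^sup>2 * b t * a s * exp u + a s * (1 - ln (a s)))"
      by (simp add: mult_ac)
  qed
  let ?h = "\<lambda>x y. if 4 * D \<le> \<bar>real_of_int (k x * l y)\<bar> then \<bar>real_of_int (k x * l y)\<bar> * N x y else 0"
  have h0: "?h x y = 0" if "k x = 0 \<or> l y = 0" for x y using that D by auto
  have "(\<Sum>x<n. \<Sum>y<n. ?h x y) = (\<Sum>s<S. \<Sum>x\<in>level n k s. \<Sum>y<n. ?h x y)"
    unfolding S_def using h0 by (intro sum_levels[OF k] sum.neutral) simp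
  also have "\<dots> = (\<Sum>s<S. \<Sum>x\<in>level n k s. \<Sum>t<S. \<Sum>y\<in>level n l t. ?h x y)"
    unfolding S_def using h0 by (intro sum.cong refl sum_levels[OF l]) simp
  also have "\<dots> = (\<Sum>s<S. \<Sum>t<S. \<Sum>x\<in>level n k s. \<Sum>y\<in>level n l t. ?h x y)"
    by (intro sum.cong refl sum.swap)
  also have "\<dots> \<le> (\<Sum>s<S. \<Sum>t<S. 4 * n * (if D \<le> 2 ^ s * 2 ^ t then 2 ^ s * 2 ^ t * E s t else 0))"
  proof (intro sum_mono)
    fix s t
    have h: "?h x y \<le> (if D \<le> 2 ^ s * 2 ^ t then 4 * (2 ^ s * 2 ^ t) * N x y else 0)"
      if x: "x \<in> level n k s" and y: "y \<in> level n l t" for x y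
    proof -
      have "\<bar>real_of_int (k x)\<bar> * \<bar>real_of_int (l y)\<bar> \<le> (2 * 2 ^ s) * (2 * 2 ^ t)"
        using level_abs[OF x] level_abs[OF y] by (intro mult_mono) auto
      then have le: "\<bar>real_of_int (k x * l y)\<bar> \<le> 4 * (2 ^ s * 2 ^ t)" by (simp add: abs_mult)
      then have "\<bar>real_of_int (k x * l y)\<bar> * N x y \<le> 4 * (2 ^ s * 2 ^ t) * N x y"
        using N by (intro mult_right_mono)
      moreover have "0 \<le> 4 * (2 ^ s * 2 ^ t) * N x y" using N by simp
      ultimately show ?thesis using le by auto
    qed
    have "(\<Sum>x\<in>level n k s. \<Sum>y\<in>level n l t. ?h x y) \<le>
        (\<Sum>x\<in>level n k s. \<Sum>y\<in>level n l t. if D \<le> 2 ^ s * 2 ^ t then 4 * (2 ^ s * 2 ^ t) * N x y else 0)"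
      by (intro sum_mono h)
    also have "\<dots> = 4 * n * (if D \<le> 2 ^ s * 2 ^ t then 2 ^ s * 2 ^ t * E s t else 0)"
    proof -
      have "(\<Sum>x\<in>level n k s. \<Sum>y\<in>level n l t. N x y) = n * E s t" using n by (simp add: E_def)
      moreover have "(\<Sum>x\<in>level n k s. \<Sum>y\<in>level n l t. if D \<le> 2 ^ s * 2 ^ t then 4 * (2 ^ s * 2 ^ t) * N x y else 0) =
          (if D \<le> 2 ^ s * 2 ^ t then 4 * (2 ^ s * 2 ^ t) * (\<Sum>x\<in>level n k s. \<Sum>y\<in>level n l t. N x y) else 0)"
        by (simp add: sum_distrib_left)
      ultimately show ?thesis by simp
    qed
    finally show "(\<Sum>x\<in>level n k s. \<Sum>y\<in>level n l t. ?h x y) \<le> 4 * n * (if D \<le> 2 ^ s * 2 ^ t then 2 ^ s * 2 ^ t * E s t else 0)" .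
  qed
  also have "\<dots> = 4 * n * (\<Sum>s<S. \<Sum>t<S. if D \<le> 2 ^ s * 2 ^ t then 2 ^ s * 2 ^ t * E s t else 0)"
    by (simp add: sum_distrib_left)
  also have "(\<Sum>s<S. \<Sum>t<S. if D \<le> 2 ^ s * 2 ^ t then 2 ^ s * 2 ^ t * E s t else 0) \<le>
      (\<Sum>s<S. \<Sum>t<S. (if a s \<le> b t \<and> D \<le> 2 ^ s * 2 ^ t then 2 ^ s * 2 ^ t * E s t else 0) +
        (if b t \<le> a s \<and> D \<le> 2 ^ t * 2 ^ s then 2 ^ t * 2 ^ s * E s t else 0))"
    using E0 by (intro sum_mono) (auto simp: mult.commute)
  also have "\<dots> = (\<Sum>s<S. \<Sum>t<S. if a s \<le> b t \<and> D \<le> 2 ^ s * 2 ^ t then 2 ^ s * 2 ^ t * E s t else 0) +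
      (\<Sum>t<S. \<Sum>s<S. if b t \<le> a s \<and> D \<le> 2 ^ t * 2 ^ s then 2 ^ t * 2 ^ s * E s t else 0)"
    unfolding sum.distrib by (intro arg_cong2[where f = "(+)"] refl sum.swap)
  also have "\<dots> \<le> 3072 * K * D + 3072 * K * D" using half1 half2 by (rule add_mono)
  finally show ?thesis using n by (simp add: mult_ac)
qed

section \<open>Norm of the centered trimmed matrix\<close>

text \<open>Rounding towards zero does not increase the norm, which keeps the rounded vector in the ball.\<close>

definition truncate :: "real \<Rightarrow> int" where
  "truncate r = (if r \<ge> 0 then \<lfloor>r\<rfloor> else \<lceil>r\<rceil>)"

lemma truncate: "\<bar>real_of_int (truncate r)\<bar> \<le> \<bar>r\<bar>" "\<bar>r - real_of_int (truncate r)\<bar> \<le> 1"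
proof -
  have "\<bar>real_of_int (truncate r)\<bar> \<le> \<bar>r\<bar> \<and> \<bar>r - real_of_int (truncate r)\<bar> \<le> 1"
  proof (cases "r \<ge> 0")
    case True
    then have 0: "real_of_int \<lfloor>r\<rfloor> \<ge> 0" and t: "truncate r = \<lfloor>r\<rfloor>" by (simp_all add: truncate_def)
    have "real_of_int \<lfloor>r\<rfloor> \<le> r" "r < real_of_int \<lfloor>r\<rfloor> + 1" by linarith+
    with True 0 show ?thesis unfolding t by linarith
  next
    case False
    then have 0: "real_of_int \<lceil>r\<rceil> \<le> 0" and t: "truncate r = \<lceil>r\<rceil>" by (simp_all add: truncate_def)
    have "r \<le> real_of_int \<lceil>r\<rceil>" "real_of_int \<lceil>r\<rceil> < r + 1" by linarith+
    with False 0 show ?thesis unfolding t by linarith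
  qed
  then show "\<bar>real_of_int (truncate r)\<bar> \<le> \<bar>r\<bar>" "\<bar>r - real_of_int (truncate r)\<bar> \<le> 1" by auto
qed

text \<open>Rounding moves each coordinate of \<open>4 * sqrt n * u\<close> by at most 1, so the
  error vector has norm at most \<open>1 / 4\<close>. The last conclusion puts four times the error
  back into the unit ball, as the absorption argument in \<open>bilinear_net_bound\<close>
  requires.\<close>

lemma lattice_approximation:
  fixes u :: "nat \<Rightarrow> real"
  assumes n: "n > 0" and u: "(\<Sum>x<n. (u x)\<^sup>2) \<le> 1"
  obtains k where "k \<in> lattice_ball n" "(\<Sum>x<n. (real_of_int (k x) / (4 * sqrt n))\<^sup>2) \<le> 1"
    "(\<Sum>x<n. (4 * (u x - real_of_int (k x) / (4 * sqrt n)))\<^sup>2) \<le> 1"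
proof -
  define r where "r = 4 * sqrt n"
  have r: "r > 0" "r\<^sup>2 = 16 * real n" using n by (auto simp: r_def power_mult_distrib)
  define k where "k x = (if x < n then truncate (r * u x) else 0)" for x
  have le: "(real_of_int (k x))\<^sup>2 \<le> 16 * real n * (u x)\<^sup>2" if "x < n" for x
  proof -
    have "\<bar>real_of_int (k x)\<bar>\<^sup>2 \<le> \<bar>r * u x\<bar>\<^sup>2"
      using truncate(1)[of "r * u x"] that by (intro power_mono) (auto simp: k_def)
    then show ?thesis by (simp add: power_mult_distrib r(2))
  qed
  have sum: "(\<Sum>x<n. (real_of_int (k x))\<^sup>2) \<le> 16 * real n"
  proof -
    have "(\<Sum>x<n. (real_of_int (k x))\<^sup>2) \<le> (\<Sum>x<n. 16 * real n * (u x)\<^sup>2)"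
      using le by (intro sum_mono) simp
    also have "\<dots> = 16 * real n * (\<Sum>x<n. (u x)\<^sup>2)" by (simp add: sum_distrib_left)
    also have "\<dots> \<le> 16 * real n * 1" using u by (intro mult_left_mono) auto
    finally show ?thesis by simp
  qed
  have ball: "k \<in> lattice_ball n"
  proof -
    have "real_of_int (\<Sum>x<n. (k x)\<^sup>2) \<le> real_of_int (16 * int n)" using sum by simp
    then have "(\<Sum>x<n. (k x)\<^sup>2) \<le> 16 * int n" by (simp only: of_int_le_iff)
    then show ?thesis by (simp add: lattice_ball_def k_def)
  qed
  have "(\<Sum>x<n. (real_of_int (k x) / r)\<^sup>2) = (\<Sum>x<n. (real_of_int (k x))\<^sup>2) / (16 * real n)"
    by (simp add: power_divide r(2) sum_divide_distrib)
  also have "\<dots> \<le> 1" using sum n by (simp add: divide_le_eq)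
  finally have 1: "(\<Sum>x<n. (real_of_int (k x) / r)\<^sup>2) \<le> 1" .
  have "(\<Sum>x<n. (4 * (u x - real_of_int (k x) / r))\<^sup>2) \<le> (\<Sum>x<n. 1 / n)"
  proof (rule sum_mono)
    fix x assume "x \<in> {..<n}"
    then have x: "x < n" by simp
    have "(4 * (u x - real_of_int (k x) / r))\<^sup>2 = 16 * \<bar>r * u x - real_of_int (k x)\<bar>\<^sup>2 / r\<^sup>2"
    proof -
      have "4 * (u x - real_of_int (k x) / r) = 4 * (r * u x - real_of_int (k x)) / r"
        using r(1) by (simp add: field_simps)
      then show ?thesis by (simp only: power_mult_distrib power_divide power2_abs) simp
    qed
    also have "\<dots> \<le> 16 * 1\<^sup>2 / r\<^sup>2"
      using truncate(2)[of "r * u x"] x by (intro divide_right_mono mult_left_mono power_mono) (auto simp: k_def)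
    also have "\<dots> = 1 / n" using n by (simp add: r(2))
    finally show "(4 * (u x - real_of_int (k x) / r))\<^sup>2 \<le> 1 / n" .
  qed
  also have "\<dots> = 1" using n by simp
  finally show thesis using that ball 1 by (simp add: r_def)
qed

text \<open>A bound on the operator norm, stated for the bilinear form. Absolute values are
  unnecessary since \<open>u\<close> can be negated.\<close>

definition form_bounded :: "nat \<Rightarrow> (nat \<Rightarrow> nat \<Rightarrow> real) \<Rightarrow> real \<Rightarrow> bool" where
  "form_bounded n a c \<longleftrightarrow> (\<forall>u v. (\<Sum>x<n. \<Sum>y<n. u x * v y * a x y) \<le>
     c * (sqrt (\<Sum>x<n. (u x)\<^sup>2) * sqrt (\<Sum>y<n. (v y)\<^sup>2)))"

definition deviation ::
    "nat set \<Rightarrow> (nat \<Rightarrow> nat \<Rightarrow> real) \<Rightarrow> (nat \<Rightarrow> real) \<Rightarrow> (nat \<Rightarrow> nat \<Rightarrow> real) \<Rightarrow> nat \<Rightarrow> nat \<Rightarrow> real" where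
  "deviation G N r Q x y = (if x \<in> G \<and> y \<in> G then N x y - r x * Q x y else 0)"

text \<open>Absorption: for the supremum \<open>Z\<close> of the form over the unit ball, rounding
  either argument costs at most \<open>Z / 4\<close>, and the value on the net is at most
  \<open>c * n / (16 * n)\<close>. So \<open>Z \<le> c / 16 + Z / 2\<close>, where the crude bound
  by the sum of all entries guarantees that \<open>Z\<close> is a genuine supremum and may be
  subtracted.\<close>

lemma bilinear_net_bound:
  fixes A :: "nat \<Rightarrow> nat \<Rightarrow> real"
  assumes n: "n > 0"
    and net: "\<And>k l. k \<in> lattice_ball n \<Longrightarrow> l \<in> lattice_ball n \<Longrightarrow>
      (\<Sum>x<n. \<Sum>y<n. real_of_int (k x) * real_of_int (l y) * A x y) \<le> c * n"
  shows "form_bounded n A (c / 8)"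
  unfolding form_bounded_def
proof (intro allI)
  fix u v :: "nat \<Rightarrow> real"
  define F where "F u v = (\<Sum>x<n. \<Sum>y<n. u x * v y * A x y)" for u v :: "nat \<Rightarrow> real"
  define U where "U = {u :: nat \<Rightarrow> real. (\<Sum>x<n. (u x)\<^sup>2) \<le> 1}"
  have F_add1: "F (\<lambda>x. u x + u' x) v = F u v + F u' v" for u u' v
    by (simp add: F_def distrib_right sum.distrib)
  have F_add2: "F u (\<lambda>x. v x + v' x) = F u v + F u v'" for u v v'
    by (simp add: F_def distrib_right distrib_left sum.distrib)
  have F_mult1: "F (\<lambda>x. a * u x) v = a * F u v" for a u v
    by (simp add: F_def sum_distrib_left mult_ac)
  have F_mult2: "F u (\<lambda>x. a * v x) = a * F u v" for a u v
    by (simp add: F_def sum_distrib_left mult_ac)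
  define Z where "Z = (\<Squnion>(u, v)\<in>U \<times> U. F u v)"
  have bdd: "bdd_above ((\<lambda>(u, v). F u v) ` (U \<times> U))"
  proof (rule bdd_aboveI2)
    fix p assume "p \<in> U \<times> U"
    then obtain u v where p: "p = (u, v)" "u \<in> U" "v \<in> U" by auto
    have le1: "\<bar>w x\<bar> \<le> 1" if "w \<in> U" "x < n" for w x
    proof -
      have "(w x)\<^sup>2 \<le> (\<Sum>x<n. (w x)\<^sup>2)" using that by (intro member_le_sum) auto
      also have "\<dots> \<le> 1" using that by (simp add: U_def)
      finally show ?thesis by (simp add: abs_square_le_1)
    qed
    have "F u v \<le> (\<Sum>x<n. \<Sum>y<n. \<bar>A x y\<bar>)"
      unfolding F_def
    proof (intro sum_mono)
      fix x y assume "x \<in> {..<n}" "y \<in> {..<n}"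
      then have "\<bar>u x\<bar> * \<bar>v y\<bar> \<le> 1 * 1" using le1 p by (intro mult_mono) auto
      then have "\<bar>u x\<bar> * \<bar>v y\<bar> * \<bar>A x y\<bar> \<le> 1 * \<bar>A x y\<bar>" by (intro mult_right_mono) auto
      then show "u x * v y * A x y \<le> \<bar>A x y\<bar>"
        using abs_ge_self[of "u x * v y * A x y"] by (simp add: abs_mult)
    qed
    then show "(case p of (u, v) \<Rightarrow> F u v) \<le> (\<Sum>x<n. \<Sum>y<n. \<bar>A x y\<bar>)" by (simp add: p)
  qed
  have Z: "F u v \<le> Z" if "u \<in> U" "v \<in> U" for u v
    unfolding Z_def using cSUP_upper[OF _ bdd, of "(u, v)"] that by simp
  have step: "F u v \<le> c / 16 + Z / 2" if u: "u \<in> U" and v: "v \<in> U" for u v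
  proof -
    define r where "r = 4 * sqrt n"
    have r: "r * r = 16 * n" "r > 0" using n by (auto simp: r_def)
    obtain k where k: "k \<in> lattice_ball n" "(\<lambda>x. real_of_int (k x) / r) \<in> U"
      "(\<lambda>x. 4 * (u x - real_of_int (k x) / r)) \<in> U"
      using lattice_approximation[OF n, of u] u unfolding U_def r_def by auto
    obtain l where l: "l \<in> lattice_ball n" "(\<lambda>x. real_of_int (l x) / r) \<in> U"
      "(\<lambda>x. 4 * (v x - real_of_int (l x) / r)) \<in> U"
      using lattice_approximation[OF n, of v] v unfolding U_def r_def by auto
    let ?k = "\<lambda>x. real_of_int (k x) / r" and ?l = "\<lambda>x. real_of_int (l x) / r"
    have "F u v = F (\<lambda>x. (u x - ?k x) + ?k x) v" by simp
    also have "\<dots> = F (\<lambda>x. u x - ?k x) v + F ?k v" by (rule F_add1)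
    also have "F ?k v = F ?k (\<lambda>x. (v x - ?l x) + ?l x)" by simp
    also have "\<dots> = F ?k (\<lambda>x. v x - ?l x) + F ?k ?l" by (rule F_add2)
    finally have split: "F u v = F (\<lambda>x. u x - ?k x) v + (F ?k (\<lambda>x. v x - ?l x) + F ?k ?l)" .
    have "4 * F (\<lambda>x. u x - ?k x) v \<le> Z" using Z[OF k(3) v] unfolding F_mult1 .
    moreover have "4 * F ?k (\<lambda>x. v x - ?l x) \<le> Z" using Z[OF k(2) l(3)] unfolding F_mult2 .
    moreover have "F ?k ?l \<le> c / 16"
    proof -
      have "F ?k ?l = (\<Sum>x<n. \<Sum>y<n. real_of_int (k x) * real_of_int (l y) * A x y) / (r * r)"
        unfolding F_def sum_divide_distrib by (intro sum.cong refl) simp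
      also have "\<dots> \<le> c * n / (r * r)"
        using net[OF k(1) l(1)] r by (intro divide_right_mono) auto
      finally show ?thesis using n unfolding r(1) by simp
    qed
    ultimately show ?thesis using split by linarith
  qed
  have "U \<noteq> {}" by (auto simp: U_def intro!: exI[of _ "\<lambda>_. 0"])
  then have "Z \<le> c / 16 + Z / 2" unfolding Z_def by (intro cSUP_least) (use step Z_def in auto)
  then have Z8: "Z \<le> c / 8" by simp
  define a where "a = sqrt (\<Sum>x<n. (u x)\<^sup>2)"
  define b where "b = sqrt (\<Sum>y<n. (v y)\<^sup>2)"
  have ab: "a \<ge> 0" "b \<ge> 0" "a\<^sup>2 = (\<Sum>x<n. (u x)\<^sup>2)" "b\<^sup>2 = (\<Sum>y<n. (v y)\<^sup>2)"
    by (auto simp: a_def b_def sum_nonneg)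
  have zero: "w x = 0" if "(\<Sum>x<n. (w x)\<^sup>2) = 0" "x < n" for w :: "nat \<Rightarrow> real" and x
    using that by (subst (asm) sum_nonneg_eq_0_iff) auto
  have "F u v \<le> c / 8 * (a * b)"
  proof (cases "a = 0 \<or> b = 0")
    case True
    then have "(\<Sum>x<n. (u x)\<^sup>2) = 0 \<or> (\<Sum>y<n. (v y)\<^sup>2) = 0" using ab(3,4) by auto
    then have "F u v = 0" unfolding F_def using zero by (auto intro!: sum.neutral)
    with True show ?thesis by auto
  next
    case False
    then have pos: "a > 0" "b > 0" using ab by auto
    have "(\<lambda>x. 1 / a * u x) \<in> U" "(\<lambda>x. 1 / b * v x) \<in> U"
      using pos ab by (simp_all add: U_def power_divide flip: sum_divide_distrib)
    from Z[OF this] have "1 / a * (1 / b * F u v) \<le> c / 8"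
      using Z8 unfolding F_mult1 F_mult2 by linarith
    then have "F u v / (a * b) \<le> c / 8" by simp
    then show ?thesis using pos by (simp only: pos_divide_le_eq mult_pos_pos)
  qed
  then show "(\<Sum>x<n. \<Sum>y<n. u x * v y * A x y) \<le>
      c / 8 * (sqrt (\<Sum>x<n. (u x)\<^sup>2) * sqrt (\<Sum>y<n. (v y)\<^sup>2))"
    by (simp add: F_def a_def b_def)
qed

lemma ent_nonneg:
  assumes "0 \<le> z" "z \<le> 1"
  shows "0 \<le> ent z"
proof (cases "z = 0")
  case False
  then have "ln z \<le> 0" using assms by simp
  then show ?thesis unfolding ent_def using assms by (intro mult_nonneg_nonneg) auto
qed (simp add: ent_def)

text \<open>Above the cutoff \<open>s\<close> the counts and the compensator are bounded separately:
  the counts by \<open>heavy_bound\<close> with \<open>D = s / 4\<close>, the compensator because a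
  product of size at least \<open>s\<close> is at most its square divided by \<open>s\<close>. The
  summands of \<open>K\<close> serve the degree bound, the exponential term and the entropy term of
  the discrepancy; the factors 16 come from replacing \<open>s\<close> by \<open>s / 4\<close>. Net
  vectors are first set to zero outside \<open>G\<close>, which keeps them in the lattice
  ball.\<close>

lemma deviation_form_bound:
  fixes N Q :: "nat \<Rightarrow> nat \<Rightarrow> real" and s B c1 c2 :: real
    and n :: nat and G :: "nat set"
  defines "r \<equiv> \<lambda>x. \<Sum>y<n. N x y"
  defines "K \<equiv> 16 * B + 16 * c1 * B + 6"
  assumes n: "n > 0" and s: "s > 0" and B: "B \<ge> 0" and c1: "c1 \<ge> 0"
    and N: "\<And>x y. 0 \<le> N x y"
    and Q: "\<And>x y. x < n \<Longrightarrow> y < n \<Longrightarrow> 0 \<le> Q x y" "\<And>x y. x < n \<Longrightarrow> y < n \<Longrightarrow> Q x y \<le> c1 / n"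
    and row: "\<And>x. x \<in> G \<Longrightarrow> r x \<le> B * s\<^sup>2"
    and col: "\<And>y. y \<in> G \<Longrightarrow> (\<Sum>x<n. N x y) \<le> B * s\<^sup>2"
    and light: "\<And>k l. k \<in> lattice_ball n \<Longrightarrow> l \<in> lattice_ball n \<Longrightarrow> (\<And>x. k x \<noteq> 0 \<Longrightarrow> x \<in> G) \<Longrightarrow>
      (\<Sum>x<n. \<Sum>y<n. light s k l x y * (N x y - r x * Q x y)) \<le> c2 * n * s"
    and disc: "\<And>A A' w. A \<subseteq> G \<Longrightarrow> A' \<subseteq> G \<Longrightarrow> A \<subseteq> {..<n} \<Longrightarrow> A' \<subseteq> {..<n} \<Longrightarrow> A \<noteq> {} \<Longrightarrow> A' \<noteq> {} \<Longrightarrow>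
      w \<in> {1, (1 - ln (max (card A) (card A') / n)) / 4} \<Longrightarrow>
      w * (\<Sum>x\<in>A. \<Sum>y\<in>A'. N x y) \<le>
        6 * n * ent (max (card A) (card A') / n) + c1 * (B * s\<^sup>2) * card A * card A' / n * exp w"
  shows "form_bounded n (deviation G N r Q) ((c2 + 256 * c1 * B + 6144 * K) * s / 8)"
proof (rule bilinear_net_bound[OF n])
  fix k0 l0 assume kl0: "k0 \<in> lattice_ball n" "l0 \<in> lattice_ball n"
  define k where "k x = (if x \<in> G then k0 x else 0)" for x
  define l where "l x = (if x \<in> G then l0 x else 0)" for x
  have restr: "(\<lambda>x. if x \<in> G then j x else 0) \<in> lattice_ball n" if "j \<in> lattice_ball n" for j
  proof -
    have "(\<Sum>x<n. (if x \<in> G then j x else 0)\<^sup>2) \<le> (\<Sum>x<n. (j x)\<^sup>2)" by (intro sum_mono) auto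
    with that show ?thesis by (auto simp: lattice_ball_def)
  qed
  have k: "k \<in> lattice_ball n" and l: "l \<in> lattice_ball n"
    using restr[OF kl0(1)] restr[OF kl0(2)] unfolding k_def[abs_def] l_def[abs_def] by auto
  have kG: "x \<in> G" if "k x \<noteq> 0" for x using that by (auto simp: k_def split: if_splits)
  have lG: "x \<in> G" if "l x \<noteq> 0" for x using that by (auto simp: l_def split: if_splits)
  have K: "K \<ge> 0" using B c1 by (simp add: K_def)
  have KB: "B * s\<^sup>2 \<le> K * (s / 4)\<^sup>2"
  proof -
    have "16 * B * (s / 4)\<^sup>2 \<le> K * (s / 4)\<^sup>2"
      using B c1 by (intro mult_right_mono) (auto simp: K_def)
    then show ?thesis by (simp add: power_divide)
  qed
  let ?kl = "\<lambda>x y. real_of_int (k x * l y)"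
  let ?hv = "\<lambda>x y f. if s \<le> \<bar>?kl x y\<bar> then \<bar>?kl x y\<bar> * f else 0 :: real"
  have heavy: "(\<Sum>x<n. \<Sum>y<n. ?hv x y (N x y)) \<le> 6144 * K * s * n"
  proof -
    have "(\<Sum>x<n. \<Sum>y<n. if 4 * (s / 4) \<le> \<bar>?kl x y\<bar> then \<bar>?kl x y\<bar> * N x y else 0) \<le> 24576 * K * (s / 4) * n"
    proof (rule heavy_bound[OF n k l N _ K])
      show "(\<Sum>y<n. N x y) \<le> K * (s / 4)\<^sup>2" if "x < n" "k x \<noteq> 0" for x
        using row[OF kG[OF that(2)]] KB unfolding r_def by linarith
      show "(\<Sum>x<n. N x y) \<le> K * (s / 4)\<^sup>2" if "y < n" "l y \<noteq> 0" for y
        using col[OF lG[OF that(2)]] KB by linarith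
    next
      fix A A' w
      assume A: "A \<subseteq> {x. x < n \<and> k x \<noteq> 0}" "A' \<subseteq> {y. y < n \<and> l y \<noteq> 0}" "A \<noteq> {}" "A' \<noteq> {}"
        and w: "w \<in> {1, (1 - ln (max (card A) (card A') / n)) / 4}"
      let ?m = "max (card A) (card A') / n"
      have "card A \<le> n" "card A' \<le> n"
        using A card_mono[of "{..<n}" A] card_mono[of "{..<n}" A'] by auto
      then have m: "0 \<le> ?m" "?m \<le> 1" using n by auto
      have ent: "0 \<le> ent ?m" by (rule ent_nonneg[OF m])
      have "w * (\<Sum>x\<in>A. \<Sum>y\<in>A'. N x y) \<le>
          6 * n * ent ?m + c1 * (B * s\<^sup>2) * card A * card A' / n * exp w"
        using A w kG lG by (intro disc) auto
      also have "6 * n * ent ?m \<le> K * (n * ent ?m)"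
      proof -
        have "6 * (n * ent ?m) \<le> K * (n * ent ?m)"
          using ent B c1 by (intro mult_right_mono) (auto simp: K_def)
        then show ?thesis by simp
      qed
      also have "c1 * (B * s\<^sup>2) * card A * card A' / n * exp w \<le> K * ((s / 4)\<^sup>2 * card A * card A' / n * exp w)"
      proof -
        have "16 * c1 * B * ((s / 4)\<^sup>2 * card A * card A' / n * exp w) \<le> K * ((s / 4)\<^sup>2 * card A * card A' / n * exp w)"
          using B c1 by (intro mult_right_mono) (auto simp: K_def)
        then show ?thesis by (simp add: power_divide mult_ac)
      qed
      finally show "w * (\<Sum>x\<in>A. \<Sum>y\<in>A'. N x y) \<le>
          K * ((s / 4)\<^sup>2 * card A * card A' / n * exp w + n * ent ?m)"
        by (simp add: distrib_left add.commute)
    qed (use s in auto)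
    then show ?thesis by simp
  qed
  have heavyQ: "(\<Sum>x<n. \<Sum>y<n. ?hv x y (r x * Q x y)) \<le> 256 * c1 * B * s * n"
  proof -
    have "(\<Sum>x<n. \<Sum>y<n. ?hv x y (r x * Q x y)) \<le>
        (\<Sum>x<n. \<Sum>y<n. B * s * c1 / n * ((real_of_int (k x))\<^sup>2 * (real_of_int (l y))\<^sup>2))"
    proof (intro sum_mono)
      fix x y assume "x \<in> {..<n}" "y \<in> {..<n}"
      then have xy: "x < n" "y < n" by auto
      let ?R = "B * s * c1 / n * ((real_of_int (k x))\<^sup>2 * (real_of_int (l y))\<^sup>2)"
      have R0: "0 \<le> ?R" using B s c1 by simp
      show "?hv x y (r x * Q x y) \<le> ?R"
      proof (cases "s \<le> \<bar>?kl x y\<bar>")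
        case True
        then have "k x \<noteq> 0" using s by auto
        then have rx: "r x \<le> B * s\<^sup>2" using row kG by blast
        have "0 \<le> r x" using N by (simp add: r_def sum_nonneg)
        then have "r x * Q x y \<le> (B * s\<^sup>2) * (c1 / n)"
          using rx Q xy B by (intro mult_mono) auto
        then have "\<bar>?kl x y\<bar> * (r x * Q x y) \<le> \<bar>?kl x y\<bar> * ((B * s\<^sup>2) * (c1 / n))"
          by (intro mult_left_mono) auto
        also have "\<dots> = (B * s * c1 / n * \<bar>?kl x y\<bar>) * s" by (simp add: power2_eq_square)
        also have "\<dots> \<le> (B * s * c1 / n * \<bar>?kl x y\<bar>) * \<bar>?kl x y\<bar>"
          using True B s c1 by (intro mult_left_mono) auto
        also have "\<dots> = B * s * c1 / n * (\<bar>?kl x y\<bar> * \<bar>?kl x y\<bar>)" by (simp only: mult.assoc)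
        also have "\<bar>?kl x y\<bar> * \<bar>?kl x y\<bar> = (real_of_int (k x))\<^sup>2 * (real_of_int (l y))\<^sup>2"
          unfolding abs_mult_self_eq by (simp add: power2_eq_square mult_ac)
        finally show ?thesis using True by simp
      qed (use R0 in simp)
    qed
    also have "\<dots> = B * s * c1 / n * ((\<Sum>x<n. (real_of_int (k x))\<^sup>2) * (\<Sum>y<n. (real_of_int (l y))\<^sup>2))"
      unfolding sum_product by (simp only: sum_distrib_left)
    also have "\<dots> \<le> B * s * c1 / n * ((16 * real n) * (16 * real n))"
      using lattice_ball_sum_le[OF k] lattice_ball_sum_le[OF l] B s c1 by (intro mult_left_mono mult_mono sum_nonneg) auto
    also have "\<dots> = 256 * c1 * B * s * n" using n by (simp add: field_simps)
    finally show ?thesis .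
  qed
  have "(\<Sum>x<n. \<Sum>y<n. real_of_int (k0 x) * real_of_int (l0 y) * deviation G N r Q x y) =
      (\<Sum>x<n. \<Sum>y<n. ?kl x y * (N x y - r x * Q x y))"
    by (intro sum.cong refl) (auto simp: k_def l_def deviation_def)
  also have "\<dots> \<le> (\<Sum>x<n. \<Sum>y<n. light s k l x y * (N x y - r x * Q x y) + ?hv x y (N x y) + ?hv x y (r x * Q x y))"
  proof (intro sum_mono)
    fix x y assume "x \<in> {..<n}" "y \<in> {..<n}"
    then have xy: "x < n" "y < n" by auto
    have p: "0 \<le> N x y" "0 \<le> r x * Q x y"
      using N Q(1)[OF xy] by (auto simp: r_def intro!: mult_nonneg_nonneg sum_nonneg)
    have "?kl x y * N x y \<le> \<bar>?kl x y\<bar> * N x y"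
      by (rule mult_right_mono[OF abs_ge_self p(1)])
    moreover have "- (?kl x y) * (r x * Q x y) \<le> \<bar>?kl x y\<bar> * (r x * Q x y)"
      by (rule mult_right_mono[OF abs_ge_minus_self p(2)])
    moreover have "?kl x y * (N x y - r x * Q x y) = ?kl x y * N x y + - (?kl x y) * (r x * Q x y)"
      by (simp add: right_diff_distrib)
    ultimately have "?kl x y * (N x y - r x * Q x y) \<le> \<bar>?kl x y\<bar> * N x y + \<bar>?kl x y\<bar> * (r x * Q x y)"
      by linarith
    then show "?kl x y * (N x y - r x * Q x y) \<le>
        light s k l x y * (N x y - r x * Q x y) + ?hv x y (N x y) + ?hv x y (r x * Q x y)"
      by (auto simp: light_def)
  qed
  also have "\<dots> \<le> c2 * n * s + 6144 * K * s * n + 256 * c1 * B * s * n"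
    unfolding sum.distrib using light[OF k l kG] heavy heavyQ by (intro add_mono) auto
  also have "\<dots> = (c2 + 256 * c1 * B + 6144 * K) * s * n" by (simp add: algebra_simps)
  finally show "(\<Sum>x<n. \<Sum>y<n. real_of_int (k0 x) * real_of_int (l0 y) * deviation G N r Q x y)
      \<le> (c2 + 256 * c1 * B + 6144 * K) * s * n" .
qed

text \<open>The constant of \<open>deviation_form_bound\<close> for the light bound
  \<open>c2 = 256 * c1 * B + 37\<close> of \<open>light_tail\<close>; \<open>B * d\<close> bounds
  the row and column sums of the states that are kept.\<close>

definition deviation_const :: "real \<Rightarrow> real" where
  "deviation_const c1 = (let B = 3 * c1 + 3 in
     ((256 * c1 * B + 37) + 256 * c1 * B + 6144 * (16 * B + 16 * c1 * B + 6)) / 8)"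

section \<open>One bad set for all estimates\<close>

context comparable_chain
begin

text \<open>The assumption \<open>large\<close> makes the exponent of \<open>few_visits\<close> at
  least \<open>2 * n\<close>, which outweighs the \<open>2 ^ n \<le> exp n\<close> sets.\<close>

lemma few_visits_uniform:
  fixes \<eta> :: real
  assumes \<eta>: "\<eta> \<ge> 0" and large: "8 \<le> c0 * \<eta> * d"
  shows "prob {\<omega> \<in> space M. \<exists>A\<in>Pow {..<n}. \<eta> * n \<le> card A \<and> (\<Sum>y\<in>A. C \<omega> y) \<le> c0 * \<eta> / 4 * T} \<le> exp (- real n)"
    (is "prob ?bad \<le> _")
proof -
  have "prob ?bad \<le> (\<Sum>A\<in>Pow {..<n}. exp (- (2 * real n)))"
  proof (rule union_bound)
    fix A assume A: "A \<in> Pow {..<n}"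
    show "prob {\<omega> \<in> space M. \<eta> * n \<le> card A \<and> (\<Sum>y\<in>A. C \<omega> y) \<le> c0 * \<eta> / 4 * T} \<le> exp (- (2 * real n))"
    proof (cases "\<eta> * n \<le> card A")
      case True
      have "prob {\<omega> \<in> space M. (\<Sum>y\<in>A. C \<omega> y) \<le> c0 * \<eta> / 4 * T} \<le> exp (- (c0 * \<eta> / 4 * T))"
        using A \<eta> True by (intro few_visits) auto
      also have "\<dots> \<le> exp (- (2 * real n))"
      proof -
        have "8 * real n \<le> c0 * \<eta> * d * n" using large by (intro mult_right_mono) auto
        then show ?thesis using n by simp
      qed
      finally show ?thesis using True by simp
    qed simp
  qed (simp, measurable)
  also have "\<dots> = 2 ^ n * exp (- (2 * real n))" by (simp add: card_Pow)
  also have "\<dots> \<le> exp 1 ^ n * exp (- (2 * real n))"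
    using exp_ge_add_one_self[of 1] by (intro mult_right_mono power_mono) auto
  also have "\<dots> = exp (- real n)" by (simp flip: exp_of_nat_mult exp_add)
  finally show ?thesis .
qed

text \<open>Outside a single measurable set the conclusions hold for all \<open>A\<close> and
  \<open>G\<close> at once, so they may be applied to a path-dependent set. A row sum exceeds the
  column sum of the same state by at most one, which \<open>d \<ge> 1\<close> absorbs: this is the
  step from \<open>3 * c1 + 2\<close> to \<open>3 * c1 + 3\<close>.\<close>

lemma good_event:
  fixes \<eta> :: real
  assumes d1: "d \<ge> 1" and \<eta>: "\<eta> > 0" and large: "8 \<le> c0 * \<eta> * d"
  obtains bad where "bad \<in> events" "prob bad \<le> exp (- d) + 2 * exp (- real n) + 2 / real n ^ 2"
    "\<And>\<omega>. \<omega> \<in> space M \<Longrightarrow> \<omega> \<notin> bad \<Longrightarrow>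
      (\<Sum>y<n. if (3 * c1 + 2) * d \<le> C \<omega> y then 1 else 0) < n * exp (- d)"
    "\<And>\<omega> A. \<omega> \<in> space M \<Longrightarrow> \<omega> \<notin> bad \<Longrightarrow> A \<subseteq> {..<n} \<Longrightarrow> \<eta> * n \<le> card A \<Longrightarrow>
      c0 * \<eta> / 8 * T \<le> (\<Sum>x\<in>A. R \<omega> x)"
    "\<And>\<omega> G. \<omega> \<in> space M \<Longrightarrow> \<omega> \<notin> bad \<Longrightarrow> G \<subseteq> {..<n} \<Longrightarrow>
      (\<And>y. y \<in> G \<Longrightarrow> C \<omega> y < (3 * c1 + 2) * d) \<Longrightarrow>
      form_bounded n (deviation G (N \<omega>) (R \<omega>) (\<lambda>x y. P $$ (x, y))) (deviation_const c1 * sqrt d)"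
    "\<And>\<omega> x. \<omega> \<in> space M \<Longrightarrow> x < n \<Longrightarrow> C \<omega> x < (3 * c1 + 2) * d \<Longrightarrow> R \<omega> x \<le> (3 * c1 + 3) * d"
proof -
  define B where "B = 3 * c1 + 3"
  have B: "B \<ge> 0" using c1_pos by (simp add: B_def)
  define bad1 where "bad1 = {\<omega> \<in> space M. real n * exp (- d) \<le> (\<Sum>y<n. if (3 * c1 + 2) * d \<le> C \<omega> y then 1 else 0)}"
  define bad2 where "bad2 = {\<omega> \<in> space M. \<exists>k\<in>lattice_ball n. \<exists>l\<in>lattice_ball n.
      (\<Sum>x<n. (real_of_int (k x))\<^sup>2 * R \<omega> x) \<le> 16 * B * T \<and>
      (256 * c1 * B + 37) * n * sqrt d \<le>
        (\<Sum>x<n. \<Sum>y<n. light (sqrt d) k l x y * (N \<omega> x y - R \<omega> x * P $$ (x, y)))}"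
  define bad3 where "bad3 = {\<omega> \<in> space M. \<exists>A\<in>Pow {..<n} - {{}}. \<exists>A'\<in>Pow {..<n} - {{}}.
      \<exists>u\<in>{1, (1 - ln (max (card A) (card A') / n)) / 4}. (\<Sum>x\<in>A. R \<omega> x) \<le> B * d * card A \<and>
        6 * real n * ent (max (card A) (card A') / n) + c1 * (B * d) * card A * card A' / n * exp u \<le> u * e \<omega> A A'}"
  define bad4 where "bad4 = {\<omega> \<in> space M. \<exists>A\<in>Pow {..<n}. \<eta> * n \<le> card A \<and> (\<Sum>y\<in>A. C \<omega> y) \<le> c0 * \<eta> / 4 * T}"
  have m1: "bad1 \<in> events" unfolding bad1_def by measurable
  have m2: "bad2 \<in> events" unfolding bad2_def
    by (intro sets.sets_Collect_finite_Ex lattice_ball_card(1)) measurable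
  have m3: "bad3 \<in> events" unfolding bad3_def
  proof (intro sets.sets_Collect_finite_Ex)
    fix A A' :: "nat set" and u :: real
    show "{\<omega> \<in> space M. (\<Sum>x\<in>A. R \<omega> x) \<le> B * d * card A \<and>
        6 * real n * ent (max (card A) (card A') / n) + c1 * (B * d) * card A * card A' / n * exp u \<le> u * e \<omega> A A'} \<in> events"
      by measurable
  qed auto
  have m4: "bad4 \<in> events" unfolding bad4_def
  proof (intro sets.sets_Collect_finite_Ex)
    fix A :: "nat set"
    show "{\<omega> \<in> space M. \<eta> * n \<le> card A \<and> (\<Sum>y\<in>A. C \<omega> y) \<le> c0 * \<eta> / 4 * T} \<in> events"
      by measurable
  qed auto
  define bad where "bad = bad1 \<union> (bad2 \<union> (bad3 \<union> bad4))"
  have meas: "bad \<in> events" using m1 m2 m3 m4 by (auto simp: bad_def)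
  have "prob bad \<le> prob bad1 + (prob bad2 + (prob bad3 + prob bad4))"
    unfolding bad_def using m1 m2 m3 m4
    by (intro order_trans[OF measure_Un_le] add_left_mono) auto
  moreover have "prob bad1 \<le> exp (- d)" unfolding bad1_def by (rule many_large_columns)
  moreover have "prob bad2 \<le> exp (- real n)" unfolding bad2_def by (rule light_uniform[OF B])
  moreover have "prob bad3 \<le> 2 / real n ^ 2"
    unfolding bad3_def using B by (intro discrepancy_uniform) auto
  moreover have "prob bad4 \<le> exp (- real n)"
    unfolding bad4_def using \<eta> large by (intro few_visits_uniform) auto
  ultimately have pr: "prob bad \<le> exp (- d) + 2 * exp (- real n) + 2 / real n ^ 2" by linarith
  have colsum: "(\<Sum>x<n. N \<omega> x y) = C \<omega> y" for \<omega> y by (simp add: column_count_def)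
  have RC: "R \<omega> x \<le> C \<omega> x + 1" if "\<omega> \<in> space M" "x < n" for \<omega> x
  proof -
    have "R \<omega> x - C \<omega> x = (if X 0 \<omega> = x then 1 else 0) - (if X T \<omega> = x then 1 else 0)"
      using R_diff[OF that(1), of "\<lambda>z. if z = x then 1 else 0"] that(2) by (simp add: mult_delta_left)
    then show ?thesis by (simp split: if_splits)
  qed
  have Rle: "R \<omega> x \<le> B * d" if "\<omega> \<in> space M" "x < n" "C \<omega> x < (3 * c1 + 2) * d" for \<omega> x
  proof -
    have "B * d = (3 * c1 + 2) * d + d" by (simp add: B_def algebra_simps)
    then show ?thesis using RC[OF that(1,2)] that(3) d1 by linarith
  qed
  have s: "sqrt d > 0" "(sqrt d)\<^sup>2 = d" using d1 by auto
  show thesis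
  proof (rule that[OF meas pr])
    fix \<omega> assume w: "\<omega> \<in> space M" "\<omega> \<notin> bad"
    then show "(\<Sum>y<n. if (3 * c1 + 2) * d \<le> C \<omega> y then 1 else 0) < n * exp (- d)"
      by (simp add: bad_def bad1_def not_le)
  next
    fix \<omega> A assume w: "\<omega> \<in> space M" "\<omega> \<notin> bad" and A: "A \<subseteq> {..<n}" "\<eta> * n \<le> card A"
    have "\<not> (\<Sum>y\<in>A. C \<omega> y) \<le> c0 * \<eta> / 4 * T"
      using w A unfolding bad_def bad4_def by blast
    moreover have "(\<Sum>y\<in>A. C \<omega> y) \<le> (\<Sum>x\<in>A. R \<omega> x) + 1"
    proof -
      have eq: "(\<Sum>z<n. (if z \<in> A then 1 else 0) * f z) = (\<Sum>z\<in>A. f z)" for f :: "nat \<Rightarrow> real"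
        using A(1) by (simp add: mult_delta_left sum.inter_restrict[symmetric] Int_absorb1)
      have "(\<Sum>x\<in>A. R \<omega> x) - (\<Sum>y\<in>A. C \<omega> y) = (if X 0 \<omega> \<in> A then 1 else 0) - (if X T \<omega> \<in> A then 1 else 0)"
        using R_diff[OF w(1), of "\<lambda>z. if z \<in> A then 1 else 0"] unfolding eq by simp
      then show ?thesis by (simp split: if_splits)
    qed
    \<comment> \<open>Half of the threshold \<open>c0 * \<eta> / 4 * T\<close> of
      \<open>few_visits_uniform\<close> is spent on the unit lost between column and row
      sums.\<close>
    moreover have "1 \<le> c0 * \<eta> / 8 * T"
    proof -
      have "8 * real n \<le> c0 * \<eta> * d * n" using large by (intro mult_right_mono) auto
      then have "8 * real n \<le> c0 * \<eta> * T" using n by simp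
      moreover have "real n \<ge> 1" using n by simp
      ultimately have "8 \<le> c0 * \<eta> * T" by linarith
      then show ?thesis by simp
    qed
    moreover have "c0 * \<eta> / 4 * T = c0 * \<eta> / 8 * T + c0 * \<eta> / 8 * T" by simp
    ultimately show "c0 * \<eta> / 8 * T \<le> (\<Sum>x\<in>A. R \<omega> x)" by linarith
  next
    fix \<omega> x assume "\<omega> \<in> space M" "x < n" "C \<omega> x < (3 * c1 + 2) * d"
    from Rle[OF this] show "R \<omega> x \<le> (3 * c1 + 3) * d" by (simp only: B_def)
  next
    fix \<omega> G
    assume w: "\<omega> \<in> space M" "\<omega> \<notin> bad" and G: "G \<subseteq> {..<n}"
      and deg: "\<And>y. y \<in> G \<Longrightarrow> C \<omega> y < (3 * c1 + 2) * d"
    have RG: "R \<omega> x \<le> B * d" if "x \<in> G" for x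
      using Rle[OF w(1) _ deg[OF that]] G that by auto
    have CG: "C \<omega> y \<le> B * d" if "y \<in> G" for y
    proof -
      have "(3 * c1 + 2) * d \<le> B * d" using d1 by (intro mult_right_mono) (auto simp: B_def)
      then show ?thesis using deg[OF that] by linarith
    qed
    have "form_bounded n (deviation G (N \<omega>) (R \<omega>) (\<lambda>x y. P $$ (x, y)))
        (((256 * c1 * B + 37) + 256 * c1 * B + 6144 * (16 * B + 16 * c1 * B + 6)) * sqrt d / 8)"
    proof (rule deviation_form_bound[OF n s(1) B less_imp_le[OF c1_pos]])
      fix k l assume kl: "k \<in> lattice_ball n" "l \<in> lattice_ball n" and kG: "\<And>x. k x \<noteq> 0 \<Longrightarrow> x \<in> G"
      have "(\<Sum>x<n. (real_of_int (k x))\<^sup>2 * R \<omega> x) \<le> (\<Sum>x<n. (real_of_int (k x))\<^sup>2 * (B * d))"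
      proof (rule sum_mono)
        fix x show "(real_of_int (k x))\<^sup>2 * R \<omega> x \<le> (real_of_int (k x))\<^sup>2 * (B * d)"
        proof (cases "k x = 0")
          case False
          show ?thesis by (rule mult_left_mono[OF RG[OF kG[OF False]]]) simp
        qed simp
      qed
      also have "\<dots> = (\<Sum>x<n. (real_of_int (k x))\<^sup>2) * (B * d)" by (simp only: sum_distrib_right)
      also have "\<dots> \<le> (16 * real n) * (B * d)"
        using lattice_ball_sum_le[OF kl(1)] B by (intro mult_right_mono) auto
      also have "\<dots> = 16 * B * T" using n by simp
      finally have "(\<Sum>x<n. (real_of_int (k x))\<^sup>2 * R \<omega> x) \<le> 16 * B * T" .
      then have "\<not> (256 * c1 * B + 37) * n * sqrt d \<le>
          (\<Sum>x<n. \<Sum>y<n. light (sqrt d) k l x y * (N \<omega> x y - R \<omega> x * P $$ (x, y)))"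
        using w kl unfolding bad_def bad2_def by blast
      then show "(\<Sum>x<n. \<Sum>y<n. light (sqrt d) k l x y * (N \<omega> x y - R \<omega> x * P $$ (x, y))) \<le>
          (256 * c1 * B + 37) * n * sqrt d" by linarith
    next
      fix A A' :: "nat set" and z :: real
      assume A: "A \<subseteq> G" "A' \<subseteq> G" "A \<subseteq> {..<n}" "A' \<subseteq> {..<n}" "A \<noteq> {}" "A' \<noteq> {}"
        and z: "z \<in> {1, (1 - ln (max (card A) (card A') / n)) / 4}"
      have "(\<Sum>x\<in>A. R \<omega> x) \<le> (\<Sum>x\<in>A. B * d)" using RG A(1) by (intro sum_mono) auto
      then have "(\<Sum>x\<in>A. R \<omega> x) \<le> B * d * card A" by (simp add: mult.commute)
      then have "\<not> 6 * real n * ent (max (card A) (card A') / n) + c1 * (B * d) * card A * card A' / n * exp z \<le> z * e \<omega> A A'"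
        using w A z unfolding bad_def bad3_def by blast
      then show "z * (\<Sum>x\<in>A. \<Sum>y\<in>A'. N \<omega> x y) \<le>
          6 * n * ent (max (card A) (card A') / n) + c1 * (B * (sqrt d)\<^sup>2) * card A * card A' / n * exp z"
        unfolding s(2) by simp
    qed (use P_nonneg P_le RG CG s(2) in \<open>auto simp: colsum\<close>)
    also have "((256 * c1 * B + 37) + 256 * c1 * B + 6144 * (16 * B + 16 * c1 * B + 6)) * sqrt d / 8 =
        deviation_const c1 * sqrt d"
      by (simp add: deviation_const_def Let_def B_def)
    finally show "form_bounded n (deviation G (N \<omega>) (R \<omega>) (\<lambda>x y. P $$ (x, y))) (deviation_const c1 * sqrt d)" .
  qed
qed

end

section \<open>Singular values of a perturbed block matrix\<close>

lemma mat_mult_vec_index: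
  fixes a :: "nat \<Rightarrow> nat \<Rightarrow> real"
  assumes "x < m" "v \<in> carrier_vec n"
  shows "(mat m n (\<lambda>(x, y). a x y) *\<^sub>v v) $ x = (\<Sum>y<n. a x y * v $ y)"
  using assms by (simp add: scalar_prod_def atLeast0LessThan)

lemma scalar_prod_self:
  fixes v :: "real vec"
  assumes "v \<in> carrier_vec n"
  shows "v \<bullet> v = (\<Sum>x<n. (v $ x)\<^sup>2)"
  using assms by (simp add: scalar_prod_def atLeast0LessThan power2_eq_square)

text \<open>Test the form with the image \<open>w\<close> of \<open>v\<close> in the first argument
  and cancel one factor \<open>W\<close>.\<close>

lemma norm_bound_of_form_bound:
  fixes a :: "nat \<Rightarrow> nat \<Rightarrow> real" and v :: "nat \<Rightarrow> real"
  assumes c: "c \<ge> 0"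
    and form: "form_bounded n a c"
  shows "(\<Sum>x<n. (\<Sum>y<n. a x y * v y)\<^sup>2) \<le> c\<^sup>2 * (\<Sum>y<n. (v y)\<^sup>2)"
proof -
  define w where "w x = (\<Sum>y<n. a x y * v y)" for x
  define W where "W = sqrt (\<Sum>x<n. (w x)\<^sup>2)"
  define V where "V = sqrt (\<Sum>y<n. (v y)\<^sup>2)"
  have WV: "W \<ge> 0" "V \<ge> 0" "W\<^sup>2 = (\<Sum>x<n. (w x)\<^sup>2)" "V\<^sup>2 = (\<Sum>y<n. (v y)\<^sup>2)"
    by (auto simp: W_def V_def sum_nonneg)
  have "W\<^sup>2 = (\<Sum>x<n. \<Sum>y<n. w x * v y * a x y)"
  proof -
    have "(w x)\<^sup>2 = (\<Sum>y<n. w x * v y * a x y)" for x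
    proof -
      have "(w x)\<^sup>2 = w x * (\<Sum>y<n. a x y * v y)" by (simp only: power2_eq_square w_def)
      also have "\<dots> = (\<Sum>y<n. w x * v y * a x y)"
        unfolding sum_distrib_left by (intro sum.cong refl) simp
      finally show ?thesis .
    qed
    then show ?thesis unfolding WV(3) by simp
  qed
  also have "\<dots> \<le> c * (W * V)" using form unfolding W_def V_def form_bounded_def by blast
  finally have "W * W \<le> (c * V) * W" by (simp add: power2_eq_square mult_ac)
  then have "W \<le> c * V"
    using WV c by (cases "W = 0") auto
  then have "W\<^sup>2 \<le> (c * V)\<^sup>2" using WV by (intro power_mono)
  then show ?thesis by (simp add: WV power_mult_distrib w_def)
qed

lemma sum_by_cluster:
  fixes f :: "nat \<Rightarrow> real" and \<sigma> :: "nat \<Rightarrow> nat"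
  assumes "\<And>y. y < n \<Longrightarrow> \<sigma> y < K"
  shows "(\<Sum>y<n. if y \<in> G then f y else 0) = (\<Sum>l<K. \<Sum>y\<in>{y. y < n \<and> y \<in> G \<and> \<sigma> y = l}. f y)"
proof -
  have "(\<Sum>y<n. if y \<in> G then f y else 0) = (\<Sum>y\<in>{y. y < n \<and> y \<in> G}. f y)"
    by (rule sum.mono_neutral_cong_right) auto
  also have "\<dots> = (\<Sum>l<K. \<Sum>y\<in>{y \<in> {y. y < n \<and> y \<in> G}. \<sigma> y = l}. f y)"
    by (rule sum.group[symmetric]) (use assms in auto)
  also have "\<dots> = (\<Sum>l<K. \<Sum>y\<in>{y. y < n \<and> y \<in> G \<and> \<sigma> y = l}. f y)"
    by (intro sum.cong refl) auto
  finally show ?thesis .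
qed

text \<open>The rows of \<open>F\<close> are the indicators of the \<open>K\<close> trimmed
  clusters. Since \<open>Q x y\<close> depends on \<open>y\<close> only through its cluster, the
  term \<open>r x * Q x y\<close> annihilates the kernel of \<open>F\<close>, and there the trimmed
  matrix acts as \<open>deviation\<close>.\<close>

lemma singular_value_block_le:
  fixes N Q h :: "nat \<Rightarrow> nat \<Rightarrow> real" and r :: "nat \<Rightarrow> real" and \<sigma> :: "nat \<Rightarrow> nat"
  assumes i: "K < i" "i \<le> n" and c: "c \<ge> 0"
    and \<sigma>: "\<And>y. y < n \<Longrightarrow> \<sigma> y < K" and Q: "\<And>x y. x < n \<Longrightarrow> y < n \<Longrightarrow> Q x y = h x (\<sigma> y)"
    and form: "form_bounded n (deviation G N r Q) c"
  shows "singular_value (mat n n (\<lambda>(x, y). if x \<in> G \<and> y \<in> G then N x y else 0)) i \<le> c"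
proof -
  define F where "F = mat K n (\<lambda>(l, y). if y \<in> G \<and> \<sigma> y = l then 1 else 0 :: real)"
  define A where "A = mat n n (\<lambda>(x, y). if x \<in> G \<and> y \<in> G then N x y else 0)"
  have F: "F \<in> carrier_mat K n" and A: "A \<in> carrier_mat n n" by (simp_all add: F_def A_def)
  have "singular_value A i \<le> c"
  proof (rule singular_value_le[OF A i c F])
    fix v :: "real vec" assume v: "v \<in> carrier_vec n" and Fv: "F *\<^sub>v v = 0\<^sub>v K"
    have Av: "A *\<^sub>v v \<in> carrier_vec n" using A v by simp
    have zero: "(\<Sum>y\<in>{y. y < n \<and> y \<in> G \<and> \<sigma> y = l}. v $ y) = 0" if l: "l < K" for l
    proof -
      have "(\<Sum>y\<in>{y. y < n \<and> y \<in> G \<and> \<sigma> y = l}. v $ y) = (\<Sum>y<n. (if y \<in> G \<and> \<sigma> y = l then 1 else 0) * v $ y)"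
        by (rule sum.mono_neutral_cong_left) auto
      also have "\<dots> = (F *\<^sub>v v) $ l" unfolding F_def by (rule mat_mult_vec_index[OF l v, symmetric])
      finally show ?thesis using Fv l by simp
    qed
    have "(A *\<^sub>v v) $ x = (\<Sum>y<n. deviation G N r Q x y * v $ y)" if x: "x < n" for x
    proof -
      have "(\<Sum>y<n. if y \<in> G then r x * Q x y * v $ y else 0) =
          (\<Sum>l<K. \<Sum>y\<in>{y. y < n \<and> y \<in> G \<and> \<sigma> y = l}. r x * Q x y * v $ y)"
        by (rule sum_by_cluster[OF \<sigma>])
      also have "\<dots> = (\<Sum>l<K. r x * h x l * (\<Sum>y\<in>{y. y < n \<and> y \<in> G \<and> \<sigma> y = l}. v $ y))"
        unfolding sum_distrib_left using Q[OF x] by (intro sum.cong refl) auto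
      also have "\<dots> = 0" using zero by (intro sum.neutral) simp
      finally have *: "(\<Sum>y<n. if y \<in> G then r x * Q x y * v $ y else 0) = 0" .
      have "(A *\<^sub>v v) $ x = (\<Sum>y<n. (if x \<in> G \<and> y \<in> G then N x y else 0) * v $ y)"
        unfolding A_def by (rule mat_mult_vec_index[OF x v])
      also have "\<dots> = (\<Sum>y<n. deviation G N r Q x y * v $ y +
          (if x \<in> G then if y \<in> G then r x * Q x y * v $ y else 0 else 0))"
        by (intro sum.cong refl) (simp add: deviation_def left_diff_distrib)
      also have "\<dots> = (\<Sum>y<n. deviation G N r Q x y * v $ y) +
          (\<Sum>y<n. if x \<in> G then if y \<in> G then r x * Q x y * v $ y else 0 else 0)"
        by (rule sum.distrib)
      also have "(\<Sum>y<n. if x \<in> G then if y \<in> G then r x * Q x y * v $ y else 0 else 0) = 0"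
        using * by (cases "x \<in> G") simp_all
      finally show ?thesis by simp
    qed
    then have "(A *\<^sub>v v) \<bullet> (A *\<^sub>v v) =
        (\<Sum>x<n. (\<Sum>y<n. deviation G N r Q x y * v $ y)\<^sup>2)"
      unfolding scalar_prod_self[OF Av] by (intro sum.cong refl) simp
    also have "\<dots> \<le> c\<^sup>2 * (\<Sum>y<n. (v $ y)\<^sup>2)"
      by (rule norm_bound_of_form_bound[OF c form])
    finally show "(A *\<^sub>v v) \<bullet> (A *\<^sub>v v) \<le> c\<^sup>2 * (v \<bullet> v)" unfolding scalar_prod_self[OF v] .
  qed
  then show ?thesis by (simp only: A_def)
qed

text \<open>Schur test: the inequality between arithmetic and geometric mean, weighted by
  \<open>\<tau>\<close>, splits the form into a part with row sums and a part with column
  sums.\<close>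

lemma singular_value_le_line_sums:
  fixes a :: "nat \<Rightarrow> nat \<Rightarrow> real"
  assumes i: "1 \<le> i" "i \<le> n" and \<tau>: "\<tau> > 0" and a: "\<And>x y. 0 \<le> a x y"
    and row: "\<And>x. x < n \<Longrightarrow> (\<Sum>y<n. a x y) \<le> \<tau>" and col: "\<And>y. y < n \<Longrightarrow> (\<Sum>x<n. a x y) \<le> \<tau>"
  shows "singular_value (mat n n (\<lambda>(x, y). a x y)) i \<le> \<tau>"
proof -
  define A where "A = mat n n (\<lambda>(x, y). a x y)"
  have A: "A \<in> carrier_mat n n" by (simp add: A_def)
  have "singular_value A i \<le> \<tau>"
  \<comment> \<open>A matrix with zero rows imposes no condition, so this bounds the norm on the
    whole space and with it every singular value.\<close>
  proof (rule singular_value_le[OF A, of 0])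
    fix v :: "real vec" assume v: "v \<in> carrier_vec n"
    have Av: "A *\<^sub>v v \<in> carrier_vec n" using A v by simp
    define w where "w x = (A *\<^sub>v v) $ x" for x
    define W where "W = (\<Sum>x<n. (w x)\<^sup>2)"
    define V where "V = (\<Sum>y<n. (v $ y)\<^sup>2)"
    have w: "w x = (\<Sum>y<n. a x y * v $ y)" if "x < n" for x
      unfolding w_def A_def by (rule mat_mult_vec_index[OF that v])
    have "W = (\<Sum>x<n. \<Sum>y<n. a x y * (w x * v $ y))"
    proof -
      have "(w x)\<^sup>2 = (\<Sum>y<n. a x y * (w x * v $ y))" if "x < n" for x
      proof -
        have "(w x)\<^sup>2 = w x * (\<Sum>y<n. a x y * v $ y)" unfolding power2_eq_square w[OF that, symmetric] ..
        then show ?thesis by (simp add: sum_distrib_left mult_ac)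
      qed
      then show ?thesis unfolding W_def by (intro sum.cong refl) simp
    qed
    also have "\<dots> \<le> (\<Sum>x<n. \<Sum>y<n. a x y * ((w x)\<^sup>2 / (2 * \<tau>) + \<tau> * (v $ y)\<^sup>2 / 2))"
    proof (intro sum_mono mult_left_mono a)
      fix x y
      have "0 \<le> (w x - \<tau> * v $ y)\<^sup>2" by simp
      then have "2 * \<tau> * (w x * v $ y) \<le> (w x)\<^sup>2 + \<tau>\<^sup>2 * (v $ y)\<^sup>2"
        by (simp add: power2_diff power_mult_distrib mult_ac)
      then show "w x * v $ y \<le> (w x)\<^sup>2 / (2 * \<tau>) + \<tau> * (v $ y)\<^sup>2 / 2"
        using \<tau> by (simp add: field_simps power2_eq_square)
    qed
    also have "\<dots> = (\<Sum>x<n. (\<Sum>y<n. a x y) * ((w x)\<^sup>2 / (2 * \<tau>))) + (\<Sum>y<n. (\<Sum>x<n. a x y) * (\<tau> * (v $ y)\<^sup>2 / 2))"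
      unfolding distrib_left sum.distrib sum_distrib_right
      by (intro arg_cong2[where f = "(+)"] refl sum.swap)
    also have "\<dots> \<le> (\<Sum>x<n. \<tau> * ((w x)\<^sup>2 / (2 * \<tau>))) + (\<Sum>y<n. \<tau> * (\<tau> * (v $ y)\<^sup>2 / 2))"
      using \<tau> by (intro add_mono sum_mono mult_right_mono row col) auto
    also have "\<dots> = W / 2 + \<tau>\<^sup>2 * V / 2"
      using \<tau> by (simp add: W_def V_def sum_divide_distrib sum_distrib_left power2_eq_square mult_ac)
    finally have "W \<le> \<tau>\<^sup>2 * V" by simp
    then show "(A *\<^sub>v v) \<bullet> (A *\<^sub>v v) \<le> \<tau>\<^sup>2 * (v \<bullet> v)"
      unfolding scalar_prod_self[OF v] scalar_prod_self[OF Av] W_def V_def w_def .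
  next
    show "0\<^sub>m 0 n \<in> carrier_mat 0 n" by simp
  qed (use i \<tau> in auto)
  then show ?thesis by (simp only: A_def)
qed

text \<open>With \<open>s\<close> the squared Frobenius norm of the inverse, Cauchy-Schwarz in each
  row bounds \<open>z\<close> by its image. The \<open>+ 1\<close> in the witness
  \<open>1 / (s + 1)\<close> avoids division by zero.\<close>

lemma full_rank_lower_bound:
  fixes p :: "real mat"
  assumes p: "p \<in> carrier_mat K K" and rank: "vec_space.rank K p = K"
  obtains \<rho> where "\<rho> > 0"
    "\<And>z. \<rho> * (\<Sum>l<K. (z l)\<^sup>2) \<le> (\<Sum>k<K. (\<Sum>l<K. p $$ (k, l) * z l)\<^sup>2)"
proof -
  have "det p \<noteq> 0" using vec_space.det_rank_iff[OF p] rank by simp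
  from det_non_zero_imp_unit[OF p this, of undefined]
  obtain B where B: "B \<in> carrier_mat K K" "B * p = 1\<^sub>m K"
    unfolding Units_def by (auto simp: ring_mat_def)
  define s where "s = (\<Sum>l<K. \<Sum>k<K. (B $$ (l, k))\<^sup>2)"
  have s: "s \<ge> 0" by (auto simp: s_def intro!: sum_nonneg)
  have main: "(\<Sum>l<K. (z l)\<^sup>2) \<le> s * (\<Sum>k<K. (\<Sum>l<K. p $$ (k, l) * z l)\<^sup>2)" for z :: "nat \<Rightarrow> real"
  proof -
    define y where "y k = (\<Sum>l<K. p $$ (k, l) * z l)" for k
    have zl: "z l = (\<Sum>k<K. B $$ (l, k) * y k)" if l: "l < K" for l
    proof -
      have Bp: "(\<Sum>k<K. B $$ (l, k) * p $$ (k, m)) = (if l = m then 1 else 0)" if m: "m < K" for m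
        using arg_cong[OF B(2), of "\<lambda>A. A $$ (l, m)"] l m B(1) p
        by (simp add: scalar_prod_def atLeast0LessThan)
      have "(\<Sum>k<K. B $$ (l, k) * y k) = (\<Sum>k<K. \<Sum>m<K. B $$ (l, k) * p $$ (k, m) * z m)"
        unfolding y_def by (simp add: sum_distrib_left mult.assoc)
      also have "\<dots> = (\<Sum>m<K. (\<Sum>k<K. B $$ (l, k) * p $$ (k, m)) * z m)"
        unfolding sum_distrib_right by (rule sum.swap)
      also have "\<dots> = (\<Sum>m<K. (if l = m then 1 else 0) * z m)"
        using Bp by (intro sum.cong refl) simp
      also have "\<dots> = z l" using l by (simp add: mult_delta_left)
      finally show ?thesis by simp
    qed
    have "(\<Sum>l<K. (z l)\<^sup>2) \<le> (\<Sum>l<K. (\<Sum>k<K. (B $$ (l, k))\<^sup>2) * (\<Sum>k<K. (y k)\<^sup>2))"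
    proof (rule sum_mono)
      fix l assume "l \<in> {..<K}"
      then show "(z l)\<^sup>2 \<le> (\<Sum>k<K. (B $$ (l, k))\<^sup>2) * (\<Sum>k<K. (y k)\<^sup>2)"
        using zl[of l] Cauchy_Schwarz_ineq_sum[of "\<lambda>k. B $$ (l, k)" y "{..<K}"] by simp
    qed
    also have "\<dots> = s * (\<Sum>k<K. (y k)\<^sup>2)" by (simp only: s_def sum_distrib_right)
    finally show ?thesis by (simp only: y_def)
  qed
  show thesis
  proof (rule that[of "1 / (s + 1)"])
    show "1 / (s + 1) > 0" using s by simp
    fix z :: "nat \<Rightarrow> real"
    have "(\<Sum>l<K. (z l)\<^sup>2) \<le> s * (\<Sum>k<K. (\<Sum>l<K. p $$ (k, l) * z l)\<^sup>2)" by (rule main)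
    also have "\<dots> \<le> (s + 1) * (\<Sum>k<K. (\<Sum>l<K. p $$ (k, l) * z l)\<^sup>2)"
      by (intro mult_right_mono sum_nonneg) auto
    finally show "1 / (s + 1) * (\<Sum>l<K. (z l)\<^sup>2) \<le> (\<Sum>k<K. (\<Sum>l<K. p $$ (k, l) * z l)\<^sup>2)"
      using s by (simp add: divide_le_eq mult.commute)
  qed
qed

text \<open>The test space is spanned by the indicators of the first \<open>i\<close> trimmed
  clusters; on it the centering term maps coefficients \<open>z\<close> to
  \<open>r x * q (\<sigma> x)\<close>. Trimmed clusters keep half of their size, which costs
  \<open>1 / 4\<close>; \<open>inj\<close> inverts \<open>p\<close>; Cauchy-Schwarz within a cluster
  turns \<open>\<beta>\<close> visits into a square sum of at least
  \<open>\<beta>\<^sup>2 / n\<close>. Since the squared norm of the test vector is at most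
  \<open>n\<close> times that of \<open>z\<close>, and separating off the deviation costs a factor
  2, the denominator becomes \<open>8 * n\<^sup>2\<close>.\<close>

lemma singular_value_block_ge:
  fixes N Q p :: "nat \<Rightarrow> nat \<Rightarrow> real" and r V :: "nat \<Rightarrow> real" and \<sigma> :: "nat \<Rightarrow> nat"
    and n :: nat and G :: "nat set"
  defines "Gl \<equiv> \<lambda>l. {y. y < n \<and> y \<in> G \<and> \<sigma> y = l}"
  assumes i: "1 \<le> i" "i \<le> K" "i \<le> n" and c: "c \<ge> 0" and \<rho>: "\<rho> \<ge> 0" and \<beta>: "\<beta> \<ge> 0" and \<theta>: "\<theta> \<ge> 0"
    and \<sigma>: "\<And>y. y < n \<Longrightarrow> \<sigma> y < K"
    and Q: "\<And>x y. x < n \<Longrightarrow> y < n \<Longrightarrow> Q x y = p (\<sigma> x) (\<sigma> y) / V (\<sigma> y)"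
    and V: "\<And>l. l < K \<Longrightarrow> 0 < V l" "\<And>l. l < K \<Longrightarrow> V l \<le> 2 * card (Gl l)"
    and inj: "\<And>z. \<rho> * (\<Sum>l<K. (z l)\<^sup>2) \<le> (\<Sum>k<K. (\<Sum>l<K. p k l * z l)\<^sup>2)"
    and visits: "\<And>k. k < K \<Longrightarrow> \<beta> \<le> (\<Sum>x\<in>Gl k. r x)"
    and form: "form_bounded n (deviation G N r Q) c"
    and \<theta>le: "\<theta>\<^sup>2 + c\<^sup>2 \<le> \<rho> * \<beta>\<^sup>2 / (8 * (real n)\<^sup>2)"
  shows "\<theta> \<le> singular_value (mat n n (\<lambda>(x, y). if x \<in> G \<and> y \<in> G then N x y else 0)) i"
proof -
  define U where "U = mat n i (\<lambda>(x, l). if x \<in> G \<and> \<sigma> x = l then 1 else 0 :: real)"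
  define A where "A = mat n n (\<lambda>(x, y). if x \<in> G \<and> y \<in> G then N x y else 0)"
  have U: "U \<in> carrier_mat n i" and A: "A \<in> carrier_mat n n" by (simp_all add: U_def A_def)
  have n: "real n > 0" using i by simp
  have cardn: "real (card (Gl l)) \<le> n" for l
    using card_mono[of "{..<n}" "Gl l"] by (auto simp: Gl_def)
  define w' where "w' w l = (if l < i then w $ l else 0)" for w :: "real vec" and l
  have Uw: "(U *\<^sub>v w) $ x = (if x \<in> G then w' w (\<sigma> x) else 0)" if w: "w \<in> carrier_vec i" and x: "x < n" for w x
  proof -
    have "(U *\<^sub>v w) $ x = (\<Sum>l<i. (if x \<in> G \<and> \<sigma> x = l then 1 else 0) * w $ l)"
      unfolding U_def by (rule mat_mult_vec_index[OF x w])
    also have "\<dots> = (if x \<in> G then w' w (\<sigma> x) else 0)"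
      by (cases "x \<in> G") (auto simp: mult_delta_left w'_def)
    finally show ?thesis .
  qed
  have "\<theta> \<le> singular_value A i"
  proof (rule singular_value_ge[OF A i(1,3) \<theta> U])
    fix w :: "real vec" assume w: "w \<in> carrier_vec i" "w \<noteq> 0\<^sub>v i"
    obtain l where l: "l < i" "w $ l \<noteq> 0" by (rule vec_nonzero_index[OF w])
    have "real (card (Gl l)) > 0" using V[of l] l i by simp
    then have "Gl l \<noteq> {}" by auto
    then obtain x where x: "x < n" "x \<in> G" "\<sigma> x = l" by (auto simp: Gl_def)
    then have "(U *\<^sub>v w) $ x = w $ l" using Uw[OF w(1) x(1)] l by (simp add: w'_def)
    then show "U *\<^sub>v w \<noteq> 0\<^sub>v n" using l x by auto
  next
    fix w :: "real vec" assume w: "w \<in> carrier_vec i"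
    define z where "z = w' w"
    define v where "v = U *\<^sub>v w"
    have v: "v \<in> carrier_vec n" using U w by (simp add: v_def)
    have Av: "A *\<^sub>v v \<in> carrier_vec n" using A v by simp
    have vx: "v $ x = (if x \<in> G then z (\<sigma> x) else 0)" if "x < n" for x
      unfolding v_def z_def by (rule Uw[OF w that])
    define D where "D x = (\<Sum>y<n. deviation G N r Q x y * v $ y)" for x
    define q where "q k = (\<Sum>l<K. p k l * (card (Gl l) / V l * z l))" for k
    define b where "b x = (if x \<in> G then r x * q (\<sigma> x) else 0)" for x
    have Avx: "(A *\<^sub>v v) $ x = D x + b x" if x: "x < n" for x
    proof -
      have "(\<Sum>y<n. if y \<in> G then Q x y * z (\<sigma> y) else 0) =
          (\<Sum>l<K. \<Sum>y\<in>{y. y < n \<and> y \<in> G \<and> \<sigma> y = l}. Q x y * z (\<sigma> y))"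
        by (rule sum_by_cluster[OF \<sigma>])
      also have "\<dots> = (\<Sum>l<K. \<Sum>y\<in>Gl l. p (\<sigma> x) l / V l * z l)"
        unfolding Gl_def using Q[OF x] by (intro sum.cong refl) auto
      also have "\<dots> = q (\<sigma> x)" unfolding q_def by (intro sum.cong refl) simp
      finally have *: "(\<Sum>y<n. if y \<in> G then Q x y * z (\<sigma> y) else 0) = q (\<sigma> x)" .
      have "(A *\<^sub>v v) $ x = (\<Sum>y<n. (if x \<in> G \<and> y \<in> G then N x y else 0) * v $ y)"
        unfolding A_def by (rule mat_mult_vec_index[OF x v])
      also have "\<dots> = (\<Sum>y<n. deviation G N r Q x y * v $ y +
          (if x \<in> G then r x * (if y \<in> G then Q x y * z (\<sigma> y) else 0) else 0))"
        using vx by (intro sum.cong refl) (auto simp: deviation_def left_diff_distrib)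
      also have "\<dots> = D x + (\<Sum>y<n. if x \<in> G then r x * (if y \<in> G then Q x y * z (\<sigma> y) else 0) else 0)"
        by (simp only: sum.distrib D_def)
      also have "(\<Sum>y<n. if x \<in> G then r x * (if y \<in> G then Q x y * z (\<sigma> y) else 0) else 0) = b x"
        unfolding b_def *[symmetric] by (cases "x \<in> G") (simp_all add: sum_distrib_left)
      finally show ?thesis .
    qed
    have D: "(\<Sum>x<n. (D x)\<^sup>2) \<le> c\<^sup>2 * (\<Sum>y<n. (v $ y)\<^sup>2)"
      unfolding D_def by (rule norm_bound_of_form_bound[OF c form])
    have vv: "(\<Sum>y<n. (v $ y)\<^sup>2) \<le> n * (\<Sum>l<K. (z l)\<^sup>2)"
    proof -
      have "(\<Sum>y<n. (v $ y)\<^sup>2) = (\<Sum>y<n. if y \<in> G then (z (\<sigma> y))\<^sup>2 else 0)"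
        using vx by (intro sum.cong refl) auto
      also have "\<dots> = (\<Sum>l<K. \<Sum>y\<in>Gl l. (z (\<sigma> y))\<^sup>2)"
        unfolding Gl_def by (rule sum_by_cluster[OF \<sigma>])
      also have "\<dots> = (\<Sum>l<K. card (Gl l) * (z l)\<^sup>2)"
        by (intro sum.cong refl) (simp add: Gl_def)
      also have "\<dots> \<le> (\<Sum>l<K. n * (z l)\<^sup>2)" using cardn by (intro sum_mono mult_right_mono) auto
      finally show ?thesis by (simp add: sum_distrib_left)
    qed
    have bb: "\<rho> * \<beta>\<^sup>2 / (4 * n) * (\<Sum>l<K. (z l)\<^sup>2) \<le> (\<Sum>x<n. (b x)\<^sup>2)"
    proof -
      have "\<rho> * (1 / 4 * (\<Sum>l<K. (z l)\<^sup>2)) \<le> \<rho> * (\<Sum>l<K. (card (Gl l) / V l * z l)\<^sup>2)"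
        unfolding sum_distrib_left[of "1 / 4"]
      proof (intro mult_left_mono sum_mono \<rho>)
        fix l assume "l \<in> {..<K}"
        then have l: "l < K" by simp
        have "1 / 2 \<le> card (Gl l) / V l" using V[OF l] by (simp add: field_simps)
        then have "(1 / 2)\<^sup>2 \<le> (card (Gl l) / V l)\<^sup>2" by (intro power_mono) auto
        then have "(1 / 2)\<^sup>2 * (z l)\<^sup>2 \<le> (card (Gl l) / V l)\<^sup>2 * (z l)\<^sup>2" by (intro mult_right_mono) auto
        then show "1 / 4 * (z l)\<^sup>2 \<le> (card (Gl l) / V l * z l)\<^sup>2"
          unfolding power_mult_distrib by (simp add: power2_eq_square)
      qed
      also have "\<dots> \<le> (\<Sum>k<K. (q k)\<^sup>2)" unfolding q_def by (rule inj)
      finally have q: "\<rho> * (1 / 4 * (\<Sum>l<K. (z l)\<^sup>2)) \<le> (\<Sum>k<K. (q k)\<^sup>2)" .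
      have "\<rho> * \<beta>\<^sup>2 / (4 * n) * (\<Sum>l<K. (z l)\<^sup>2) = \<beta>\<^sup>2 / n * (\<rho> * (1 / 4 * (\<Sum>l<K. (z l)\<^sup>2)))"
        by (simp add: mult_ac)
      also have "\<dots> \<le> \<beta>\<^sup>2 / n * (\<Sum>k<K. (q k)\<^sup>2)" using q n by (intro mult_left_mono) auto
      also have "\<dots> = (\<Sum>k<K. \<beta>\<^sup>2 / n * (q k)\<^sup>2)" by (simp add: sum_distrib_left)
      also have "\<dots> \<le> (\<Sum>k<K. (\<Sum>x\<in>Gl k. (r x)\<^sup>2) * (q k)\<^sup>2)"
      proof (intro sum_mono mult_right_mono)
        fix k assume "k \<in> {..<K}"
        then have k: "k < K" by simp
        have "\<beta>\<^sup>2 \<le> (\<Sum>x\<in>Gl k. r x)\<^sup>2" using visits[OF k] \<beta> by (intro power_mono)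
        also have "\<dots> \<le> (\<Sum>x\<in>Gl k. (r x)\<^sup>2) * (\<Sum>x\<in>Gl k. 1\<^sup>2)"
          using Cauchy_Schwarz_ineq_sum[of r "\<lambda>_. 1" "Gl k"] by simp
        also have "\<dots> \<le> (\<Sum>x\<in>Gl k. (r x)\<^sup>2) * n"
          using cardn by (intro mult_left_mono sum_nonneg) auto
        finally show "\<beta>\<^sup>2 / n \<le> (\<Sum>x\<in>Gl k. (r x)\<^sup>2)" using n by (simp add: divide_le_eq)
      qed simp
      also have "\<dots> = (\<Sum>k<K. \<Sum>x\<in>Gl k. (r x * q (\<sigma> x))\<^sup>2)"
        unfolding sum_distrib_right by (intro sum.cong refl) (auto simp: Gl_def power_mult_distrib)
      also have "\<dots> = (\<Sum>x<n. if x \<in> G then (r x * q (\<sigma> x))\<^sup>2 else 0)"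
        unfolding Gl_def by (rule sum_by_cluster[OF \<sigma>, symmetric])
      also have "\<dots> = (\<Sum>x<n. (b x)\<^sup>2)" by (intro sum.cong refl) (simp add: b_def)
      finally show ?thesis .
    qed
    have "(\<Sum>x<n. (b x)\<^sup>2) \<le> (\<Sum>x<n. 2 * ((A *\<^sub>v v) $ x)\<^sup>2 + 2 * (D x)\<^sup>2)"
    proof (rule sum_mono)
      fix x assume "x \<in> {..<n}"
      then have bx: "b x = (A *\<^sub>v v) $ x - D x" using Avx by simp
      have "0 \<le> ((A *\<^sub>v v) $ x + D x)\<^sup>2" by simp
      then show "(b x)\<^sup>2 \<le> 2 * ((A *\<^sub>v v) $ x)\<^sup>2 + 2 * (D x)\<^sup>2"
        unfolding bx power2_sum power2_diff by linarith
    qed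
    then have split: "(\<Sum>x<n. (b x)\<^sup>2) \<le> 2 * ((A *\<^sub>v v) \<bullet> (A *\<^sub>v v)) + 2 * (\<Sum>x<n. (D x)\<^sup>2)"
      unfolding scalar_prod_self[OF Av] by (simp add: sum.distrib sum_distrib_left)
    have "2 * (\<theta>\<^sup>2 + c\<^sup>2) * (\<Sum>y<n. (v $ y)\<^sup>2) \<le> 2 * (\<rho> * \<beta>\<^sup>2 / (8 * (real n)\<^sup>2)) * (n * (\<Sum>l<K. (z l)\<^sup>2))"
      using \<theta>le vv \<rho> by (intro mult_mono sum_nonneg) auto
    also have "\<dots> = \<rho> * \<beta>\<^sup>2 / (4 * n) * (\<Sum>l<K. (z l)\<^sup>2)"
      using n by (simp add: power2_eq_square)
    also have "\<dots> \<le> 2 * ((A *\<^sub>v v) \<bullet> (A *\<^sub>v v)) + 2 * (c\<^sup>2 * (\<Sum>y<n. (v $ y)\<^sup>2))"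
      using bb split D by linarith
    finally show "\<theta>\<^sup>2 * ((U *\<^sub>v w) \<bullet> (U *\<^sub>v w)) \<le> (A *\<^sub>v (U *\<^sub>v w)) \<bullet> (A *\<^sub>v (U *\<^sub>v w))"
      unfolding v_def[symmetric] scalar_prod_self[OF v] by (simp add: distrib_right)
  qed
  then show ?thesis by (simp only: A_def)
qed

section \<open>Spectrum of the trimmed count matrix\<close>

text \<open>In HOL \<open>sqrt\<close> is negative at negative arguments, so the sign has to come
  from the eigenvalue: it is the squared norm of the image of a singular vector.\<close>

lemma singular_value_nonneg:
  assumes A: "A \<in> carrier_mat n n" and i: "1 \<le> i" "i \<le> n"
  shows "0 \<le> singular_value A i"
proof -
  obtain P es where sv: "\<And>i. 1 \<le> i \<Longrightarrow> i \<le> n \<Longrightarrow> singular_value A i = sqrt (es ! (i - 1))"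
    and quad: "\<And>z. z \<in> carrier_vec n \<Longrightarrow>
       (A *\<^sub>v (P *\<^sub>v z)) \<bullet> (A *\<^sub>v (P *\<^sub>v z)) = (\<Sum>j<n. es ! j * (z $ j)\<^sup>2)"
    by (rule singular_values_diagonalize[OF A]) auto
  define y where "y = A *\<^sub>v (P *\<^sub>v unit_vec n (i - 1))"
  have "0 \<le> y \<bullet> y" by (auto simp: scalar_prod_def intro!: sum_nonneg)
  also have "y \<bullet> y = (\<Sum>j<n. es ! j * (unit_vec n (i - 1) $ j)\<^sup>2)"
    unfolding y_def by (rule quad) simp
  also have "\<dots> = (\<Sum>j<n. if j = i - 1 then es ! j else 0)"
    using i by (intro sum.cong refl) auto
  also have "\<dots> = es ! (i - 1)" using i by simp
  finally show ?thesis using sv[OF i] by simp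
qed

text \<open>If a kept state had a count of at least \<open>a\<close>, so would every removed one.
  Together these are one more than the rounded-down number of removed states, hence more than
  \<open>few\<close> allows.\<close>

lemma column_count_less_of_trimming:
  assumes trim: "trimming n T X G \<omega>" and G: "G \<subseteq> {..<n}" and y: "y \<in> G"
    and few: "(\<Sum>z<n. if a \<le> real (column_count n T X \<omega> z) then 1 else 0) < n * exp (- (real T / real n))"
  shows "real (column_count n T X \<omega> y) < a"
proof (rule ccontr)
  let ?C = "column_count n T X \<omega>" and ?H = "{..<n} - G"
  assume "\<not> real (?C y) < a"
  then have ay: "a \<le> real (?C y)" by simp
  define S where "S = {z. z < n \<and> a \<le> real (?C z)}"
  have fin: "finite S" "finite G" "finite ?H"
    using finite_subset[OF G] by (auto simp: S_def)
  have "insert y ?H \<subseteq> S"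
  proof
    fix z assume z: "z \<in> insert y ?H"
    show "z \<in> S"
    proof (cases "z = y")
      case True
      then show ?thesis using ay y G by (auto simp: S_def)
    next
      case False
      then have zH: "z \<in> ?H" using z by simp
      have "?C y \<le> Max (?C ` G)" using y fin by simp
      also have "\<dots> \<le> Min (?C ` ?H)" using trim zH unfolding trimming_def by blast
      also have "\<dots> \<le> ?C z" using zH fin by simp
      finally have "real (?C y) \<le> real (?C z)" by simp
      then show ?thesis using ay zH by (simp add: S_def)
    qed
  qed
  then have "card (insert y ?H) \<le> card S" using fin by (intro card_mono)
  then have "card ?H + 1 \<le> card S" using y fin by simp
  then have "real (card ?H) + 1 \<le> real (card S)" by linarith
  moreover have "real (card S) = (\<Sum>z<n. if a \<le> real (?C z) then 1 else 0)"
  proof -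
    have "(\<Sum>z<n. if a \<le> real (?C z) then 1 else 0 :: real) = (\<Sum>z\<in>S. 1)"
      by (rule sum.mono_neutral_cong_right) (auto simp: S_def)
    then show ?thesis by simp
  qed
  moreover have "n * exp (- (real T / real n)) < real (card ?H) + 1"
  proof -
    have "card ?H = nat \<lfloor>real n * exp (- (real T / real n))\<rfloor>" using trim by (simp add: trimming_def)
    then show ?thesis by linarith
  qed
  ultimately show False using few by linarith
qed

text \<open>Clusters have at least \<open>\<alpha>m * n / 2\<close> states, whence
  \<open>c1 = 2 / \<alpha>m\<close>. By \<open>d3\<close> the trimming removes at most
  \<open>\<alpha>m * n / 4\<close> states, so each cluster keeps \<open>\<eta> * n\<close> states
  and half of its size. For \<open>\<beta> = pm * \<eta> / 8 * T\<close> the right-hand side of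
  \<open>\<theta>le\<close> in \<open>singular_value_block_ge\<close> equals
  \<open>2 * \<gamma> * d\<^sup>2\<close>: one half becomes the lower bound
  \<open>sqrt \<gamma> * d\<close>, the other absorbs the deviation by \<open>d4\<close>.\<close>

lemma trimmed_spectrum:
  fixes \<alpha>m pm \<rho> :: real and p :: "real mat" and \<sigma> :: "nat \<Rightarrow> nat"
    and X :: "nat \<Rightarrow> 'a \<Rightarrow> nat" and \<Gamma> :: "'a \<Rightarrow> nat set"
  defines "c1 \<equiv> 2 / \<alpha>m" and "\<eta> \<equiv> \<alpha>m / 4"
  defines "\<gamma> \<equiv> \<rho> * (pm * \<eta> / 8)\<^sup>2 / 16"
  assumes par: "bmc_parameters K \<alpha> p" and \<alpha>m: "\<alpha>m > 0" and pm: "pm > 0" and \<rho>: "\<rho> > 0"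
    and pm_le: "\<And>k l. k < K \<Longrightarrow> l < K \<Longrightarrow> pm \<le> p $$ (k, l)"
    and inj: "\<And>z. \<rho> * (\<Sum>l<K. (z l)\<^sup>2) \<le> (\<Sum>k<K. (\<Sum>l<K. p $$ (k, l) * z l)\<^sup>2)"
    and Kn: "K \<le> n" and T: "T > 0"
    and size: "\<And>k. k < K \<Longrightarrow> \<alpha>m * n / 2 \<le> cluster_size K \<alpha> n k"
    and map: "cluster_map K \<alpha> n \<sigma>" and chain: "block_markov_chain M p n \<sigma> X"
    and \<Gamma>: "\<Gamma> \<in> measurable M (count_space (Pow {..<n}))"
    and trim: "AE \<omega> in M. trimming n T X (\<Gamma> \<omega>) \<omega>"
    and d1: "1 \<le> real T / n" and d2: "8 \<le> pm * \<eta> * (real T / n)" and d3: "exp (- (real T / n)) \<le> \<alpha>m / 4"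
    and d4: "(deviation_const c1)\<^sup>2 \<le> \<gamma> * (real T / n)" and L: "deviation_const c1 \<ge> 0"
  obtains bad where "bad \<in> sets M"
    "measure M bad \<le> exp (- (real T / n)) + 2 * exp (- real n) + 2 / real n ^ 2"
    "\<And>\<omega> i. \<omega> \<in> space M \<Longrightarrow> \<omega> \<notin> bad \<Longrightarrow> i \<in> {1..K} \<Longrightarrow>
      sqrt \<gamma> * (real T / n) \<le> singular_value (trimmed_count_matrix n T X (\<Gamma> \<omega>) \<omega>) i \<and>
      singular_value (trimmed_count_matrix n T X (\<Gamma> \<omega>) \<omega>) i \<le> (3 * c1 + 3) * (real T / n)"
    "\<And>\<omega> i. \<omega> \<in> space M \<Longrightarrow> \<omega> \<notin> bad \<Longrightarrow> i \<in> {K<..n} \<Longrightarrow>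
      \<bar>singular_value (trimmed_count_matrix n T X (\<Gamma> \<omega>) \<omega>) i\<bar> \<le> deviation_const c1 * sqrt (real T / n)"
proof -
  have K: "K \<ge> 1" and p: "p \<in> carrier_mat K K" and p_pos: "\<And>k l. k < K \<Longrightarrow> l < K \<Longrightarrow> 0 < p $$ (k, l)"
    and p_sum: "\<And>k. k < K \<Longrightarrow> (\<Sum>l<K. p $$ (k, l)) = 1"
    using par by (auto simp: bmc_parameters_def)
  have n: "n > 0" using K Kn by simp
  have p_le: "p $$ (k, l) \<le> 1" if "k < K" "l < K" for k l
  proof -
    have "p $$ (k, l) \<le> (\<Sum>l<K. p $$ (k, l))"
      using p_pos that by (intro member_le_sum) (auto intro: less_imp_le)
    then show ?thesis using p_sum that by simp
  qed
  define V where "V l = real (card (cluster n \<sigma> l))" for l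
  have \<sigma>: "\<sigma> x < K" if "x < n" for x using map that by (simp add: cluster_map_def)
  have V_ge: "\<alpha>m * n / 2 \<le> V l" if "l < K" for l
    using map size[OF that] that by (simp add: cluster_map_def V_def)
  have V_pos: "V l > 0" if "l < K" for l
  proof -
    have "0 < \<alpha>m * n / 2" using \<alpha>m n by simp
    then show ?thesis using V_ge[OF that] by linarith
  qed
  have V_le: "V l \<le> n" for l
    using card_mono[of "{..<n}" "cluster n \<sigma> l"] by (auto simp: V_def cluster_def)
  define P where "P = bmc_transition p n \<sigma>"
  have P: "P $$ (x, y) = p $$ (\<sigma> x, \<sigma> y) / V (\<sigma> y)" if "x < n" "y < n" for x y
    using that by (simp add: P_def bmc_transition_def V_def)
  obtain \<pi> where mc: "markov_chain M n P \<pi> X"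
    using chain by (auto simp: block_markov_chain_def P_def)
  interpret comparable_chain M n P \<pi> X T pm c1
  proof
    fix x assume x: "x < n"
    have "(\<Sum>y<n. P $$ (x, y)) = (\<Sum>y<n. if y \<in> UNIV then p $$ (\<sigma> x, \<sigma> y) / V (\<sigma> y) else 0)"
      using P[OF x] by simp
    also have "\<dots> = (\<Sum>l<K. \<Sum>y\<in>{y. y < n \<and> y \<in> UNIV \<and> \<sigma> y = l}. p $$ (\<sigma> x, \<sigma> y) / V (\<sigma> y))"
      by (rule sum_by_cluster[OF \<sigma>])
    also have "\<dots> = (\<Sum>l<K. V l * (p $$ (\<sigma> x, l) / V l))"
      by (intro sum.cong refl) (simp add: V_def cluster_def)
    also have "\<dots> = (\<Sum>l<K. p $$ (\<sigma> x, l))"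
    proof (intro sum.cong refl)
      fix l assume "l \<in> {..<K}"
      then have "V l \<noteq> 0" using V_pos[of l] by simp
      then show "V l * (p $$ (\<sigma> x, l) / V l) = p $$ (\<sigma> x, l)" by simp
    qed
    finally show "(\<Sum>y<n. P $$ (x, y)) = 1" using p_sum[OF \<sigma>[OF x]] by simp
  next
    fix x y assume xy: "x < n" "y < n"
    have "pm / n \<le> p $$ (\<sigma> x, \<sigma> y) / V (\<sigma> y)"
      using V_pos[OF \<sigma>[OF xy(2)]] V_le pm pm_le[OF \<sigma>[OF xy(1)] \<sigma>[OF xy(2)]] by (intro frac_le) auto
    then show "pm / n \<le> P $$ (x, y)" using P[OF xy] by simp
    have "p $$ (\<sigma> x, \<sigma> y) / V (\<sigma> y) \<le> 1 / (\<alpha>m * n / 2)"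
      using V_ge[OF \<sigma>[OF xy(2)]] \<alpha>m n p_le[OF \<sigma>[OF xy(1)] \<sigma>[OF xy(2)]] by (intro frac_le) auto
    also have "\<dots> = c1 / n" by (simp add: c1_def)
    finally show "P $$ (x, y) \<le> c1 / n" using P[OF xy] by simp
  qed (use mc n T pm in auto)
  have \<eta>: "\<eta> > 0" using \<alpha>m by (simp add: \<eta>_def)
  have \<gamma>: "\<gamma> > 0" using \<rho> pm \<eta> by (simp add: \<gamma>_def)
  obtain bad0 where bad0: "bad0 \<in> events" "prob bad0 \<le> exp (- d) + 2 * exp (- real n) + 2 / real n ^ 2"
    and few: "\<And>\<omega>. \<omega> \<in> space M \<Longrightarrow> \<omega> \<notin> bad0 \<Longrightarrow>
      (\<Sum>y<n. if (3 * c1 + 2) * d \<le> C \<omega> y then 1 else 0) < n * exp (- d)"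
    and visits: "\<And>\<omega> A. \<omega> \<in> space M \<Longrightarrow> \<omega> \<notin> bad0 \<Longrightarrow> A \<subseteq> {..<n} \<Longrightarrow> \<eta> * n \<le> card A \<Longrightarrow>
      pm * \<eta> / 8 * T \<le> (\<Sum>x\<in>A. R \<omega> x)"
    and form: "\<And>\<omega> G. \<omega> \<in> space M \<Longrightarrow> \<omega> \<notin> bad0 \<Longrightarrow> G \<subseteq> {..<n} \<Longrightarrow>
      (\<And>y. y \<in> G \<Longrightarrow> C \<omega> y < (3 * c1 + 2) * d) \<Longrightarrow>
      form_bounded n (deviation G (N \<omega>) (R \<omega>) (\<lambda>x y. P $$ (x, y))) (deviation_const c1 * sqrt d)"
    and row: "\<And>\<omega> x. \<omega> \<in> space M \<Longrightarrow> x < n \<Longrightarrow> C \<omega> x < (3 * c1 + 2) * d \<Longrightarrow> R \<omega> x \<le> (3 * c1 + 3) * d"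
    by (rule good_event[OF d1 \<eta> d2]) blast
  \<comment> \<open>The outcomes that violate \<open>trimming\<close> are only known to lie in a
    null set; adding that null set to \<open>bad0\<close> keeps the bad set measurable.\<close>
  obtain Z where Z: "{\<omega> \<in> space M. \<not> trimming n T X (\<Gamma> \<omega>) \<omega>} \<subseteq> Z" "emeasure M Z = 0" "Z \<in> events"
    using trim by (rule AE_E)
  have meas: "bad0 \<union> Z \<in> events" using bad0 Z by auto
  have "prob (bad0 \<union> Z) \<le> prob bad0 + prob Z" using bad0 Z by (intro measure_Un_le) auto
  also have "prob Z = 0" using Z by (simp add: measure_def)
  finally have pr: "prob (bad0 \<union> Z) \<le> exp (- d) + 2 * exp (- real n) + 2 / real n ^ 2" using bad0 by linarith
  have A: "trimmed_count_matrix n T X (\<Gamma> \<omega>) \<omega> = mat n n (\<lambda>(x, y). if x \<in> \<Gamma> \<omega> \<and> y \<in> \<Gamma> \<omega> then N \<omega> x y else 0)" for \<omega>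
    by (simp add: trimmed_count_matrix_def)
  have good: "\<Gamma> \<omega> \<subseteq> {..<n} \<and> (\<forall>y\<in>\<Gamma> \<omega>. C \<omega> y < (3 * c1 + 2) * d) \<and>
      (\<forall>l<K. \<eta> * n \<le> card {y. y < n \<and> y \<in> \<Gamma> \<omega> \<and> \<sigma> y = l} \<and> V l \<le> 2 * card {y. y < n \<and> y \<in> \<Gamma> \<omega> \<and> \<sigma> y = l})"
    if w: "\<omega> \<in> space M" "\<omega> \<notin> bad0 \<union> Z" for \<omega>
  proof (intro conjI)
    have tr: "trimming n T X (\<Gamma> \<omega>) \<omega>" using w Z by auto
    show G: "\<Gamma> \<omega> \<subseteq> {..<n}" using measurable_space[OF \<Gamma> w(1)] by simp
    show "\<forall>y\<in>\<Gamma> \<omega>. C \<omega> y < (3 * c1 + 2) * d"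
      using column_count_less_of_trimming[OF tr G] few[OF w(1)] w(2) by blast
    show "\<forall>l<K. \<eta> * n \<le> card {y. y < n \<and> y \<in> \<Gamma> \<omega> \<and> \<sigma> y = l} \<and> V l \<le> 2 * card {y. y < n \<and> y \<in> \<Gamma> \<omega> \<and> \<sigma> y = l}"
    proof (intro allI impI)
      fix l assume l: "l < K"
      let ?g = "{y. y < n \<and> y \<in> \<Gamma> \<omega> \<and> \<sigma> y = l}"
      have "card (cluster n \<sigma> l) \<le> card (?g \<union> ({..<n} - \<Gamma> \<omega>))"
        by (intro card_mono) (auto simp: cluster_def)
      also have "\<dots> \<le> card ?g + card ({..<n} - \<Gamma> \<omega>)" by (rule card_Un_le)
      finally have "V l \<le> real (card ?g) + real (card ({..<n} - \<Gamma> \<omega>))" by (simp add: V_def)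
      moreover have "real (card ({..<n} - \<Gamma> \<omega>)) \<le> \<alpha>m / 4 * n"
      proof -
        have "card ({..<n} - \<Gamma> \<omega>) = nat \<lfloor>real n * exp (- d)\<rfloor>" using tr by (simp add: trimming_def)
        then have "real (card ({..<n} - \<Gamma> \<omega>)) \<le> real n * exp (- d)" by simp
        also have "\<dots> \<le> real n * (\<alpha>m / 4)" using d3 by (intro mult_left_mono) auto
        finally show ?thesis by (simp add: mult.commute)
      qed
      ultimately show "\<eta> * n \<le> card ?g \<and> V l \<le> 2 * card ?g"
        using V_ge[OF l] by (simp add: \<eta>_def)
    qed
  qed
  show thesis
  proof (rule that[OF meas pr])
    fix \<omega> i assume w: "\<omega> \<in> space M" "\<omega> \<notin> bad0 \<union> Z" and i: "i \<in> {1..K}"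
    have w0: "\<omega> \<notin> bad0" using w by simp
    note g = good[OF w]
    show "sqrt \<gamma> * d \<le> singular_value (trimmed_count_matrix n T X (\<Gamma> \<omega>) \<omega>) i \<and>
      singular_value (trimmed_count_matrix n T X (\<Gamma> \<omega>) \<omega>) i \<le> (3 * c1 + 3) * d"
    proof
      show "sqrt \<gamma> * d \<le> singular_value (trimmed_count_matrix n T X (\<Gamma> \<omega>) \<omega>) i"
        unfolding A
      proof (rule singular_value_block_ge[where c = "deviation_const c1 * sqrt d" and r = "R \<omega>" and V = V and \<sigma> = \<sigma>
            and \<rho> = \<rho> and K = K and \<beta> = "pm * \<eta> / 8 * T" and Q = "\<lambda>x y. P $$ (x, y)" and p = "\<lambda>k l. p $$ (k, l)"])
        show "pm * \<eta> / 8 * T \<le> (\<Sum>x\<in>{y. y < n \<and> y \<in> \<Gamma> \<omega> \<and> \<sigma> y = k}. R \<omega> x)" if "k < K" for k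
          using g that by (intro visits[OF w(1) w0]) auto
        show "(sqrt \<gamma> * d)\<^sup>2 + (deviation_const c1 * sqrt d)\<^sup>2 \<le> \<rho> * (pm * \<eta> / 8 * T)\<^sup>2 / (8 * (real n)\<^sup>2)"
        proof -
          have "(deviation_const c1)\<^sup>2 * d \<le> \<gamma> * d * d" using d4 by (intro mult_right_mono) auto
          moreover have "(sqrt \<gamma> * d)\<^sup>2 = \<gamma> * d * d"
            using \<gamma> by (simp only: power_mult_distrib real_sqrt_pow2 less_imp_le) (simp only: power2_eq_square mult.assoc)
          moreover have "(deviation_const c1 * sqrt d)\<^sup>2 = (deviation_const c1)\<^sup>2 * d"
            using d1 by (simp add: power_mult_distrib)
          ultimately have "(sqrt \<gamma> * d)\<^sup>2 + (deviation_const c1 * sqrt d)\<^sup>2 \<le> 2 * \<gamma> * d\<^sup>2"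
            unfolding power2_eq_square[of d] by linarith
          also have "\<dots> = \<rho> * (pm * \<eta> / 8 * T)\<^sup>2 / (8 * (real n)\<^sup>2)"
            by (simp add: \<gamma>_def power_mult_distrib power_divide)
          finally show ?thesis .
        qed
      qed (use g i Kn L \<rho> pm \<eta> \<gamma> \<sigma> P V_pos inj form[OF w(1) w0] in auto)
      \<comment> \<open>The upper bound is read off from the line sums, which are of order
        \<open>d\<close> after trimming.\<close>
      have "singular_value (mat n n (\<lambda>(x, y). if x \<in> \<Gamma> \<omega> \<and> y \<in> \<Gamma> \<omega> then N \<omega> x y else 0)) i \<le> (3 * c1 + 3) * d"
      proof (rule singular_value_le_line_sums)
        have B: "0 < (3 * c1 + 3) * d" using c1_pos n T by simp
        then show "0 < (3 * c1 + 3) * d" .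
        show "(\<Sum>y<n. if x \<in> \<Gamma> \<omega> \<and> y \<in> \<Gamma> \<omega> then N \<omega> x y else 0) \<le> (3 * c1 + 3) * d" if x: "x < n" for x
        proof (cases "x \<in> \<Gamma> \<omega>")
          case True
          have "(\<Sum>y<n. if x \<in> \<Gamma> \<omega> \<and> y \<in> \<Gamma> \<omega> then N \<omega> x y else 0) \<le> R \<omega> x" by (intro sum_mono) auto
          also have "\<dots> \<le> (3 * c1 + 3) * d" using g True by (intro row[OF w(1) x]) auto
          finally show ?thesis .
        qed (use B in simp)
        show "(\<Sum>x<n. if x \<in> \<Gamma> \<omega> \<and> y \<in> \<Gamma> \<omega> then N \<omega> x y else 0) \<le> (3 * c1 + 3) * d" if y: "y < n" for y
        proof (cases "y \<in> \<Gamma> \<omega>")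
          case True
          have "(\<Sum>x<n. if x \<in> \<Gamma> \<omega> \<and> y \<in> \<Gamma> \<omega> then N \<omega> x y else 0) \<le> (\<Sum>x<n. N \<omega> x y)" by (intro sum_mono) auto
          also have "\<dots> = C \<omega> y" by (simp add: column_count_def)
          also have "\<dots> \<le> (3 * c1 + 2) * d" using g True by (auto intro: less_imp_le)
          also have "\<dots> \<le> (3 * c1 + 3) * d" using d1 by (intro mult_right_mono) auto
          finally show ?thesis .
        qed (use B in simp)
      qed (use i Kn in auto)
      then show "singular_value (trimmed_count_matrix n T X (\<Gamma> \<omega>) \<omega>) i \<le> (3 * c1 + 3) * d"
        unfolding A .
    qed
  next
    fix \<omega> i assume w: "\<omega> \<in> space M" "\<omega> \<notin> bad0 \<union> Z" and i: "i \<in> {K<..n}"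
    have w0: "\<omega> \<notin> bad0" using w by simp
    note g = good[OF w]
    have "singular_value (trimmed_count_matrix n T X (\<Gamma> \<omega>) \<omega>) i \<le> deviation_const c1 * sqrt d"
      unfolding A
      by (rule singular_value_block_le[where K = K and \<sigma> = \<sigma> and r = "R \<omega>" and Q = "\<lambda>x y. P $$ (x, y)"
            and h = "\<lambda>x l. p $$ (\<sigma> x, l) / V l"])
         (use g i L \<sigma> P form[OF w(1) w0] in auto)
    moreover have "0 \<le> singular_value (trimmed_count_matrix n T X (\<Gamma> \<omega>) \<omega>) i"
      by (rule singular_value_nonneg[of _ n]) (use i in \<open>auto simp: A\<close>)
    ultimately show "\<bar>singular_value (trimmed_count_matrix n T X (\<Gamma> \<omega>) \<omega>) i\<bar> \<le> deviation_const c1 * sqrt d"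
      by simp
  qed
qed

section \<open>From fixed \<open>n\<close> to the asymptotic statement\<close>

lemma bigo_probI:
  assumes C: "C > 0"
    and ev: "\<And>\<epsilon>. \<epsilon> > 0 \<Longrightarrow> \<forall>\<^sub>F n in sequentially. \<P>(\<omega> in M n. C * \<bar>Y n \<omega>\<bar> < \<bar>X n \<omega>\<bar>) \<le> \<epsilon>"
  shows "bigo_prob M X Y"
  unfolding bigo_prob_def
proof (intro allI impI)
  fix \<epsilon> :: real assume "\<epsilon> > 0"
  from ev[OF this] obtain n0 where "\<And>n. n \<ge> n0 \<Longrightarrow> \<P>(\<omega> in M n. C * \<bar>Y n \<omega>\<bar> < \<bar>X n \<omega>\<bar>) \<le> \<epsilon>"
    unfolding eventually_sequentially by blast
  then have "\<forall>n>Suc n0. \<P>(\<omega> in M n. C * \<bar>Y n \<omega>\<bar> < \<bar>X n \<omega>\<bar>) \<le> \<epsilon>" by simp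
  with C zero_less_Suc[of n0] show "\<exists>C>0. \<exists>n0>0. \<forall>n>n0. \<P>(\<omega> in M n. C * \<bar>Y n \<omega>\<bar> < \<bar>X n \<omega>\<bar>) \<le> \<epsilon>"
    by blast
qed

text \<open>Rounding down the other clusters only enlarges cluster 0. Elsewhere it loses at most 1,
  which is at most half of \<open>m * n\<close>.\<close>

lemma cluster_size_ge:
  assumes sum: "(\<Sum>k<K. \<alpha> k) = 1" and m: "\<And>k. k < K \<Longrightarrow> m \<le> \<alpha> k" and m0: "m > 0"
    and n: "2 \<le> m * n" and k: "k < K"
  shows "m * n / 2 \<le> cluster_size K \<alpha> n k"
proof (cases "k = 0")
  case True
  have "real (\<Sum>l\<in>{1..<K}. nat \<lfloor>real n * \<alpha> l\<rfloor>) \<le> (\<Sum>l\<in>{1..<K}. real n * \<alpha> l)"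
    unfolding of_nat_sum
  proof (rule sum_mono)
    fix l assume "l \<in> {1..<K}"
    then have "0 \<le> \<alpha> l" using m[of l] m0 by simp
    then have "0 \<le> real n * \<alpha> l" by simp
    then show "real (nat \<lfloor>real n * \<alpha> l\<rfloor>) \<le> real n * \<alpha> l" by simp
  qed
  also have "\<dots> = real n * ((\<Sum>k<K. \<alpha> k) - \<alpha> 0)"
  proof -
    have "{..<K} = insert 0 {1..<K}" using k by auto
    then have "(\<Sum>k<K. \<alpha> k) = \<alpha> 0 + (\<Sum>k\<in>{1..<K}. \<alpha> k)" by simp
    then show ?thesis by (simp add: sum_distrib_left)
  qed
  also have "\<dots> = real n - \<alpha> 0 * n" unfolding sum by (simp add: algebra_simps)
  finally have "\<alpha> 0 * n \<le> real (n - (\<Sum>l\<in>{1..<K}. nat \<lfloor>real n * \<alpha> l\<rfloor>))" by linarith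
  moreover have "m * n \<le> \<alpha> 0 * n" using m[of 0] k by (intro mult_right_mono) auto
  moreover have "cluster_size K \<alpha> n k = n - (\<Sum>l\<in>{1..<K}. nat \<lfloor>real n * \<alpha> l\<rfloor>)"
    using True by (simp add: cluster_size_def)
  ultimately show ?thesis using n by linarith
next
  case False
  have "m * n \<le> \<alpha> k * n" using m[OF k] by (intro mult_right_mono) auto
  then have "m * n \<le> real n * \<alpha> k" by (simp only: mult.commute)
  moreover have "real n * \<alpha> k - 1 \<le> real (nat \<lfloor>real n * \<alpha> k\<rfloor>)" by linarith
  ultimately have "m * n / 2 \<le> real (nat \<lfloor>real n * \<alpha> k\<rfloor>)" using n by linarith
  then show ?thesis using False by (simp add: cluster_size_def)
qed

theorem corollary4:
  fixes K :: nat and \<alpha> :: "nat \<Rightarrow> real" and p :: "real mat"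
    and T :: "nat \<Rightarrow> nat"
    and \<sigma> :: "nat \<Rightarrow> nat \<Rightarrow> nat"
    and M :: "nat \<Rightarrow> 'a measure"
    and X :: "nat \<Rightarrow> nat \<Rightarrow> 'a \<Rightarrow> nat"
    and \<Gamma> :: "nat \<Rightarrow> 'a \<Rightarrow> nat set"
  assumes "bmc_parameters K \<alpha> p"
    and "\<And>n. T n > 0"
    and "filterlim (\<lambda>n. real (T n) / real n) at_top sequentially"
    and "\<And>n. (\<forall>k<K. cluster_size K \<alpha> n k > 0) \<Longrightarrow> cluster_map K \<alpha> n (\<sigma> n)"
    and "\<And>n. (\<forall>k<K. cluster_size K \<alpha> n k > 0) \<Longrightarrow> block_markov_chain (M n) p n (\<sigma> n) (X n)"
    and "\<And>n. (\<forall>k<K. cluster_size K \<alpha> n k > 0) \<Longrightarrow>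
           \<Gamma> n \<in> measurable (M n) (count_space (Pow {..<n}))"
    and "\<And>n. (\<forall>k<K. cluster_size K \<alpha> n k > 0) \<Longrightarrow>
           (AE \<omega> in M n. trimming n (T n) (X n) (\<Gamma> n \<omega>) \<omega>)"
  shows "(\<forall>i\<in>{1..K}.
            bigtheta_prob M
              (\<lambda>n \<omega>. singular_value (trimmed_count_matrix n (T n) (X n) (\<Gamma> n \<omega>) \<omega>) i)
              (\<lambda>n \<omega>. real (T n) / real n)) \<and>
         (\<forall>i :: nat \<Rightarrow> nat. (\<forall>\<^sub>F n in sequentially. i n \<in> {K<..n}) \<longrightarrow>
            bigo_prob M
              (\<lambda>n \<omega>. singular_value (trimmed_count_matrix n (T n) (X n) (\<Gamma> n \<omega>) \<omega>) (i n))
              (\<lambda>n \<omega>. sqrt (real (T n) / real n)))"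
proof -
  have K: "K \<ge> 1" and p: "p \<in> carrier_mat K K" and p_pos: "\<And>k l. k < K \<Longrightarrow> l < K \<Longrightarrow> 0 < p $$ (k, l)"
    and \<alpha>: "(\<Sum>k<K. \<alpha> k) = 1" "\<And>k. k < K \<Longrightarrow> \<alpha> k > 0" and rank: "vec_space.rank K p = K"
    using assms(1) by (auto simp: bmc_parameters_def)
  have K0: "{..<K} \<noteq> {}" using K by (auto simp: lessThan_empty_iff)
  define \<alpha>m where "\<alpha>m = Min (\<alpha> ` {..<K})"
  have \<alpha>m: "\<alpha>m > 0" "\<And>k. k < K \<Longrightarrow> \<alpha>m \<le> \<alpha> k"
    using K0 \<alpha>(2) by (auto simp: \<alpha>m_def)
  define pm where "pm = Min ((\<lambda>z. p $$ z) ` ({..<K} \<times> {..<K}))"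
  have pm: "pm > 0" "\<And>k l. k < K \<Longrightarrow> l < K \<Longrightarrow> pm \<le> p $$ (k, l)"
  proof -
    have "pm \<in> (\<lambda>z. p $$ z) ` ({..<K} \<times> {..<K})" unfolding pm_def using K0 by (intro Min_in) auto
    then show "pm > 0" using p_pos by auto
    show "pm \<le> p $$ (k, l)" if "k < K" "l < K" for k l
      unfolding pm_def using that by (intro Min_le) auto
  qed
  obtain \<rho> where \<rho>: "\<rho> > 0"
    "\<And>z. \<rho> * (\<Sum>l<K. (z l)\<^sup>2) \<le> (\<Sum>k<K. (\<Sum>l<K. p $$ (k, l) * z l)\<^sup>2)"
    by (rule full_rank_lower_bound[OF p rank], rule that)
  define c1 where "c1 = 2 / \<alpha>m"
  define \<eta> where "\<eta> = \<alpha>m / 4"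
  define \<gamma> where "\<gamma> = \<rho> * (pm * \<eta> / 8)\<^sup>2 / 16"
  define L where "L = deviation_const c1"
  have c1: "c1 > 0" and \<eta>: "\<eta> > 0" using \<alpha>m by (simp_all add: c1_def \<eta>_def)
  have \<gamma>: "\<gamma> > 0" using \<rho> pm \<eta> by (simp add: \<gamma>_def)
  have L: "L > 0" using c1 by (auto simp: L_def deviation_const_def Let_def intro!: add_pos_pos add_nonneg_pos)
  let ?d = "\<lambda>n. real (T n) / real n"
  let ?s = "\<lambda>n \<omega> i. singular_value (trimmed_count_matrix n (T n) (X n) (\<Gamma> n \<omega>) \<omega>) i"
  \<comment> \<open>One bad set serves all indices at once, with constants independent of
    \<open>n\<close> and \<open>\<epsilon>\<close>; this is what admits index sequences
    \<open>i n\<close> in the second claim.\<close>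
  define event where "event \<epsilon> n bad \<longleftrightarrow> prob_space (M n) \<and> 1 \<le> ?d n \<and> bad \<in> sets (M n) \<and> measure (M n) bad \<le> \<epsilon> \<and>
      (\<forall>\<omega>\<in>space (M n) - bad. (\<forall>i\<in>{1..K}. sqrt \<gamma> * ?d n \<le> ?s n \<omega> i \<and> ?s n \<omega> i \<le> (3 * c1 + 3) * ?d n) \<and>
        (\<forall>i\<in>{K<..n}. \<bar>?s n \<omega> i\<bar> \<le> L * sqrt (?d n)))" for \<epsilon> :: real and n bad
  have key: "\<forall>\<^sub>F n in sequentially. \<exists>bad. event \<epsilon> n bad" if \<epsilon>: "\<epsilon> > 0" for \<epsilon>
  proof -
    have dlim: "\<forall>\<^sub>F n in sequentially. D \<le> ?d n" for D
      using assms(3) by (simp add: filterlim_at_top)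
    have nlim: "\<forall>\<^sub>F n in sequentially. D \<le> real n" for D
      using filterlim_real_sequentially by (simp add: filterlim_at_top)
    have exp0: "(\<lambda>n. exp (- ?d n)) \<longlonglongrightarrow> 0"
      by (intro filterlim_compose[OF exp_at_bot] filterlim_compose[OF filterlim_uminus_at_bot_at_top] assms(3))
    have "(\<lambda>n. exp (- real n)) \<longlonglongrightarrow> 0" "(\<lambda>n. 2 / real n ^ 2) \<longlonglongrightarrow> 0" by real_asymp+
    then have "(\<lambda>n. exp (- ?d n) + 2 * exp (- real n) + 2 / real n ^ 2) \<longlonglongrightarrow> 0 + 2 * 0 + 0"
      by (intro tendsto_add tendsto_mult exp0 tendsto_const)
    then have "\<forall>\<^sub>F n in sequentially. exp (- ?d n) + 2 * exp (- real n) + 2 / real n ^ 2 < \<epsilon>"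
      using \<epsilon> by (intro order_tendstoD(2)) auto
    moreover have "\<forall>\<^sub>F n in sequentially. exp (- ?d n) < \<alpha>m / 4"
      using \<alpha>m by (intro order_tendstoD(2)[OF exp0]) auto
    moreover note dlim[of 1] dlim[of "8 / (pm * \<eta>)"] dlim[of "L\<^sup>2 / \<gamma>"] nlim[of "2 / \<alpha>m"] eventually_ge_at_top[of K]
    ultimately show ?thesis
    proof eventually_elim
      case (elim n)
      have n2: "2 \<le> \<alpha>m * n" using elim(6) \<alpha>m by (simp add: field_simps)
      have size: "\<alpha>m * n / 2 \<le> cluster_size K \<alpha> n k" if "k < K" for k
        by (rule cluster_size_ge[OF \<alpha>(1) \<alpha>m(2,1) n2 that])
      \<comment> \<open>The assumptions on the chain and on the trimming are conditional on nonempty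
        clusters; \<open>2 \<le> \<alpha>m * n\<close> provides these.\<close>
      have pos: "\<forall>k<K. cluster_size K \<alpha> n k > 0"
      proof (intro allI impI)
        fix k assume "k < K"
        from size[OF this] n2 have "0 < real (cluster_size K \<alpha> n k)" by linarith
        then show "0 < cluster_size K \<alpha> n k" by simp
      qed
      have d2: "8 \<le> pm * \<eta> * ?d n" using elim(4) pm \<eta> by (simp add: divide_le_eq mult.commute mult.left_commute)
      have d4: "L\<^sup>2 \<le> \<gamma> * ?d n" using elim(5) \<gamma> by (simp add: divide_le_eq mult.commute)
      have ps: "prob_space (M n)"
        using assms(5)[OF pos] by (auto simp: block_markov_chain_def markov_chain_def)
      obtain bad where bad: "bad \<in> sets (M n)"
        "measure (M n) bad \<le> exp (- ?d n) + 2 * exp (- real n) + 2 / real n ^ 2"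
        "\<And>\<omega> i. \<omega> \<in> space (M n) \<Longrightarrow> \<omega> \<notin> bad \<Longrightarrow> i \<in> {1..K} \<Longrightarrow>
          sqrt \<gamma> * ?d n \<le> ?s n \<omega> i \<and> ?s n \<omega> i \<le> (3 * c1 + 3) * ?d n"
        "\<And>\<omega> i. \<omega> \<in> space (M n) \<Longrightarrow> \<omega> \<notin> bad \<Longrightarrow> i \<in> {K<..n} \<Longrightarrow> \<bar>?s n \<omega> i\<bar> \<le> L * sqrt (?d n)"
        using trimmed_spectrum[OF assms(1) \<alpha>m(1) pm(1) \<rho>(1) pm(2) \<rho>(2) elim(7) assms(2) size
          assms(4)[OF pos] assms(5)[OF pos] assms(6)[OF pos] assms(7)[OF pos] elim(3)
          d2[unfolded \<eta>_def] less_imp_le[OF elim(2)] d4[unfolded L_def \<gamma>_def \<eta>_def c1_def]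
          less_imp_le[OF L[unfolded L_def c1_def]]]
        unfolding \<gamma>_def \<eta>_def c1_def L_def by metis
      then have "event \<epsilon> n bad" using ps elim(1,3) by (auto simp: event_def)
      then show ?case by blast
    qed
  qed
  have main: "\<forall>\<^sub>F n in sequentially. \<P>(\<omega> in M n. Q n \<omega>) \<le> \<epsilon>"
    if \<epsilon>: "\<epsilon> > 0" and Q: "\<forall>\<^sub>F n in sequentially. \<forall>bad \<omega>. event \<epsilon> n bad \<longrightarrow> \<omega> \<in> space (M n) - bad \<longrightarrow> \<not> Q n \<omega>"
    for \<epsilon> Q
    using key[OF \<epsilon>] Q
  proof eventually_elim
    case (elim n)
    then obtain bad where bad: "event \<epsilon> n bad" by blast
    interpret prob_space "M n" using bad by (simp add: event_def)
    \<comment> \<open>Inclusion in the measurable set \<open>bad\<close> bounds the probability even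
      if the event of \<open>Q\<close> is not known to be measurable.\<close>
    have "{\<omega> \<in> space (M n). Q n \<omega>} \<subseteq> bad" using elim(2) bad by blast
    then have "\<P>(\<omega> in M n. Q n \<omega>) \<le> measure (M n) bad"
      using bad by (intro finite_measure_mono) (auto simp: event_def)
    also have "\<dots> \<le> \<epsilon>" using bad by (simp add: event_def)
    finally show ?case .
  qed
  show ?thesis
  proof (intro conjI ballI allI impI)
    fix i assume i: "i \<in> {1..K}"
    have "bigo_prob M (\<lambda>n \<omega>. ?s n \<omega> i) (\<lambda>n \<omega>. ?d n)"
    proof (rule bigo_probI[of "3 * c1 + 3"])
      fix \<epsilon> :: real assume "\<epsilon> > 0"
      then show "\<forall>\<^sub>F n in sequentially. \<P>(\<omega> in M n. (3 * c1 + 3) * \<bar>?d n\<bar> < \<bar>?s n \<omega> i\<bar>) \<le> \<epsilon>"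
      proof (rule main, intro always_eventually allI impI)
        fix n bad \<omega> assume e: "event \<epsilon> n bad" and w: "\<omega> \<in> space (M n) - bad"
        have s: "sqrt \<gamma> * ?d n \<le> ?s n \<omega> i" "?s n \<omega> i \<le> (3 * c1 + 3) * ?d n"
          using e w i unfolding event_def by blast+
        have "0 \<le> sqrt \<gamma> * ?d n" using \<gamma> by simp
        then have "\<bar>?s n \<omega> i\<bar> = ?s n \<omega> i" using s(1) by linarith
        then show "\<not> (3 * c1 + 3) * \<bar>?d n\<bar> < \<bar>?s n \<omega> i\<bar>" using s(2) by simp
      qed
    qed (use c1 in simp)
    moreover have "bigo_prob M (\<lambda>n \<omega>. ?d n) (\<lambda>n \<omega>. ?s n \<omega> i)"
    proof (rule bigo_probI[of "1 / sqrt \<gamma>"])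
      fix \<epsilon> :: real assume "\<epsilon> > 0"
      then show "\<forall>\<^sub>F n in sequentially. \<P>(\<omega> in M n. 1 / sqrt \<gamma> * \<bar>?s n \<omega> i\<bar> < \<bar>?d n\<bar>) \<le> \<epsilon>"
      proof (rule main, intro always_eventually allI impI)
        fix n bad \<omega> assume e: "event \<epsilon> n bad" and w: "\<omega> \<in> space (M n) - bad"
        have "sqrt \<gamma> * ?d n \<le> ?s n \<omega> i" using e w i unfolding event_def by blast
        then have "sqrt \<gamma> * \<bar>?d n\<bar> \<le> \<bar>?s n \<omega> i\<bar>" by simp
        then have "\<bar>?d n\<bar> \<le> \<bar>?s n \<omega> i\<bar> / sqrt \<gamma>" using \<gamma> by (simp add: pos_le_divide_eq mult.commute)
        then show "\<not> 1 / sqrt \<gamma> * \<bar>?s n \<omega> i\<bar> < \<bar>?d n\<bar>" by simp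
      qed
    qed (use \<gamma> in simp)
    ultimately show "bigtheta_prob M (\<lambda>n \<omega>. ?s n \<omega> i) (\<lambda>n \<omega>. ?d n)"
      by (simp add: bigtheta_prob_def)
  next
    fix i :: "nat \<Rightarrow> nat" assume i: "\<forall>\<^sub>F n in sequentially. i n \<in> {K<..n}"
    show "bigo_prob M (\<lambda>n \<omega>. ?s n \<omega> (i n)) (\<lambda>n \<omega>. sqrt (?d n))"
    proof (rule bigo_probI[OF L])
      fix \<epsilon> :: real assume \<epsilon>: "\<epsilon> > 0"
      show "\<forall>\<^sub>F n in sequentially. \<P>(\<omega> in M n. L * \<bar>sqrt (?d n)\<bar> < \<bar>?s n \<omega> (i n)\<bar>) \<le> \<epsilon>"
      proof (rule main[OF \<epsilon>])
        show "\<forall>\<^sub>F n in sequentially. \<forall>bad \<omega>. event \<epsilon> n bad \<longrightarrow> \<omega> \<in> space (M n) - bad \<longrightarrow>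
            \<not> L * \<bar>sqrt (?d n)\<bar> < \<bar>?s n \<omega> (i n)\<bar>"
          using i
        proof eventually_elim
          case (elim n)
          have "\<bar>?s n \<omega> (i n)\<bar> \<le> L * \<bar>sqrt (?d n)\<bar>" if "event \<epsilon> n bad" "\<omega> \<in> space (M n) - bad" for bad \<omega>
          proof -
            have "\<bar>?s n \<omega> (i n)\<bar> \<le> L * sqrt (?d n)" using that elim unfolding event_def by blast
            then show ?thesis by simp
          qed
          then show ?case by (auto simp: not_less)
        qed
      qed
    qed
  qed
qed

end
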